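(* There is a completion of $\mathsf{IOpen}$ that is axiomatisable by a single sentence together with an infinite set of $\Sigma_1$-sentences.
   Context: The language of arithmetic has signature $\{0,1,+,\times,<\}$. $\mathsf{PA}^-$ is the theory of non-negative parts of discretely ordered commutative rings, axiomatised by (the universal closures of): $(x+y)+z=x+(y+z)$; $x+y=y+x$; $(xy)z=x(yz)$; $xy=yx$; $x(y+z)=xy+xz$; $x+0=x\wedge x\cdot 0=0$; $x\cdot 1=x$; $(x<y\wedge y<z)\to x<z$; $\neg\,x<x$; $x<y\vee x=y\vee y<x$; $x<y\to x+z<y+z$; $(0<z\wedge x<y)\to xz<yz$; $x<y\to\exists z\,(x+z=y)$; $0<1\wedge(0<x\to(x=1\vee 1<x))$; $x=0\vee 0<x$. $\mathsf{IOpen}$ is $\mathsf{PA}^-$ plus the induction scheme for quantifier-free formulas (parameters allowed). A formula is $\Delta_0$ if all its quantifiers are bounded (of the form $\forall y\le x$, $\exists y\le x$). A $\Sigma_1$-formula is a $\Delta_0$-formula prefixed by a (possibly empty) block of existential quantifiers. A completion of a theory $T$ is a consistent complete theory in the same language extending $T$. *)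

theory Defs
  imports Main
begin

section \<open>First-order logic with equality in the language of arithmetic\<close>

text \<open>Variables are de Bruijn indices: in the body of a quantifier, index 0 is the bound
  variable and index \<open>Suc i\<close> is what index \<open>i\<close> is outside.\<close>

datatype tm =
    Var nat
  | Zero    ("\<^bold>0")
  | One     ("\<^bold>1")
  | Add tm tm  (infixl "\<^bold>+" 85)
  | Mul tm tm  (infixl "\<^bold>*" 90)

datatype fm =
    Eq tm tm    (infix "\<^bold>=" 75)
  | Less tm tm  (infix "\<^bold><" 75)
  | Fls         ("\<^bold>\<bottom>")
  | Imp fm fm   (infixr "\<^bold>\<longrightarrow>" 55)
  | Conj fm fm  (infixr "\<^bold>\<and>" 65)
  | Disj fm fm  (infixr "\<^bold>\<or>" 60)
  | All fm
  | Ex fm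

abbreviation Neg :: "fm \<Rightarrow> fm"  ("\<^bold>\<not> _" [70] 70)
  where "\<^bold>\<not> p \<equiv> p \<^bold>\<longrightarrow> \<^bold>\<bottom>"

abbreviation Le :: "tm \<Rightarrow> tm \<Rightarrow> fm"  (infix "\<^bold>\<le>" 75)
  where "s \<^bold>\<le> t \<equiv> s \<^bold>< t \<^bold>\<or> s \<^bold>= t"

primrec fv_tm :: "tm \<Rightarrow> nat set" where
  "fv_tm (Var n) = {n}"
| "fv_tm \<^bold>0 = {}"
| "fv_tm \<^bold>1 = {}"
| "fv_tm (s \<^bold>+ t) = fv_tm s \<union> fv_tm t"
| "fv_tm (s \<^bold>* t) = fv_tm s \<union> fv_tm t"

primrec fv :: "fm \<Rightarrow> nat set" where
  "fv (s \<^bold>= t) = fv_tm s \<union> fv_tm t"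
| "fv (s \<^bold>< t) = fv_tm s \<union> fv_tm t"
| "fv \<^bold>\<bottom> = {}"
| "fv (p \<^bold>\<longrightarrow> q) = fv p \<union> fv q"
| "fv (p \<^bold>\<and> q) = fv p \<union> fv q"
| "fv (p \<^bold>\<or> q) = fv p \<union> fv q"
| "fv (All p) = {n. Suc n \<in> fv p}"
| "fv (Ex p) = {n. Suc n \<in> fv p}"

definition sentence :: "fm \<Rightarrow> bool" where
  "sentence p \<longleftrightarrow> fv p = {}"

definition univ_closure :: "fm \<Rightarrow> fm" where
  "univ_closure p = (All ^^ (LEAST k. fv p \<subseteq> {..<k})) p"

text \<open>Simultaneous substitution of terms for the free variables.\<close>

primrec subst_tm :: "(nat \<Rightarrow> tm) \<Rightarrow> tm \<Rightarrow> tm" where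
  "subst_tm \<sigma> (Var n) = \<sigma> n"
| "subst_tm \<sigma> \<^bold>0 = \<^bold>0"
| "subst_tm \<sigma> \<^bold>1 = \<^bold>1"
| "subst_tm \<sigma> (s \<^bold>+ t) = subst_tm \<sigma> s \<^bold>+ subst_tm \<sigma> t"
| "subst_tm \<sigma> (s \<^bold>* t) = subst_tm \<sigma> s \<^bold>* subst_tm \<sigma> t"

definition under_binder :: "(nat \<Rightarrow> tm) \<Rightarrow> nat \<Rightarrow> tm" where
  "under_binder \<sigma> = case_nat (Var 0) (\<lambda>n. subst_tm (\<lambda>i. Var (Suc i)) (\<sigma> n))"

primrec subst :: "(nat \<Rightarrow> tm) \<Rightarrow> fm \<Rightarrow> fm" where
  "subst \<sigma> (s \<^bold>= t) = (subst_tm \<sigma> s \<^bold>= subst_tm \<sigma> t)"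
| "subst \<sigma> (s \<^bold>< t) = (subst_tm \<sigma> s \<^bold>< subst_tm \<sigma> t)"
| "subst \<sigma> \<^bold>\<bottom> = \<^bold>\<bottom>"
| "subst \<sigma> (p \<^bold>\<longrightarrow> q) = (subst \<sigma> p \<^bold>\<longrightarrow> subst \<sigma> q)"
| "subst \<sigma> (p \<^bold>\<and> q) = (subst \<sigma> p \<^bold>\<and> subst \<sigma> q)"
| "subst \<sigma> (p \<^bold>\<or> q) = (subst \<sigma> p \<^bold>\<or> subst \<sigma> q)"
| "subst \<sigma> (All p) = All (subst (under_binder \<sigma>) p)"
| "subst \<sigma> (Ex p) = Ex (subst (under_binder \<sigma>) p)"

definition lift :: "fm \<Rightarrow> fm" where
  "lift = subst (\<lambda>n. Var (Suc n))"

text \<open>\<open>inst p t\<close> is the instance at \<open>t\<close> of the body \<open>p\<close> of a quantifier; the remaining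
  free indices of \<open>p\<close> drop by one.\<close>

definition inst :: "fm \<Rightarrow> tm \<Rightarrow> fm" where
  "inst p t = subst (case_nat t Var) p"

text \<open>Classical natural deduction with equality. The eigenvariable conditions of \<open>allI\<close> and
  \<open>exE\<close> are expressed by lifting the side formulas, which leaves index 0 fresh.\<close>

inductive derives :: "fm set \<Rightarrow> fm \<Rightarrow> bool"  (infix "\<turnstile>" 50) where
  assm:   "p \<in> \<Gamma> \<Longrightarrow> \<Gamma> \<turnstile> p"
| impI:   "insert p \<Gamma> \<turnstile> q \<Longrightarrow> \<Gamma> \<turnstile> p \<^bold>\<longrightarrow> q"
| impE:   "\<Gamma> \<turnstile> p \<^bold>\<longrightarrow> q \<Longrightarrow> \<Gamma> \<turnstile> p \<Longrightarrow> \<Gamma> \<turnstile> q"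
| ccontr: "insert (\<^bold>\<not> p) \<Gamma> \<turnstile> \<^bold>\<bottom> \<Longrightarrow> \<Gamma> \<turnstile> p"
| conjI:  "\<Gamma> \<turnstile> p \<Longrightarrow> \<Gamma> \<turnstile> q \<Longrightarrow> \<Gamma> \<turnstile> p \<^bold>\<and> q"
| conjE1: "\<Gamma> \<turnstile> p \<^bold>\<and> q \<Longrightarrow> \<Gamma> \<turnstile> p"
| conjE2: "\<Gamma> \<turnstile> p \<^bold>\<and> q \<Longrightarrow> \<Gamma> \<turnstile> q"
| disjI1: "\<Gamma> \<turnstile> p \<Longrightarrow> \<Gamma> \<turnstile> p \<^bold>\<or> q"
| disjI2: "\<Gamma> \<turnstile> q \<Longrightarrow> \<Gamma> \<turnstile> p \<^bold>\<or> q"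
| disjE:  "\<Gamma> \<turnstile> p \<^bold>\<or> q \<Longrightarrow> insert p \<Gamma> \<turnstile> r \<Longrightarrow> insert q \<Gamma> \<turnstile> r \<Longrightarrow> \<Gamma> \<turnstile> r"
| allI:   "lift ` \<Gamma> \<turnstile> p \<Longrightarrow> \<Gamma> \<turnstile> All p"
| allE:   "\<Gamma> \<turnstile> All p \<Longrightarrow> \<Gamma> \<turnstile> inst p t"
| exI:    "\<Gamma> \<turnstile> inst p t \<Longrightarrow> \<Gamma> \<turnstile> Ex p"
| exE:    "\<Gamma> \<turnstile> Ex p \<Longrightarrow> insert p (lift ` \<Gamma>) \<turnstile> lift q \<Longrightarrow> \<Gamma> \<turnstile> q"
| eqI:    "\<Gamma> \<turnstile> t \<^bold>= t"
| eqE:    "\<Gamma> \<turnstile> s \<^bold>= t \<Longrightarrow> \<Gamma> \<turnstile> inst p s \<Longrightarrow> \<Gamma> \<turnstile> inst p t"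

section \<open>Theories\<close>

definition deductive_closure :: "fm set \<Rightarrow> fm set" where
  "deductive_closure A = {p. sentence p \<and> A \<turnstile> p}"

definition is_theory :: "fm set \<Rightarrow> bool" where
  "is_theory T \<longleftrightarrow> deductive_closure T = T"

definition consistent :: "fm set \<Rightarrow> bool" where
  "consistent T \<longleftrightarrow> \<not> T \<turnstile> \<^bold>\<bottom>"

definition complete :: "fm set \<Rightarrow> bool" where
  "complete T \<longleftrightarrow> (\<forall>p. sentence p \<longrightarrow> T \<turnstile> p \<or> T \<turnstile> \<^bold>\<not> p)"

definition completion_of :: "fm set \<Rightarrow> fm set \<Rightarrow> bool" where
  "completion_of U T \<longleftrightarrow> is_theory T \<and> U \<subseteq> T \<and> consistent T \<and> complete T"

definition axiomatised_by :: "fm set \<Rightarrow> fm set \<Rightarrow> bool" where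
  "axiomatised_by T A \<longleftrightarrow> (\<forall>p\<in>A. sentence p) \<and> deductive_closure A = T"

section \<open>Formula classes\<close>

primrec quantifier_free :: "fm \<Rightarrow> bool" where
  "quantifier_free (s \<^bold>= t) = True"
| "quantifier_free (s \<^bold>< t) = True"
| "quantifier_free \<^bold>\<bottom> = True"
| "quantifier_free (p \<^bold>\<longrightarrow> q) = (quantifier_free p \<and> quantifier_free q)"
| "quantifier_free (p \<^bold>\<and> q) = (quantifier_free p \<and> quantifier_free q)"
| "quantifier_free (p \<^bold>\<or> q) = (quantifier_free p \<and> quantifier_free q)"
| "quantifier_free (All p) = False"
| "quantifier_free (Ex p) = False"

text \<open>The bound is a variable other than the quantified one, so its index inside the quantifier
  is a successor.\<close>

inductive delta0 :: "fm \<Rightarrow> bool" where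
  "delta0 (s \<^bold>= t)"
| "delta0 (s \<^bold>< t)"
| "delta0 \<^bold>\<bottom>"
| "delta0 p \<Longrightarrow> delta0 q \<Longrightarrow> delta0 (p \<^bold>\<longrightarrow> q)"
| "delta0 p \<Longrightarrow> delta0 q \<Longrightarrow> delta0 (p \<^bold>\<and> q)"
| "delta0 p \<Longrightarrow> delta0 q \<Longrightarrow> delta0 (p \<^bold>\<or> q)"
| "delta0 p \<Longrightarrow> delta0 (All (Var 0 \<^bold>\<le> Var (Suc i) \<^bold>\<longrightarrow> p))"
| "delta0 p \<Longrightarrow> delta0 (Ex (Var 0 \<^bold>\<le> Var (Suc i) \<^bold>\<and> p))"

inductive sigma1 :: "fm \<Rightarrow> bool" where
  "delta0 p \<Longrightarrow> sigma1 p"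
| "sigma1 p \<Longrightarrow> sigma1 (Ex p)"

section \<open>Arithmetic\<close>

definition PA_minus_axioms :: "fm set" where
  "PA_minus_axioms = (let x = Var 0; y = Var 1; z = Var 2 in univ_closure `
    {(x \<^bold>+ y) \<^bold>+ z \<^bold>= x \<^bold>+ (y \<^bold>+ z),
     x \<^bold>+ y \<^bold>= y \<^bold>+ x,
     (x \<^bold>* y) \<^bold>* z \<^bold>= x \<^bold>* (y \<^bold>* z),
     x \<^bold>* y \<^bold>= y \<^bold>* x,
     x \<^bold>* (y \<^bold>+ z) \<^bold>= x \<^bold>* y \<^bold>+ x \<^bold>* z,
     x \<^bold>+ \<^bold>0 \<^bold>= x \<^bold>\<and> x \<^bold>* \<^bold>0 \<^bold>= \<^bold>0,
     x \<^bold>* \<^bold>1 \<^bold>= x,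
     x \<^bold>< y \<^bold>\<and> y \<^bold>< z \<^bold>\<longrightarrow> x \<^bold>< z,
     \<^bold>\<not> (x \<^bold>< x),
     x \<^bold>< y \<^bold>\<or> x \<^bold>= y \<^bold>\<or> y \<^bold>< x,
     x \<^bold>< y \<^bold>\<longrightarrow> x \<^bold>+ z \<^bold>< y \<^bold>+ z,
     \<^bold>0 \<^bold>< z \<^bold>\<and> x \<^bold>< y \<^bold>\<longrightarrow> x \<^bold>* z \<^bold>< y \<^bold>* z,
     x \<^bold>< y \<^bold>\<longrightarrow> Ex (Var 1 \<^bold>+ Var 0 \<^bold>= Var 2),  \<comment> \<open>under \<open>Ex\<close>, \<open>x\<close> and \<open>y\<close> are \<open>Var 1\<close> and \<open>Var 2\<close>\<close>
     \<^bold>0 \<^bold>< \<^bold>1 \<^bold>\<and> (\<^bold>0 \<^bold>< x \<^bold>\<longrightarrow> x \<^bold>= \<^bold>1 \<^bold>\<or> \<^bold>1 \<^bold>< x),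
     x \<^bold>= \<^bold>0 \<^bold>\<or> \<^bold>0 \<^bold>< x})"

text \<open>Induction on index 0 of \<open>p\<close>; the other free variables of \<open>p\<close> are parameters. The inner
  substitution replaces index 0 by its successor and leaves the parameters alone.\<close>

definition induction_axiom :: "fm \<Rightarrow> fm" where
  "induction_axiom p = univ_closure
    (inst p \<^bold>0 \<^bold>\<and> All (p \<^bold>\<longrightarrow> subst (Var(0 := Var 0 \<^bold>+ \<^bold>1)) p) \<^bold>\<longrightarrow> All p)"

definition IOpen :: "fm set" where
  "IOpen = deductive_closure
    (PA_minus_axioms \<union> {induction_axiom p | p. quantifier_free p})"

end

theory Submission
  imports Defs "HOL-Computational_Algebra.Computational_Algebra"
    "HOL-Computational_Algebra.Field_as_Ring" "HOL-Library.Countable"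
begin

text \<open>Let $M$ be the ordered semiring of the non-negative real Puiseux polynomials
  $\sum_i a_i t^{i/k}$ with integer constant term, where $t$ is infinite. A polynomial over $M$ splits over
  the real Puiseux series in $t^{-1}$ into linear and positive quadratic factors (Hensel,
  Newton--Puiseux), and every series has a floor in $M$; so a sign condition can change only at
  finitely many floors, and $M$ satisfies open induction.

  For a monomial $v = c t^q$ with $0 < q \le 1$ the pair $(v, x)$ with $x \le t$ codes the element $y$
  with $x = y(t := v)$. Every element has codes, because $q$ may be taken small. Monomials, real
  constants, and the coincidence of two codes are definable from divisibility with all quantifiers
  bounded by some $B > t^5$, so $M$ has a copy of itself below $B$ with $\Delta_0$-definable
  operations. One sentence states that such $t$ and $B$ exist and that, for all of them, the coding
  is an isomorphism. Modulo this sentence every sentence is equivalent to its relativisation to the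
  copy, prefixed by $\exists B\,t$, which is $\Sigma_1$. Hence that sentence and the true
  $\Sigma_1$-sentences axiomatise the theory of $M$.\<close>

text \<open>Composition with a monomial has no Delta_0 definition at hand. What can be written down
  is the value of an element at a point, as a congruence modulo \<open>t * w - s\<close>, whose zero
  is the point where the monomial \<open>w\<close> takes a prescribed real value. An element of M is
  a function on the positive reals and is determined by its values; so equality of codes becomes a
  statement about all pairs of values, with witnesses bounded by a small power of \<open>t\<close>.

  Real coefficients and rational exponents make M closed under composition with monomials, which is
  the source of its self-similarity. The integral constant term makes M discrete, but it also
  obstructs division by linear factors, hence the extra factors \<open>t\<close> in the formulas.

  Comparing a code with an arbitrary element needs a bound that depends on that element, so
  faithfulness of the coding is not Delta_0. It goes into the single sentence, for all good pairs,
  and only the test \<open>GoodF\<close> enters the Sigma_1 sentences. Therefore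
  \<open>GoodF\<close> may hold in M of infinite monomials only.\<close>

unbundle fps_syntax
notation fls_nth (infixl "$$" 75)

section \<open>Hensel lifting\<close>

locale comm_ring_hom =
  fixes hom :: "'a::comm_ring_1 \<Rightarrow> 'b::comm_ring_1"
  assumes hom_add: "hom (x + y) = hom x + hom y"
    and hom_mult: "hom (x * y) = hom x * hom y"
    and hom_one: "hom 1 = 1"
begin

lemma hom_zero: "hom 0 = 0"
  using hom_add[of 0 0] by simp

lemma hom_uminus: "hom (- x) = - hom x"
  using hom_add[of x "- x"] by (simp add: hom_zero eq_neg_iff_add_eq_0 add.commute)

lemma hom_diff: "hom (x - y) = hom x - hom y"
  using hom_add[of x "- y"] by (simp add: hom_uminus)

lemma hom_sum: "hom (sum f A) = (\<Sum>x\<in>A. hom (f x))"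
  by (induction A rule: infinite_finite_induct) (simp_all add: hom_zero hom_add)

lemma hom_power: "hom (x ^ n) = hom x ^ n"
  by (induction n) (simp_all add: hom_one hom_mult)

lemma map_poly_pCons: "map_poly hom (pCons a p) = pCons (hom a) (map_poly hom p)"
  by (rule poly_eqI) (simp add: coeff_map_poly hom_zero coeff_pCons split: nat.split)

lemma map_poly_add: "map_poly hom (p + q) = map_poly hom p + map_poly hom q"
  by (rule poly_eqI) (simp add: coeff_map_poly hom_zero hom_add)

lemma map_poly_mult: "map_poly hom (p * q) = map_poly hom p * map_poly hom q"
  by (rule poly_eqI) (simp add: coeff_map_poly hom_zero hom_mult hom_sum coeff_mult)

lemma map_poly_smult: "map_poly hom (smult c q) = smult (hom c) (map_poly hom q)"
  by (rule poly_eqI) (simp add: coeff_map_poly hom_zero hom_mult)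

lemma map_poly_pcompose: "map_poly hom (pcompose p q) = pcompose (map_poly hom p) (map_poly hom q)"
  by (induction p) (simp_all add: map_poly_pCons pcompose_pCons map_poly_add map_poly_mult hom_zero)

lemma hom_poly: "hom (poly p x) = poly (map_poly hom p) (hom x)"
  by (induction p) (simp_all add: map_poly_pCons hom_zero hom_add hom_mult)

end

text \<open>A polynomial over power series is read as a power series whose coefficients are
  polynomials; \<open>layer j\<close> is the one of order \<open>j\<close>.\<close>

definition layer :: "nat \<Rightarrow> 'a::comm_ring_1 fps poly \<Rightarrow> 'a poly" where
  "layer j P = map_poly (\<lambda>f. fps_nth f j) P"

lemma coeff_layer [simp]: "coeff (layer j P) i = fps_nth (coeff P i) j"
  by (simp add: layer_def coeff_map_poly)

lemma layer_mult: "layer n (P * Q) = (\<Sum>a\<le>n. layer a P * layer (n - a) Q)"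
proof (rule poly_eqI)
  fix i
  have "coeff (layer n (P * Q)) i = (\<Sum>b\<le>i. \<Sum>a\<le>n. coeff P b $ a * coeff Q (i - b) $ (n - a))"
    by (simp add: coeff_mult fps_sum_nth fps_mult_nth atLeast0AtMost)
  also have "\<dots> = (\<Sum>a\<le>n. \<Sum>b\<le>i. coeff P b $ a * coeff Q (i - b) $ (n - a))"
    by (rule sum.swap)
  also have "\<dots> = coeff (\<Sum>a\<le>n. layer a P * layer (n - a) Q) i"
    by (simp add: coeff_sum coeff_mult)
  finally show "coeff (layer n (P * Q)) i = coeff (\<Sum>a\<le>n. layer a P * layer (n - a) Q) i" .
qed

lemma poly_eqI_layer: "(\<And>j. layer j P = layer j Q) \<Longrightarrow> P = Q"
  by (metis coeff_layer fps_ext poly_eqI)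

text \<open>Bezout gives some solution, and reducing the cofactor of \<open>h\<close> modulo
  \<open>g\<close> bounds \<open>u\<close>. The bound on \<open>v\<close> is then forced: otherwise
  the leading term of \<open>g * v\<close> would lie in a degree that neither \<open>E\<close> nor
  \<open>u * h\<close> reaches.\<close>

lemma coprime_solve_bounded:
  fixes g h E :: "'a::field_gcd poly"
  assumes "coprime g h" and g: "lead_coeff g = 1" and h: "lead_coeff h = 1"
    and E: "\<And>i. i \<ge> degree g + degree h \<Longrightarrow> coeff E i = 0"
  shows "\<exists>u v. g * v + u * h = E \<and>
    (\<forall>i\<ge>degree g. coeff u i = 0) \<and> (\<forall>i\<ge>degree h. coeff v i = 0)"
proof -
  obtain a b where ab: "a * g + b * h = 1"
    using bezout_coefficients_fst_snd[of g h] \<open>coprime g h\<close> by (metis coprime_iff_gcd_eq_1)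
  define u where "u = (E * b) mod g"
  define k where "k = (E * b) div g"
  define v where "v = E * a + k * h"
  have Eb: "E * b = g * k + u" by (simp add: u_def k_def)
  have "E = E * (a * g + b * h)" by (simp add: ab)
  also have "\<dots> = g * (E * a) + (E * b) * h" by (simp add: algebra_simps)
  also have "\<dots> = g * v + u * h" by (simp add: Eb v_def algebra_simps)
  finally have eq: "g * v + u * h = E" by simp
  have g0: "g \<noteq> 0" and h0: "h \<noteq> 0" using g h by auto
  have u: "coeff u i = 0" if "i \<ge> degree g" for i
    using degree_mod_less[OF g0, of "E * b"] that by (auto simp: u_def intro: coeff_eq_0)
  have v: "coeff v i = 0" if i: "i \<ge> degree h" for i
  proof (cases "degree v < degree h \<or> v = 0")
    case True
    then show ?thesis using i by (auto intro: coeff_eq_0)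
  next
    case False
    then have v0: "v \<noteq> 0" and dv: "degree v \<ge> degree h" by auto
    have "coeff (u * h) (degree g + degree v) = 0"
    proof (cases "u = 0")
      case False
      then have "degree u < degree g" using u by (metis leading_coeff_0_iff not_le)
      then show ?thesis using dv degree_mult_le[of u h] by (intro coeff_eq_0) linarith
    qed simp
    moreover have "coeff E (degree g + degree v) = 0" using dv by (intro E) simp
    ultimately have "coeff (g * v) (degree g + degree v) = 0"
      using eq by (metis add.right_neutral coeff_add)
    then have False using v0 g by (simp add: coeff_mult_degree_sum)
    then show ?thesis ..
  qed
  from eq u v show ?thesis by blast
qed

text \<open>The common degree bound \<open>m\<close> is what lets infinitely many layers form one
  polynomial over power series.\<close>

lemma layer_of_layers:
  fixes F :: "nat \<Rightarrow> 'a::comm_ring_1 poly"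
  assumes "\<forall>j. \<forall>i>m. coeff (F j) i = 0"
  shows "\<exists>G. \<forall>j. layer j G = F j"
proof (intro HOL.exI HOL.allI)
  define G where "G = (\<Sum>i\<le>m. monom (Abs_fps (\<lambda>j. coeff (F j) i)) i)"
  have "coeff G i = Abs_fps (\<lambda>j. coeff (F j) i)" for i
  proof -
    have "coeff G i = (\<Sum>k\<le>m. if k = i then Abs_fps (\<lambda>j. coeff (F j) k) else 0)"
      by (simp add: G_def coeff_sum)
    also have "\<dots> = Abs_fps (\<lambda>j. coeff (F j) i)"
      using assms by (auto simp: fps_eq_iff)
    finally show ?thesis .
  qed
  then show "layer j G = F j" for j
    by (intro poly_eqI) simp
qed

lemma degree_layer_le: "degree (layer j P) \<le> degree P"
proof (rule degree_le, intro HOL.allI HOL.impI)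
  fix i assume "degree P < i"
  then have "coeff P i = 0" by (rule coeff_eq_0)
  then show "coeff (layer j P) i = 0" by simp
qed

lemma degree_layer_0: "lead_coeff P = 1 \<Longrightarrow> degree (layer 0 P) = degree P"
  by (intro antisym degree_layer_le le_degree) simp

text \<open>Layer \<open>n\<close> of \<open>G * H\<close> is \<open>g * H_n + G_n * h\<close> plus
  products of earlier layers, so the layers of the factors are found one after the other by
  \<open>coprime_solve_bounded\<close>. The corrections have degrees below those of \<open>g\<close>
  and \<open>h\<close>, so the degrees of the factors do not grow.\<close>

theorem hensel_factor:
  fixes P :: "'a::field_gcd fps poly"
  assumes gh: "layer 0 P = g * h" and "coprime g h"
    and P: "lead_coeff P = 1" and g: "lead_coeff g = 1" and h: "lead_coeff h = 1"
  obtains G H where "P = G * H" "degree G = degree g"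
proof -
  have degP: "degree P = degree g + degree h"
  proof -
    have "degree (layer 0 P) = degree P" using P by (rule degree_layer_0)
    moreover have "degree (g * h) = degree g + degree h"
      using g h by (intro degree_mult_eq) auto
    ultimately show ?thesis using gh by simp
  qed
  \<comment> \<open>\<open>Q f n r\<close> says that \<open>r\<close> is an admissible pair of
    layers of order \<open>n\<close> for the two factors when \<open>f\<close> lists the earlier
    pairs.\<close>
  define Q where "Q = (\<lambda>(f :: nat \<Rightarrow> 'a poly \<times> 'a poly) (n::nat) (r :: 'a poly \<times> 'a poly). if n = 0 then r = (g, h) else
     g * snd r + fst r * h = layer n P - (\<Sum>a\<in>{1..<n}. fst (f a) * snd (f (n - a))) \<and>
     (\<forall>i\<ge>degree g. coeff (fst r) i = 0) \<and> (\<forall>i\<ge>degree h. coeff (snd r) i = 0))"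
  have Q_fst: "coeff (fst r) i = 0" if "Q f n r" "n \<noteq> 0" "i \<ge> degree g" for f n r i
    using that unfolding Q_def by presburger
  have Q_snd: "coeff (snd r) i = 0" if "Q f n r" "n \<noteq> 0" "i \<ge> degree h" for f n r i
    using that unfolding Q_def by presburger
  have Q_eq: "g * snd r + fst r * h = layer n P - (\<Sum>a\<in>{1..<n}. fst (f a) * snd (f (n - a)))"
    if "Q f n r" "n \<noteq> 0" for f n r
    using that unfolding Q_def by presburger
  have "\<exists>f. \<forall>n. Q f n (f n)"
  proof (rule dependent_wellorder_choice)
    fix r :: "'a poly \<times> 'a poly" and f f' :: "nat \<Rightarrow> 'a poly \<times> 'a poly" and n :: nat
    assume "\<And>y. y < n \<Longrightarrow> f y = f' y"
    then have "(\<Sum>a\<in>{1..<n}. fst (f a) * snd (f (n - a))) = (\<Sum>a\<in>{1..<n}. fst (f' a) * snd (f' (n - a)))"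
      by (intro sum.cong) auto
    then show "Q f n r = Q f' n r" by (simp add: Q_def)
  next
    fix n :: nat and f :: "nat \<Rightarrow> 'a poly \<times> 'a poly"
    assume IH: "\<And>y. y < n \<Longrightarrow> Q f y (f y)"
    show "\<exists>r. Q f n r"
    proof (cases "n = 0")
      case True then show ?thesis by (simp add: Q_def)
    next
      case False
      define E where "E = layer n P - (\<Sum>a\<in>{1..<n}. fst (f a) * snd (f (n - a)))"
      have E0: "coeff E i = 0" if i: "i \<ge> degree g + degree h" for i
      proof -
        \<comment> \<open>The leading coefficient 1 is a constant series, so the layers of positive
          order have degree below that of \<open>P\<close>.\<close>
        have "coeff P i $ n = 0"
        proof (cases "i = degree P")
          case True then show ?thesis using P False by simp
        next
          case False then show ?thesis using i degP by (simp add: coeff_eq_0)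
        qed
        moreover have "coeff (fst (f a) * snd (f (n - a))) i = 0" if a: "a \<in> {1..<n}" for a
        proof -
          have "coeff (fst (f a)) j * coeff (snd (f (n - a))) (i - j) = 0" if "j \<le> i" for j
          proof (cases "j \<ge> degree g")
            case True then show ?thesis using Q_fst[OF IH[of a]] a by simp
          next
            case False
            then have "i - j \<ge> degree h" using i by linarith
            then show ?thesis using Q_snd[OF IH[of "n - a"]] a by simp
          qed
          then show ?thesis by (simp only: coeff_mult) (intro sum.neutral ballI, simp only: atMost_iff)
        qed
        ultimately show ?thesis by (simp add: E_def coeff_sum)
      qed
      have "\<exists>u v. g * v + u * h = E \<and>
        (\<forall>i\<ge>degree g. coeff u i = 0) \<and> (\<forall>i\<ge>degree h. coeff v i = 0)"
        by (rule coprime_solve_bounded[OF \<open>coprime g h\<close> g h]) (rule E0)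
      then obtain u v where "g * v + u * h = E" "\<forall>i\<ge>degree g. coeff u i = 0"
        "\<forall>i\<ge>degree h. coeff v i = 0" by (elim HOL.exE conjE)
      then have "Q f n (u, v)" using False by (simp add: Q_def E_def)
      then show ?thesis ..
    qed
  qed
  then obtain f where f: "\<And>n. Q f n (f n)" by blast
  have f0: "f 0 = (g, h)" using f[of 0] by (simp add: Q_def)
  have fb: "coeff (fst (f n)) i = 0" if "i > degree g" for n i
    using Q_fst[OF f[of n]] that f0 by (cases "n = 0") (simp_all add: coeff_eq_0)
  have sb: "coeff (snd (f n)) i = 0" if "i > degree h" for n i
    using Q_snd[OF f[of n]] that f0 by (cases "n = 0") (simp_all add: coeff_eq_0)
  have "\<exists>G. \<forall>j. layer j G = fst (f j)"
    by (rule layer_of_layers[where m = "degree g"]) (simp add: fb)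
  then obtain G where G: "\<And>j. layer j G = fst (f j)" by blast
  have "\<exists>H. \<forall>j. layer j H = snd (f j)"
    by (rule layer_of_layers[where m = "degree h"]) (simp add: sb)
  then obtain H where H: "\<And>j. layer j H = snd (f j)" by blast
  have "layer n P = layer n (G * H)" for n
  proof (cases "n = 0")
    case True
    have "layer 0 (G * H) = layer 0 G * layer 0 H" by (simp only: layer_mult) simp
    also have "\<dots> = layer 0 P" by (simp only: G H f0 gh fst_conv snd_conv)
    finally show ?thesis by (simp only: True)
  next
    case False
    then have "{..n} = insert 0 (insert n {1..<n})" by auto
    then have "layer n (G * H) = layer 0 G * layer n H + (layer n G * layer 0 H +
        (\<Sum>a\<in>{1..<n}. layer a G * layer (n - a) H))"
      using False by (simp only: layer_mult) simp
    then have "layer n (G * H) = g * snd (f n) + (fst (f n) * h + (\<Sum>a\<in>{1..<n}. fst (f a) * snd (f (n - a))))"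
      by (simp only: G H f0 fst_conv snd_conv)
    then show ?thesis using Q_eq[OF f[of n]] False by (simp add: algebra_simps)
  qed
  then have "P = G * H" by (rule poly_eqI_layer)
  moreover have "degree G = degree g"
  proof (rule antisym)
    show "degree G \<le> degree g"
    proof (rule degree_le, intro HOL.allI HOL.impI)
      fix i assume "degree g < i"
      then have "coeff (layer j G) i = 0" for j by (simp only: G fb)
      then show "coeff G i = 0" by (simp add: fps_eq_iff)
    qed
    have "coeff (layer 0 G) (degree g) = 1" by (simp only: G f0 fst_conv g)
    then show "degree g \<le> degree G" by (intro le_degree) auto
  qed
  ultimately show thesis by (rule that)
qed

section \<open>Puiseux roots\<close>

lemma comm_ring_hom_fls_compose_power:
  "q > 0 \<Longrightarrow> comm_ring_hom (\<lambda>f :: 'a::idom fls. fls_compose_power f q)"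
  by unfold_locales simp_all

lemma comm_ring_hom_fps_to_fls: "comm_ring_hom (fps_to_fls :: 'a::comm_ring_1 fps \<Rightarrow> 'a fls)"
  by unfold_locales (simp_all add: fls_times_fps_to_fls)

lemma fls_compose_power_compose:
  assumes "p > 0" "q > 0"
  shows "fls_compose_power (fls_compose_power f p) q = fls_compose_power f (p * q)"
proof (rule fls_eqI)
  fix n :: int
  have "int p * int q dvd n \<longleftrightarrow> int q dvd n \<and> int p dvd n div int q"
    using assms by (auto simp: dvd_div_iff_mult ac_simps elim: dvd_mult_left)
  then show "fls_compose_power (fls_compose_power f p) q $$ n = fls_compose_power f (p * q) $$ n"
    using assms by (auto simp: fls_nth_compose_power div_mult2_eq' mult.commute[of "int p"] zdiv_zmult2_eq)
qed

lemma fls_compose_power_eq_0_iff: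
  assumes "q > 0"
  shows "fls_compose_power f q = 0 \<longleftrightarrow> f = 0"
proof
  assume "fls_compose_power f q = 0"
  then have "fls_compose_power f q $$ (int q * n) = 0" for n by simp
  then show "f = 0" using assms by (intro fls_eqI) (simp add: fls_nth_compose_power)
qed simp

lemma fls_subdegree_compose_power:
  assumes "q > 0"
  shows "fls_subdegree (fls_compose_power f q) = int q * fls_subdegree f"
proof (cases "f = 0")
  case False
  show ?thesis
  proof (rule fls_subdegree_eqI)
    show "fls_compose_power f q $$ (int q * fls_subdegree f) \<noteq> 0"
      using assms False by (simp add: fls_nth_compose_power)
    fix k assume k: "k < int q * fls_subdegree f"
    show "fls_compose_power f q $$ k = 0"
    proof (cases "int q dvd k")
      case True
      then obtain j where "k = int q * j" ..
      then show ?thesis using k assms by (simp add: fls_nth_compose_power)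
    qed (use assms in \<open>simp add: fls_nth_compose_power\<close>)
  qed
qed simp

text \<open>Puiseux series are never constructed. A root of \<open>ramify q P\<close> among the
  Laurent series in X stands for a root of \<open>P\<close> in the variable X^(1/q), and the index
  \<open>q\<close> is carried along.\<close>

abbreviation ramify :: "nat \<Rightarrow> 'a::idom fls poly \<Rightarrow> 'a fls poly" where
  "ramify q P \<equiv> map_poly (\<lambda>f. fls_compose_power f q) P"

lemma ramify_ramify: "p > 0 \<Longrightarrow> q > 0 \<Longrightarrow> ramify q (ramify p P) = ramify (p * q) P"
  by (rule poly_eqI) (simp add: coeff_map_poly fls_compose_power_compose)

lemma coeff_pcompose_shift:
  fixes p :: "'a::idom poly"
  assumes "degree p \<le> n"
  shows "coeff (pcompose p [:a, 1:]) n = coeff p n \<and>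
    (n > 0 \<longrightarrow> coeff (pcompose p [:a, 1:]) (n - 1) = coeff p (n - 1) + of_nat n * a * coeff p n)"
  using assms
proof (induction p arbitrary: n)
  case 0
  then show ?case by simp
next
  case (pCons b p)
  show ?case
  proof (cases n)
    case 0
    then have "p = 0" using pCons.prems by (auto split: if_splits)
    then show ?thesis by (simp add: pcompose_pCons 0)
  next
    case (Suc m)
    then have "degree p \<le> m" using pCons.prems by (auto split: if_splits)
    note IH = pCons.IH[OF this]
    have "coeff (pcompose p [:a, 1:]) (Suc m) = 0" "coeff p (Suc m) = 0"
      using \<open>degree p \<le> m\<close> by (auto intro!: coeff_eq_0 simp: degree_pcompose)
    then show ?thesis using IH Suc
      by (cases m) (auto simp: pcompose_pCons algebra_simps)
  qed
qed

text \<open>The Tschirnhaus shift; characteristic zero allows the division by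
  \<open>n\<close>.\<close>

lemma pcompose_shift_monic:
  fixes P :: "'a::field_char_0 poly"
  assumes n: "degree P = n" "n > 0" and P: "lead_coeff P = 1"
  obtains c where "degree (pcompose P [:c, 1:]) = n" "lead_coeff (pcompose P [:c, 1:]) = 1"
    "coeff (pcompose P [:c, 1:]) (n - 1) = 0"
proof -
  define c where "c = - coeff P (n - 1) / of_nat n"
  have "coeff (pcompose P [:c, 1:]) (n - 1) = 0"
    using coeff_pcompose_shift[of P n c] n P by (simp add: c_def)
  moreover have "lead_coeff (pcompose P [:c, 1:]) = 1" by (simp add: lead_coeff_comp P)
  ultimately show thesis using that[of c] n by (simp add: degree_pcompose)
qed

lemma coeff_linear_power_pred:
  "n > 0 \<Longrightarrow> coeff ([:a, 1:] ^ n) (n - 1) = of_nat n * (a :: 'a::idom)"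
  by (cases n) (simp_all add: coeff_linear_poly_power del: power_Suc)

text \<open>A monic polynomial without second-highest term that is not a monomial is no power of a linear
  polynomial, so it splits off a proper factor coprime to its cofactor.\<close>
lemma coprime_split:
  fixes P :: "complex poly"
  assumes P: "lead_coeff P = 1" "degree P = n" "n > 0" "coeff P (n - 1) = 0" "P \<noteq> monom 1 n"
  obtains g h where "P = g * h" "coprime g h" "lead_coeff g = 1" "lead_coeff h = 1"
    "0 < degree g" "degree g < n"
proof -
  have P0: "P \<noteq> 0" using P by auto
  have "\<not> constant (poly P)" using P by (simp add: constant_degree)
  then obtain c where c: "poly P c = 0" using fundamental_theorem_of_algebra by blast
  define m where "m = order c P"
  have m0: "m > 0" using c P0 by (simp add: m_def order_gt_0_iff)
  obtain h where h: "P = [:-c, 1:] ^ m * h" "\<not> [:-c, 1:] dvd h"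
    using order_decomp[OF P0, of c] by (auto simp: m_def)
  have lg: "lead_coeff ([:-c, 1:] ^ m) = 1" by (simp add: lead_coeff_power)
  have lh: "lead_coeff h = 1" using P(1) h(1) lg by (simp add: lead_coeff_mult)
  have "prime_elem [:-c, 1:]" by (rule prime_elem_linear_field_poly) simp
  then have "coprime ([:-c, 1:] ^ m) h"
    using prime_elem_imp_coprime[OF _ h(2)] by (simp add: coprime_power_left_iff)
  moreover have "m < n"
  proof (rule HOL.ccontr)
    assume "\<not> m < n"
    have h0: "h \<noteq> 0" using lh by auto
    have "n = m + degree h" using P(2) h(1) h0 by (simp add: degree_mult_eq degree_power_eq)
    then have "degree h = 0" "m = n" using \<open>\<not> m < n\<close> by auto
    then have "h = 1" using lh by (metis degree_0_id one_pCons)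
    then have Pn: "P = [:-c, 1:] ^ n" using h(1) \<open>m = n\<close> by simp
    then have "c = 0" using P(3,4) coeff_linear_power_pred[of n "-c"] by simp
    then show False using Pn P(5) by (simp add: monom_altdef)
  qed
  ultimately show thesis using that[of "[:-c, 1:] ^ m" h] h(1) lg lh m0
    by (simp add: degree_power_eq)
qed

text \<open>Newton-Puiseux by induction on the degree. The shift kills the second-highest term, and
  scaling by the slope of the Newton polygon leaves power series as coefficients, one of which below
  the top has a nonzero residue. The residue polynomial is then no power of a linear one, so it
  splits coprimely, and Hensel lifting gives a factor of smaller degree.\<close>

theorem puiseux_root:
  fixes P :: "complex fls poly"
  assumes "degree P > 0"
  shows "\<exists>q>0. \<exists>r. poly (ramify q P) r = 0"
  using assms
proof (induction "degree P" arbitrary: P rule: less_induct)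
  case less
  define n where "n = degree P"
  have n0: "n > 0" using less.prems by (simp add: n_def)
  have P0: "P \<noteq> 0" using less.prems by auto
  define P1 where "P1 = smult (inverse (lead_coeff P)) P"
  have P1: "degree P1 = n" "lead_coeff P1 = 1" using P0 by (simp_all add: P1_def n_def)
  obtain c where P2: "degree (pcompose P1 [:c, 1:]) = n" "lead_coeff (pcompose P1 [:c, 1:]) = 1"
    "coeff (pcompose P1 [:c, 1:]) (n - 1) = 0"
    using pcompose_shift_monic[OF P1(1) n0 P1(2)] by blast
  define P2 where "P2 = pcompose P1 [:c, 1:]"
  note P2 = P2[folded P2_def]
  have "\<exists>q>0. \<exists>r. poly (ramify q P2) r = 0"
  proof (cases "P2 = monom 1 n")
    case True
    have "poly (ramify 1 P2) 0 = 0" using n0 by (simp add: True poly_0_coeff_0 coeff_map_poly)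
    then show ?thesis using zero_less_one by blast
  next
    case False
    \<comment> \<open>The Newton polygon: \<open>i\<close> stands for the coefficient of degree
      \<open>n - i\<close>, and the smallest ratio of its order to \<open>i\<close> is the
      slope.\<close>
    define I where "I = {i \<in> {1..n}. coeff P2 (n - i) \<noteq> 0}"
    have I1: "1 \<notin> I" using P2(3) by (simp add: I_def)
    have "I \<noteq> {}"
    proof
      assume I: "I = {}"
      have "coeff P2 j = (if j = n then 1 else 0)" for j
      proof -
        consider "j = n" | "j > n" | "j < n" by linarith
        then show ?thesis
        proof cases
          case 3
          then have "n - j \<in> {1..n}" "n - (n - j) = j" by auto
          moreover have "n - j \<notin> I" by (simp add: I)
          ultimately have "coeff P2 j = 0" by (simp add: I_def)
          with 3 show ?thesis by simp
        qed (use P2(1,2) in \<open>simp_all add: coeff_eq_0\<close>)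
      qed
      then have "P2 = monom 1 n" by (intro poly_eqI) (simp add: eq_commute)
      then show False using False by contradiction
    qed
    moreover have "finite I" by (simp add: I_def)
    ultimately obtain k where "is_arg_min (\<lambda>i. of_int (fls_subdegree (coeff P2 (n - i))) / real i) (\<lambda>i. i \<in> I) k"
      using ex_is_arg_min_if_finite by blast
    then have kI: "k \<in> I" and kmin: "\<And>i. i \<in> I \<Longrightarrow>
        of_int (fls_subdegree (coeff P2 (n - k))) / real k \<le> of_int (fls_subdegree (coeff P2 (n - i))) / real i"
      by (auto simp: is_arg_min_linorder)
    have k: "k > 0" "k \<le> n" "coeff P2 (n - k) \<noteq> 0" using kI by (auto simp: I_def)
    define p where "p = fls_subdegree (coeff P2 (n - k))"
    have kmin': "p * int i \<le> fls_subdegree (coeff P2 (n - i)) * int k" if "i \<in> I" for i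
    proof -
      have "i > 0" using that by (auto simp: I_def)
      then have "of_int p * real i \<le> of_int (fls_subdegree (coeff P2 (n - i))) * real k"
        using kmin[OF that] k(1) by (simp add: p_def field_simps)
      then have "real_of_int (p * int i) \<le> real_of_int (fls_subdegree (coeff P2 (n - i)) * int k)" by simp
      then show ?thesis by linarith
    qed
    \<comment> \<open>Ramification by \<open>k\<close> turns the slope \<open>p / k\<close> into the
      integer \<open>p\<close>, and \<open>w\<close> is the corresponding scaling of the
      variable.\<close>
    define w :: "complex fls" where "w = fls_X_intpow p"
    have w0: "w \<noteq> 0" by (simp add: w_def)
    have ws: "fls_subdegree (w ^ i) = int i * p" for i by (simp add: w_def fls_subdegree_pow)
    interpret s: comm_ring_hom "\<lambda>f :: complex fls. fls_compose_power f k"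
      using k(1) by (rule comm_ring_hom_fls_compose_power)
    define P3 where "P3 = ramify k P2"
    have cP3: "coeff P3 j = fls_compose_power (coeff P2 j) k" for j
      by (simp add: P3_def coeff_map_poly)
    \<comment> \<open>These are the coefficients of P3(w Y) / w^n.\<close>
    define B where "B j = coeff P3 j / w ^ (n - j)" for j
    have P3B: "coeff P3 j = B j * w ^ (n - j)" for j using w0 by (simp add: B_def)
    have Bsub: "fls_subdegree (B j) = int k * fls_subdegree (coeff P2 j) - int (n - j) * p" if "coeff P2 j \<noteq> 0" for j
    proof -
      have "coeff P3 j \<noteq> 0" using that k(1) by (simp add: cP3 fls_compose_power_eq_0_iff)
      then have "B j \<noteq> 0" using w0 by (simp add: B_def)
      then have "fls_subdegree (coeff P3 j) = fls_subdegree (B j) + int (n - j) * p"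
        using w0 by (simp add: P3B ws)
      then show ?thesis using k(1) by (simp add: cP3 fls_subdegree_compose_power)
    qed
    have Bge: "fls_subdegree (B j) \<ge> 0" for j
    proof (cases "coeff P2 j = 0 \<or> j = n")
      case True
      then show ?thesis using P2 by (auto simp: B_def cP3 k(1))
    next
      case False
      then have "j < n" using P2(1) le_degree[of P2 j] by auto
      then have "n - j \<in> I" using False by (auto simp: I_def)
      from kmin'[OF this] show ?thesis using Bsub[of j] False \<open>j < n\<close> by (simp add: mult.commute)
    qed
    define R where "R = (\<Sum>j\<le>n. monom (fls_regpart (B j)) j)"
    have cR: "coeff R j = fls_regpart (B j)" for j
    proof -
      have "coeff R j = (\<Sum>i\<le>n. if i = j then fls_regpart (B i) else 0)"
        by (simp add: R_def coeff_sum)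
      also have "\<dots> = fls_regpart (B j)"
        using P2(1) by (simp add: B_def cP3 coeff_eq_0)
      finally show ?thesis .
    qed
    have RB: "fps_to_fls (coeff R j) = B j" for j
      unfolding cR by (rule fls_regpart_to_fls_trivial) (rule Bge)
    have Bn: "B n = 1" using P2(1,2) by (simp add: B_def cP3 k(1))
    have degR: "degree R = n"
    proof (rule antisym)
      show "degree R \<le> n" by (rule degree_le) (use P2(1) in \<open>simp add: cR B_def cP3 coeff_eq_0\<close>)
      show "n \<le> degree R" by (rule le_degree) (simp add: cR Bn)
    qed
    have lR: "lead_coeff R = 1" by (simp add: degR cR Bn)
    have L: "degree (layer 0 R) = n" "lead_coeff (layer 0 R) = 1"
      using degree_layer_0[OF lR] lR degR by simp_all
    have "coeff (layer 0 R) (n - 1) = 0" using P2(3) by (simp add: cR B_def cP3)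
    \<comment> \<open>The coefficient of degree \<open>n - k\<close> attains the slope, so after
      scaling it has order 0 and survives in layer 0.\<close>
    moreover have "layer 0 R \<noteq> monom 1 n"
    proof
      assume eq: "layer 0 R = monom 1 n"
      have "fls_subdegree (B (n - k)) = 0" using Bsub[OF k(3)] k(2) by (simp add: p_def)
      moreover have "B (n - k) \<noteq> 0"
        using k w0 by (simp add: B_def cP3 fls_compose_power_eq_0_iff)
      ultimately have "B (n - k) $$ 0 \<noteq> 0" by (metis nth_fls_subdegree_nonzero)
      then have "coeff (layer 0 R) (n - k) \<noteq> 0" by (simp add: cR)
      then show False using k by (simp add: eq split: if_splits)
    qed
    ultimately obtain g h where gh: "layer 0 R = g * h" "coprime g h" "lead_coeff g = 1"
      "lead_coeff h = 1" "0 < degree g" "degree g < n"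
      using coprime_split[OF L(2) L(1) n0] by blast
    obtain G H where GH: "R = G * H" "degree G = degree g"
      using hensel_factor[OF gh(1,2) lR gh(3,4)] by blast
    define G' where "G' = map_poly fps_to_fls G"
    have "degree G' = degree g" using GH(2) by (simp add: G'_def degree_map_poly)
    then obtain q r where q: "q > 0" and r: "poly (ramify q G') r = 0"
      using less.hyps[of G'] gh(5,6) by (auto simp: n_def)
    interpret t: comm_ring_hom "\<lambda>f :: complex fls. fls_compose_power f q"
      using q by (rule comm_ring_hom_fls_compose_power)
    interpret e: comm_ring_hom "fps_to_fls :: complex fps \<Rightarrow> _"
      by (rule comm_ring_hom_fps_to_fls)
    define R' where "R' = ramify q (map_poly fps_to_fls R)"
    have R'0: "poly R' r = 0"
      using r by (simp add: R'_def GH(1) e.map_poly_mult t.map_poly_mult G'_def)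
    have cR': "coeff R' j = fls_compose_power (B j) q" for j
      by (simp add: R'_def coeff_map_poly RB)
    have degR': "degree R' = n"
      using q degR by (simp add: R'_def degree_map_poly fls_compose_power_eq_0_iff)
    define w' where "w' = fls_compose_power w q"
    have degP3': "degree (ramify q P3) = n"
      using q k P2(1) by (simp add: P3_def degree_map_poly fls_compose_power_eq_0_iff)
    \<comment> \<open>Undoing the scaling: a root \<open>r\<close> of the scaled polynomial gives
      the root \<open>w' * r\<close>.\<close>
    have "poly (ramify q P3) (w' * r) = (\<Sum>j\<le>n. fls_compose_power (coeff P3 j) q * (w' * r) ^ j)"
      by (simp add: poly_altdef degP3' coeff_map_poly)
    also have "\<dots> = (\<Sum>j\<le>n. w' ^ n * (coeff R' j * r ^ j))"
    proof (rule sum.cong)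
      fix j assume "j \<in> {..n}"
      then have "w' ^ n = w' ^ (n - j) * w' ^ j" by (simp flip: power_add)
      then show "fls_compose_power (coeff P3 j) q * (w' * r) ^ j = w' ^ n * (coeff R' j * r ^ j)"
        by (simp add: P3B cR' t.hom_mult t.hom_power w'_def power_mult_distrib)
    qed simp
    also have "\<dots> = w' ^ n * poly R' r" by (simp add: poly_altdef degR' sum_distrib_left)
    finally have "poly (ramify (k * q) P2) (w' * r) = 0"
      using R'0 k(1) q by (simp add: P3_def ramify_ramify)
    moreover have "k * q > 0" using k(1) q by simp
    ultimately show ?thesis by blast
  qed
  then obtain q r where q: "q > 0" and r: "poly (ramify q P2) r = 0" by blast
  interpret t: comm_ring_hom "\<lambda>f :: complex fls. fls_compose_power f q"
    using q by (rule comm_ring_hom_fls_compose_power)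
  have "poly (ramify q P1) (r + fls_compose_power c q) = 0"
    using r q by (simp add: P2_def t.map_poly_pcompose poly_pcompose t.map_poly_pCons add.commute)
  then have "poly (ramify q P) (r + fls_compose_power c q) = 0"
    using P0 q by (simp add: P1_def t.map_poly_smult fls_compose_power_eq_0_iff)
  then show ?case using q by blast
qed

section \<open>Real factors of real Puiseux polynomials\<close>

definition fls_map :: "('a::zero \<Rightarrow> 'b::zero) \<Rightarrow> 'a fls \<Rightarrow> 'b fls" where
  "fls_map h f = Abs_fls (\<lambda>n. h (f $$ n))"

lemma fls_map_nth: "h 0 = 0 \<Longrightarrow> fls_map h f $$ n = h (f $$ n)"
  unfolding fls_map_def
  by (rule nth_Abs_fls_ex_lower_bound) (metis fls_eq0_below_subdegree)

abbreviation cfls :: "real fls \<Rightarrow> complex fls" where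
  "cfls \<equiv> fls_map complex_of_real"

lemma cfls_eq_0_iff: "cfls f = 0 \<longleftrightarrow> f = 0"
  by (simp add: fls_eq_iff fls_map_nth)

lemma fls_subdegree_cfls: "fls_subdegree (cfls f) = fls_subdegree f"
proof (cases "f = 0")
  case True
  then show ?thesis by (simp add: cfls_eq_0_iff[THEN iffD2])
next
  case False
  then show ?thesis by (intro fls_subdegree_eqI) (simp_all add: fls_map_nth)
qed

lemma comm_ring_hom_cfls: "comm_ring_hom cfls"
proof
  show "cfls (x + y) = cfls x + cfls y" for x y
    by (rule fls_eqI) (simp add: fls_map_nth)
  show "cfls (x * y) = cfls x * cfls y" for x y
    by (rule fls_eqI) (simp add: fls_map_nth fls_times_nth(2) fls_subdegree_cfls)
  show "cfls 1 = 1"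
    by (rule fls_eqI) (simp add: fls_map_nth)
qed

lemma cfls_compose_power:
  "q > 0 \<Longrightarrow> cfls (fls_compose_power f q) = fls_compose_power (cfls f) q"
  by (rule fls_eqI) (simp add: fls_map_nth fls_nth_compose_power)

lemma complex_fls_decompose:
  obtains a b where "f = cfls a + fls_const \<i> * cfls b"
proof
  show "f = cfls (fls_map Re f) + fls_const \<i> * cfls (fls_map Im f)"
    by (rule fls_eqI) (simp add: fls_map_nth complex_eq_iff)
qed

lemma cfls_decompose_eq_0:
  assumes "cfls a + fls_const \<i> * cfls b = 0"
  shows "a = 0" "b = 0"
proof -
  have "complex_of_real (a $$ n) + \<i> * complex_of_real (b $$ n) = 0" for n
    using arg_cong[OF assms, of "\<lambda>f. f $$ n"] by (simp add: fls_map_nth)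
  then show "a = 0" "b = 0" by (auto simp: fls_eq_iff complex_eq_iff)
qed

text \<open>The product of Y - (a + ib) and Y - (a - ib).\<close>

definition quad :: "real fls \<Rightarrow> real fls \<Rightarrow> real fls poly" where
  "quad a b = [:a^2 + b^2, - 2 * a, 1:]"

lemma poly_quad: "poly (quad a b) x = (x - a)^2 + b^2"
  by (simp add: quad_def power2_eq_square algebra_simps)

lemma ramify_quad:
  assumes "q > 0"
  shows "ramify q (quad a b) = quad (fls_compose_power a q) (fls_compose_power b q)"
proof -
  interpret t: comm_ring_hom "\<lambda>f :: real fls. fls_compose_power f q"
    using assms by (rule comm_ring_hom_fls_compose_power)
  have "fls_compose_power (2 :: real fls) q = 2" using t.hom_add[of 1 1] t.hom_one by simp
  then show ?thesis
    unfolding quad_def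
    by (simp add: t.map_poly_pCons t.hom_add t.hom_mult t.hom_power t.hom_one t.hom_uminus)
qed

text \<open>A complex Puiseux root has the form a + ib with real series a and b. If b is nonzero,
  the remainder modulo \<open>quad a b\<close> has degree at most 1, real coefficients and the zero
  a + ib, so it vanishes.\<close>

lemma real_puiseux_factor:
  fixes P :: "real fls poly"
  assumes "degree P > 0"
  shows "\<exists>q>0. (\<exists>a S. ramify q P = [:- a, 1:] * S) \<or> (\<exists>a b S. b \<noteq> 0 \<and> ramify q P = quad a b * S)"
proof -
  interpret e: comm_ring_hom cfls by (rule comm_ring_hom_cfls)
  have "degree (map_poly cfls P) > 0" using assms by (simp add: degree_map_poly cfls_eq_0_iff)
  then obtain q r where q: "q > 0" and r: "poly (ramify q (map_poly cfls P)) r = 0"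
    using puiseux_root by blast
  define P' where "P' = ramify q P"
  have "ramify q (map_poly cfls P) = map_poly cfls P'"
    using q by (intro poly_eqI) (simp add: P'_def coeff_map_poly e.hom_zero cfls_compose_power)
  with r have r: "poly (map_poly cfls P') r = 0" by simp
  obtain a b where ab: "r = cfls a + fls_const \<i> * cfls b" by (rule complex_fls_decompose)
  have ii: "fls_const \<i> * (fls_const \<i> * x) = - x" for x
    by (rule fls_eqI) simp
  show ?thesis
  proof (cases "b = 0")
    case True
    then have "cfls (poly P' a) = 0" using r ab by (simp add: e.hom_poly e.hom_zero)
    then have "poly P' a = 0" by (simp add: cfls_eq_0_iff)
    then have "[:- a, 1:] dvd P'" by (simp add: poly_eq_0_iff_dvd)
    then show ?thesis using q unfolding P'_def dvd_def by blast
  next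
    case False
    define T where "T = P' mod quad a b"
    have qd: "quad a b \<noteq> 0" "degree (quad a b) = 2" by (simp_all add: quad_def)
    have P'T: "P' = quad a b * (P' div quad a b) + T" by (simp add: T_def)
    have "degree T < 2" using degree_mod_less[OF qd(1), of P'] qd(2) by (auto simp: T_def)
    then obtain c d where T: "T = [:c, d:]"
      by (metis One_nat_def Suc_1 degree_eq_zeroE degree_pCons_eq_if less_Suc_eq less_one nat.simps(3) not_less_eq pCons_0_0 pCons_cases old.nat.inject)
    have "poly (map_poly cfls (quad a b)) r = (r - cfls a)^2 + (cfls b)^2"
      using e.hom_one e.hom_add[of 1 1]
      by (simp add: quad_def e.map_poly_pCons e.hom_zero e.hom_add e.hom_mult e.hom_power e.hom_uminus
          power2_eq_square algebra_simps)
    also have "\<dots> = 0" by (simp add: ab power2_eq_square ii mult.assoc mult.left_commute[of "cfls b"])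
    finally have "poly (map_poly cfls T) r = 0"
      using r arg_cong[OF P'T, of "\<lambda>p. poly (map_poly cfls p) r"]
      by (simp add: e.map_poly_add e.map_poly_mult)
    then have "cfls (c + d * a) + fls_const \<i> * cfls (d * b) = 0"
      by (simp add: T e.map_poly_pCons e.hom_zero e.hom_add e.hom_mult ab algebra_simps)
    from cfls_decompose_eq_0[OF this] have "T = 0" using False T by simp
    then have "P' = quad a b * (P' div quad a b)" using P'T by simp
    then show ?thesis using q False unfolding P'_def by blast
  qed
qed

text \<open>Each further factor may require more ramification. Factors already split off keep their
  form under it, so the indices simply multiply.\<close>

theorem real_puiseux_split:
  fixes P :: "real fls poly"
  assumes "P \<noteq> 0"
  shows "\<exists>q>0. \<exists>c as bs. c \<noteq> 0 \<and> (\<forall>(a, b)\<in>set bs. b \<noteq> 0) \<and>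
    ramify q P = smult c (prod_list (map (\<lambda>a. [:- a, 1:]) as) * prod_list (map (\<lambda>(a, b). quad a b) bs))"
  using assms
proof (induction "degree P" arbitrary: P rule: less_induct)
  case less
  show ?case
  proof (cases "degree P = 0")
    case True
    then obtain c where "P = [:c:]" by (rule degree_eq_zeroE)
    then show ?thesis using less.prems
      by (intro HOL.exI[of _ 1] HOL.conjI HOL.exI[of _ "fls_compose_power c 1"] HOL.exI[of _ "[]"])
        (simp_all add: map_poly_pCons fls_compose_power_eq_0_iff)
  next
    case False
    then obtain q where q: "q > 0" and split: "(\<exists>a S. ramify q P = [:- a, 1:] * S) \<or> (\<exists>a b S. b \<noteq> 0 \<and> ramify q P = quad a b * S)"
      using real_puiseux_factor[of P] by blast
    have dP: "degree (ramify q P) = degree P" "ramify q P \<noteq> 0"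
      using q less.prems by (simp_all add: degree_map_poly map_poly_eq_0_iff fls_compose_power_eq_0_iff)
    have step: "\<exists>q>0. \<exists>c as bs. c \<noteq> 0 \<and> (\<forall>(a, b)\<in>set bs. b \<noteq> 0) \<and>
        ramify q S = smult c (prod_list (map (\<lambda>a. [:- a, 1:]) as) * prod_list (map (\<lambda>(a, b). quad a b) bs))"
      if "ramify q P = F * S" "degree F > 0" for F S
    proof (rule less.hyps)
      show "S \<noteq> 0" using dP(2) that by auto
      then show "degree S < degree P" using dP that degree_mult_eq[of F S] by fastforce
    qed
    from split show ?thesis
    proof (elim HOL.disjE HOL.exE conjE)
      fix a S assume eq: "ramify q P = [:- a, 1:] * S"
      obtain q' c as bs where IH: "q' > 0" "c \<noteq> 0" "\<forall>(a, b)\<in>set bs. b \<noteq> 0"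
        "ramify q' S = smult c (prod_list (map (\<lambda>a. [:- a, 1:]) as) * prod_list (map (\<lambda>(a, b). quad a b) bs))"
        using step[OF eq] by auto
      interpret t: comm_ring_hom "\<lambda>f :: real fls. fls_compose_power f q'"
        using IH(1) by (rule comm_ring_hom_fls_compose_power)
      have "ramify (q * q') P = ramify q' ([:- a, 1:] * S)" using q IH(1) by (simp add: eq flip: ramify_ramify)
      also have "\<dots> = [:- fls_compose_power a q', 1:] * ramify q' S"
        unfolding t.map_poly_mult using IH(1) by (simp add: t.map_poly_pCons)
      finally have "ramify (q * q') P = smult c (prod_list (map (\<lambda>a. [:- a, 1:]) (fls_compose_power a q' # as)) *
          prod_list (map (\<lambda>(a, b). quad a b) bs))"
        by (simp add: IH(4) mult_ac)
      moreover have "q * q' > 0" using q IH(1) by simp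
      ultimately show ?thesis using IH(2,3)
        by (intro HOL.exI[of _ "q * q'"] HOL.exI[of _ c] HOL.exI[of _ "fls_compose_power a q' # as"] HOL.exI[of _ bs] HOL.conjI)
    next
      fix a b S assume b: "b \<noteq> 0" and eq: "ramify q P = quad a b * S"
      have "degree (quad a b) > 0" by (simp add: quad_def)
      then obtain q' c as bs where IH: "q' > 0" "c \<noteq> 0" "\<forall>(a, b)\<in>set bs. b \<noteq> 0"
        "ramify q' S = smult c (prod_list (map (\<lambda>a. [:- a, 1:]) as) * prod_list (map (\<lambda>(a, b). quad a b) bs))"
        using step[OF eq] by auto
      interpret t: comm_ring_hom "\<lambda>f :: real fls. fls_compose_power f q'"
        using IH(1) by (rule comm_ring_hom_fls_compose_power)
      have "ramify (q * q') P = ramify q' (quad a b * S)" using q IH(1) by (simp add: eq flip: ramify_ramify)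
      also have "\<dots> = quad (fls_compose_power a q') (fls_compose_power b q') * ramify q' S"
        unfolding t.map_poly_mult using IH(1) by (simp add: ramify_quad)
      finally have "ramify (q * q') P = smult c (prod_list (map (\<lambda>a. [:- a, 1:]) as) *
          prod_list (map (\<lambda>(a, b). quad a b) ((fls_compose_power a q', fls_compose_power b q') # bs)))"
        by (simp add: IH(4) mult_ac)
      moreover have "\<forall>(a, b)\<in>set ((fls_compose_power a q', fls_compose_power b q') # bs). b \<noteq> 0"
        using IH(1,3) b by (simp add: fls_compose_power_eq_0_iff)
      moreover have "q * q' > 0" using q IH(1) by simp
      ultimately show ?thesis using IH(2)
        by (intro HOL.exI[of _ "q * q'"] HOL.exI[of _ c] HOL.exI[of _ as] HOL.conjI
            HOL.exI[of _ "(fls_compose_power a q', fls_compose_power b q') # bs"])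
    qed
  qed
qed

section \<open>Puiseux polynomials with integer constant term\<close>

text \<open>The leading term of a Laurent series in \<open>1 / t\<close> is the one of lowest order, and its sign is the
  sign of the series.\<close>
definition lc :: "real fls \<Rightarrow> real" where
  "lc f = f $$ fls_subdegree f"

definition pos :: "real fls \<Rightarrow> bool" where
  "pos f \<longleftrightarrow> lc f > 0"

lemma lc_eq_0_iff: "lc f = 0 \<longleftrightarrow> f = 0"
  by (metis lc_def nth_fls_subdegree_zero_iff)

lemma lc_mult: "lc (f * g) = lc f * lc g"
proof (cases "f = 0 \<or> g = 0")
  case False
  then show ?thesis by (simp add: lc_def)
qed (auto simp: lc_def)

lemma lc_uminus: "lc (- f) = - lc f"
  by (simp add: lc_def)

lemma lc_one: "lc 1 = 1"
  by (simp add: lc_def)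

lemma lc_prod_list: "lc (prod_list fs) = prod_list (map lc fs)"
  by (induction fs) (simp_all add: lc_one lc_mult)

lemma lc_compose_power: "q > 0 \<Longrightarrow> lc (fls_compose_power f q) = lc f"
  by (simp add: lc_def fls_subdegree_compose_power fls_nth_compose_power)

lemma pos_add:
  assumes f: "pos f" and g: "pos g"
  shows "pos (f + g)"
proof -
  have f0: "f \<noteq> 0" and g0: "g \<noteq> 0" using f g by (auto simp: pos_def lc_def)
  let ?m = "min (fls_subdegree f) (fls_subdegree g)"
  have "(f + g) $$ ?m > 0"
    using f g by (cases "fls_subdegree f" "fls_subdegree g" rule: linorder_cases) (auto simp: pos_def lc_def)
  moreover have "fls_subdegree (f + g) = ?m"
    by (rule fls_subdegree_eqI) (use calculation in auto)
  ultimately show ?thesis by (simp add: pos_def lc_def)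
qed

lemma pos_cases: "pos f \<or> f = 0 \<or> pos (- f)"
  using lc_eq_0_iff[of f] by (auto simp: pos_def lc_uminus)

lemma pos_square: "f \<noteq> 0 \<Longrightarrow> pos (f ^ 2)"
  using lc_eq_0_iff[of f] by (simp add: pos_def power2_eq_square lc_mult zero_less_mult_iff) linarith

lemma pos_quad: "b \<noteq> 0 \<Longrightarrow> pos (poly (quad a b) x)"
  unfolding poly_quad using pos_add[OF pos_square[of "x - a"] pos_square[of b]] pos_square[of b]
  by (cases "x = a") auto

text \<open>If \<open>r\<close> lay outside the interval from \<open>u\<close> to \<open>v\<close>,
  then \<open>pos_add\<close> would give both differences the same sign. This locates the root of a
  linear factor that changes sign.\<close>

lemma sgn_lc_neqD:
  assumes "sgn (lc (u - r)) \<noteq> sgn (lc (v - r))" "pos (v - u)"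
  shows "u - r = 0 \<or> pos (r - u)" "v - r = 0 \<or> pos (v - r)"
proof -
  have "pos (v - r)" if "pos (u - r)" using pos_add[OF that assms(2)] by simp
  then have "\<not> pos (u - r)" using assms(1) by (auto simp: pos_def)
  then show "u - r = 0 \<or> pos (r - u)" using pos_cases[of "u - r"] by auto
  have "pos (r - u)" if "pos (r - v)" using pos_add[OF that assms(2)] by simp
  moreover have "sgn (lc (u - r)) = -1" if "pos (r - u)" using that lc_uminus[of "u - r"] by (simp add: pos_def)
  moreover have "sgn (lc (v - r)) = -1" if "pos (r - v)" using that lc_uminus[of "v - r"] by (simp add: pos_def)
  ultimately have "\<not> pos (r - v)" using assms(1) by auto
  then show "v - r = 0 \<or> pos (v - r)" using pos_cases[of "v - r"] by auto
qed

section \<open>Polynomials in t as Laurent series in 1/t\<close>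

definition lp :: "real poly \<Rightarrow> real fls" where
  "lp p = poly (map_poly fls_const p) fls_X_inv"

lemma lp_pCons: "lp (pCons a p) = fls_const a + fls_X_inv * lp p"
  by (simp add: lp_def map_poly_pCons)

lemma lp_0 [simp]: "lp 0 = 0"
  by (simp add: lp_def)

lemma comm_ring_hom_fls_const: "comm_ring_hom (fls_const :: real \<Rightarrow> real fls)"
  by unfold_locales (simp_all add: fls_plus_const)

lemma comm_ring_hom_lp: "comm_ring_hom lp"
proof -
  interpret c: comm_ring_hom "fls_const :: real \<Rightarrow> real fls" by (rule comm_ring_hom_fls_const)
  show ?thesis
    by unfold_locales (simp_all add: lp_def c.map_poly_add c.map_poly_mult)
qed

lemma lp_nth: "lp p $$ n = (if n \<le> 0 then coeff p (nat (- n)) else 0)"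
proof (induction p arbitrary: n)
  case (pCons a p)
  then show ?case
    by (auto simp: lp_pCons fls_X_inv_times_conv_shift coeff_pCons nat_diff_distrib split: nat.split)
qed simp

text \<open>The top power of t is the lowest power of 1/t, so the order of the model will agree with
  the sign of Laurent series.\<close>

lemma lc_lp: "lc (lp p) = lead_coeff p"
proof (cases "p = 0")
  case False
  have "fls_subdegree (lp p) = - int (degree p)"
    by (rule fls_subdegree_eqI) (use False in \<open>auto simp: lp_nth intro: coeff_eq_0\<close>)
  then show ?thesis by (simp add: lc_def lp_nth)
qed (simp add: lc_def)

lemma fls_compose_power_lp:
  assumes "j > 0"
  shows "fls_compose_power (lp p) j = lp (pcompose p (monom 1 j))"
proof (induction p)
  case (pCons a p)
  interpret l: comm_ring_hom lp by (rule comm_ring_hom_lp)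
  have "lp (monom 1 j) = fls_X_intpow (- int j)"
    by (rule fls_eqI) (auto simp: lp_nth)
  then show ?case
    using pCons assms by (simp add: lp_pCons pcompose_pCons l.hom_add l.hom_mult)
qed simp

text \<open>The indeterminate is \<open>t = exp s\<close>, so the \<open>k\<close>-th roots of \<open>t\<close> are the functions \<open>exp (s / k)\<close> and
  substituting a monomial for \<open>t\<close> is an affine change of \<open>s\<close>.\<close>
definition pval :: "nat \<Rightarrow> real poly \<Rightarrow> real \<Rightarrow> real" where
  "pval k p = (\<lambda>s. poly p (exp (s / real k)))"

lemma pval_raise: "k > 0 \<Longrightarrow> j > 0 \<Longrightarrow> pval k p = pval (k * j) (pcompose p (monom 1 j))"
  by (simp add: pval_def poly_pcompose poly_monom fun_eq_iff flip: exp_of_nat_mult)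

lemma eventually_pval_sgn:
  assumes "k > 0"
  shows "eventually (\<lambda>s. sgn (pval k p s) = sgn (lead_coeff p)) at_top"
proof -
  have "eventually (\<lambda>x. sgn (poly p x) = sgn (lead_coeff p)) at_top"
  proof -
    consider "p = 0" | "lead_coeff p > 0" | "lead_coeff (- p) > 0" by force
    then show ?thesis
    proof cases
      case 2
      from poly_pinfty_gt_lc[OF 2] obtain n where "\<forall>x\<ge>n. lead_coeff p \<le> poly p x" by blast
      then show ?thesis using 2 unfolding eventually_at_top_linorder by (metis less_le_trans sgn_pos)
    next
      case 3
      from poly_pinfty_gt_lc[OF 3] obtain n where "\<forall>x\<ge>n. lead_coeff (- p) \<le> poly (- p) x" by blast
      then show ?thesis using 3 unfolding eventually_at_top_linorder
        by (intro HOL.exI[of _ n]) (auto simp: sgn_if)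
    qed simp
  qed
  moreover have "filterlim (\<lambda>s. exp (s / real k)) at_top at_top"
    by (rule filterlim_compose[OF exp_at_top])
      (use assms in \<open>auto intro!: filterlim_tendsto_pos_mult_at_top[OF tendsto_const _ filterlim_ident, of "1 / real k", simplified]\<close>)
  ultimately show ?thesis
    unfolding pval_def by (rule eventually_compose_filterlim)
qed

lemma pval_inject:
  assumes "k > 0"
  shows "pval k p = pval k q \<longleftrightarrow> p = q"
proof
  assume "pval k p = pval k q"
  then have "pval k (p - q) s = 0" for s by (simp add: pval_def fun_eq_iff)
  then have "eventually (\<lambda>s. sgn (lead_coeff (p - q)) = 0) (at_top :: real filter)"
    using eventually_pval_sgn[OF assms, of "p - q"] by simp
  then show "p = q" using leading_coeff_0_iff[of "p - q"] by (simp add: sgn_zero_iff)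
qed simp

text \<open>Elements are functions of \<open>s\<close> and not pairs of a denominator and a
  polynomial: the denominator is not unique, whereas for functions the ring laws hold pointwise and
  the substitution of a monomial for t is a composition.\<close>

typedef pz = "{f. \<exists>k p. k > 0 \<and> coeff p 0 \<in> \<int> \<and> f = pval k p}"
proof
  show "pval 1 0 \<in> {f. \<exists>k p. k > 0 \<and> coeff p 0 \<in> \<int> \<and> f = pval k p}"
    by (intro CollectI HOL.exI[of _ 1] HOL.exI[of _ 0]) simp
qed

setup_lifting type_definition_pz

text \<open>\<open>p\<close> presents \<open>x\<close> as a polynomial in t^(1/k). The presentation
  at a given level \<open>k\<close> is unique, and a level may be replaced by any multiple, so
  finitely many elements always have a common level.\<close>

definition lev :: "nat \<Rightarrow> pz \<Rightarrow> real poly \<Rightarrow> bool" where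
  "lev k x p \<longleftrightarrow> k > 0 \<and> Rep_pz x = pval k p"

lemma coeff_0_pcompose_monom: "j > 0 \<Longrightarrow> coeff (pcompose p (monom 1 j)) 0 = coeff (p :: 'a::comm_ring_1 poly) 0"
proof -
  assume "j > 0"
  then have "poly (monom 1 j) 0 = (0 :: 'a)" by (simp add: poly_monom power_0_left)
  then show ?thesis unfolding poly_0_coeff_0[symmetric] poly_pcompose by simp
qed

lemma lev_raise: "lev k x p \<Longrightarrow> j > 0 \<Longrightarrow> lev (k * j) x (pcompose p (monom 1 j))"
  unfolding lev_def using pval_raise[of k j p] by (metis nat_0_less_mult_iff)

lemma lev_exists: "\<exists>k p. lev k x p \<and> coeff p 0 \<in> \<int>"
  using Rep_pz[of x] by (auto simp: lev_def)

lemma lev_unique: "lev k x p \<Longrightarrow> lev k x q \<Longrightarrow> p = q"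
  by (auto simp: lev_def pval_inject)

text \<open>The type guarantees an integral constant term for one presentation only. Raising two
  presentations to a common level identifies them and leaves the constant terms alone.\<close>

lemma lev_coeff_0: "lev k x p \<Longrightarrow> coeff p 0 \<in> \<int>"
proof -
  assume x: "lev k x p"
  obtain j q where q: "lev j x q" "coeff q 0 \<in> \<int>" using lev_exists by blast
  have "k > 0" "j > 0" using x q by (auto simp: lev_def)
  then have "pcompose p (monom 1 j) = pcompose q (monom 1 k)"
    using lev_raise[OF x, of j] lev_raise[OF q(1), of k] by (intro lev_unique) (simp_all add: mult.commute)
  then show ?thesis using q(2) coeff_0_pcompose_monom[of j p] coeff_0_pcompose_monom[of k q] \<open>k > 0\<close> \<open>j > 0\<close> by simp
qed

lemma lev_common2: "\<exists>k p q. lev k x p \<and> lev k y q"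
proof -
  obtain k p where p: "lev k x p" using lev_exists by blast
  obtain j q where q: "lev j y q" using lev_exists by blast
  have "k > 0" "j > 0" using p q by (auto simp: lev_def)
  then show ?thesis using lev_raise[OF p, of j] lev_raise[OF q, of k] by (metis mult.commute)
qed

lemma lev_eq_iff: "lev k x p \<Longrightarrow> lev k y q \<Longrightarrow> x = y \<longleftrightarrow> p = q"
  by (metis Rep_pz_inject lev_def pval_inject)

lemma ex_lev_iff: "k > 0 \<Longrightarrow> coeff p 0 \<in> \<int> \<Longrightarrow> \<exists>x. lev k x p"
  using Abs_pz_inverse[of "pval k p"] by (auto simp: lev_def)

definition ofp :: "nat \<Rightarrow> real poly \<Rightarrow> pz" where
  "ofp k p = Abs_pz (pval k p)"

lemma lev_ofp: "k > 0 \<Longrightarrow> coeff p 0 \<in> \<int> \<Longrightarrow> lev k (ofp k p) p"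
  unfolding lev_def ofp_def by (auto intro!: Abs_pz_inverse)

section \<open>Ring structure and order of the Puiseux polynomials\<close>

instantiation pz :: comm_ring_1
begin

lift_definition zero_pz :: pz is "\<lambda>s. 0"
  by (rule HOL.exI[of _ 1], rule HOL.exI[of _ 0]) (simp add: pval_def)

lift_definition one_pz :: pz is "\<lambda>s. 1"
  by (rule HOL.exI[of _ 1], rule HOL.exI[of _ 1]) (simp add: pval_def)

lift_definition plus_pz :: "pz \<Rightarrow> pz \<Rightarrow> pz" is "\<lambda>f g s. f s + g s"
proof (elim HOL.exE conjE)
  fix f g k p j q assume *: "0 < k" "coeff p 0 \<in> \<int>" "f = pval k p" "0 < j" "coeff q 0 \<in> \<int>" "g = pval j q"
  show "\<exists>k p. 0 < k \<and> coeff p 0 \<in> \<int> \<and> (\<lambda>s. f s + g s) = pval k p"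
    using * pval_raise[OF *(1,4), of p] pval_raise[OF *(4,1), of q]
    by (intro HOL.exI[of _ "k * j"] HOL.exI[of _ "pcompose p (monom 1 j) + pcompose q (monom 1 k)"])
      (auto simp: poly_0_coeff_0 poly_monom power_0_left mult.commute pval_def)
qed

lift_definition times_pz :: "pz \<Rightarrow> pz \<Rightarrow> pz" is "\<lambda>f g s. f s * g s"
proof (elim HOL.exE conjE)
  fix f g k p j q assume *: "0 < k" "coeff p 0 \<in> \<int>" "f = pval k p" "0 < j" "coeff q 0 \<in> \<int>" "g = pval j q"
  show "\<exists>k p. 0 < k \<and> coeff p 0 \<in> \<int> \<and> (\<lambda>s. f s * g s) = pval k p"
    using * pval_raise[OF *(1,4), of p] pval_raise[OF *(4,1), of q]
    by (intro HOL.exI[of _ "k * j"] HOL.exI[of _ "pcompose p (monom 1 j) * pcompose q (monom 1 k)"])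
      (auto simp: poly_0_coeff_0 poly_monom power_0_left coeff_mult_0 mult.commute[of "real j"] pval_def)
qed

lift_definition uminus_pz :: "pz \<Rightarrow> pz" is "\<lambda>f s. - f s"
proof (elim HOL.exE conjE)
  fix f k p assume *: "0 < k" "coeff p 0 \<in> \<int>" "f = pval k p"
  then show "\<exists>k p. 0 < k \<and> coeff p 0 \<in> \<int> \<and> (\<lambda>s. - f s) = pval k p"
    by (intro HOL.exI[of _ k] HOL.exI[of _ "- p"]) (simp add: pval_def)
qed

definition "x - y = x + - (y :: pz)"

instance
proof
  fix x y z :: pz
  show "x + y + z = x + (y + z)" "x + y = y + x" "0 + x = x" "- x + x = 0" "x * y * z = x * (y * z)"
    "x * y = y * x" "1 * x = x" "(x + y) * z = x * z + y * z"
    by (transfer, simp add: algebra_simps)+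
  show "x - y = x + - y" by (rule minus_pz_def)
  show "(0::pz) \<noteq> 1" by transfer (simp add: fun_eq_iff)
qed

end

instantiation pz :: linordered_idom
begin

lift_definition less_pz :: "pz \<Rightarrow> pz \<Rightarrow> bool" is "\<lambda>f g. eventually (\<lambda>s. f s < g s) at_top" .

definition "x \<le> y \<longleftrightarrow> x = y \<or> x < (y :: pz)"
definition "\<bar>x\<bar> = (if x < 0 then - x else (x :: pz))"
definition "sgn x = (if x = 0 then 0 else if 0 < x then 1 else - (1 :: pz))"

lemma lev_zero: "k > 0 \<Longrightarrow> lev k 0 0"
  by (simp add: lev_def zero_pz.rep_eq pval_def)

lemma lev_one: "k > 0 \<Longrightarrow> lev k 1 1"
  by (simp add: lev_def one_pz.rep_eq pval_def)

lemma lev_plus: "lev k x p \<Longrightarrow> lev k y q \<Longrightarrow> lev k (x + y) (p + q)"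
  by (simp add: lev_def plus_pz.rep_eq pval_def)

lemma lev_times: "lev k x p \<Longrightarrow> lev k y q \<Longrightarrow> lev k (x * y) (p * q)"
  by (simp add: lev_def times_pz.rep_eq pval_def)

lemma lev_uminus: "lev k x p \<Longrightarrow> lev k (- x) (- p)"
  by (simp add: lev_def uminus_pz.rep_eq pval_def)

lemma lev_minus: "lev k x p \<Longrightarrow> lev k y q \<Longrightarrow> lev k (x - y) (p - q)"
  by (simp only: diff_conv_add_uminus lev_plus lev_uminus)

lemma lev_less_iff: 
  assumes "lev k x p" "lev k y q"
  shows "x < y \<longleftrightarrow> lead_coeff (q - p) > 0"
proof -
  have k: "k > 0" and xy: "Rep_pz x = pval k p" "Rep_pz y = pval k q" using assms by (auto simp: lev_def)
  have ev: "eventually (\<lambda>s. sgn (pval k q s - pval k p s) = sgn (lead_coeff (q - p))) at_top"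
    using eventually_pval_sgn[OF k, of "q - p"] by (simp add: pval_def)
  show ?thesis
  proof
    assume "x < y"
    then have "eventually (\<lambda>s. pval k p s < pval k q s) at_top" by (simp add: less_pz.rep_eq xy)
    with ev have "eventually (\<lambda>s. sgn (lead_coeff (q - p)) = 1) (at_top :: real filter)"
      by eventually_elim simp
    then have "sgn (lead_coeff (q - p)) = 1" using eventually_happens' trivial_limit_at_top_linorder by blast
    then show "lead_coeff (q - p) > 0" by (simp only: sgn_1_pos)
  next
    assume *: "lead_coeff (q - p) > 0"
    from ev have "eventually (\<lambda>s. pval k p s < pval k q s) at_top"
    proof eventually_elim
      case (elim s)
      then have "sgn (pval k q s - pval k p s) = 1" using * by (simp only: sgn_pos)
      then show ?case by (simp add: sgn_1_pos)
    qed
    then show "x < y" by (simp add: less_pz.rep_eq xy)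
  qed
qed

instance
proof
  fix x y z :: pz
  have irr: "\<not> x < x" for x :: pz
  proof -
    obtain k p where "lev k x p" using lev_exists by blast
    then show ?thesis by (simp add: lev_less_iff)
  qed
  have tr: "x < y \<Longrightarrow> y < z \<Longrightarrow> x < z" for x y z :: pz
  proof (transfer)
    fix f g h :: "real \<Rightarrow> real"
    assume "eventually (\<lambda>s. f s < g s) at_top" "eventually (\<lambda>s. g s < h s) at_top"
    then show "eventually (\<lambda>s. f s < h s) at_top" by eventually_elim simp
  qed
  show "x < y \<longleftrightarrow> x \<le> y \<and> \<not> y \<le> x" unfolding less_eq_pz_def using irr tr by metis
  show "x \<le> x" by (simp add: less_eq_pz_def)
  show "x \<le> y \<Longrightarrow> y \<le> z \<Longrightarrow> x \<le> z" unfolding less_eq_pz_def using tr by metis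
  show "x \<le> y \<Longrightarrow> y \<le> x \<Longrightarrow> x = y" unfolding less_eq_pz_def using irr tr by metis
  show "x \<le> y \<or> y \<le> x"
  proof -
    obtain k p q where l: "lev k x p" "lev k y q" using lev_common2 by blast
    have "p = q \<or> lead_coeff (q - p) > 0 \<or> lead_coeff (p - q) > 0"
      using leading_coeff_0_iff[of "q - p"] lead_coeff_minus[of "q - p"] by force
    then show ?thesis using lev_less_iff[OF l] lev_less_iff[OF l(2,1)] lev_eq_iff[OF l] by (auto simp: less_eq_pz_def)
  qed
  show "x \<le> y \<Longrightarrow> z + x \<le> z + y" unfolding less_eq_pz_def by transfer auto
  show "x < y \<Longrightarrow> 0 < z \<Longrightarrow> z * x < z * y"
  proof (transfer)
    fix f g h :: "real \<Rightarrow> real"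
    assume "eventually (\<lambda>s. f s < g s) at_top" "eventually (\<lambda>s. 0 < h s) at_top"
    then show "eventually (\<lambda>s. h s * f s < h s * g s) at_top" by eventually_elim simp
  qed
  show "\<bar>x\<bar> = (if x < 0 then - x else x)" by (rule abs_pz_def)
  show "sgn x = (if x = 0 then 0 else if 0 < x then 1 else - 1)" by (rule sgn_pz_def)
qed

end

section \<open>Floors and sign changes\<close>

lemma lev_pos_iff:
  assumes "lev k x p"
  shows "0 < x \<longleftrightarrow> lead_coeff p > 0"
proof -
  have "lev k 0 0" using assms by (intro lev_zero) (simp add: lev_def)
  from lev_less_iff[OF this assms] show ?thesis by simp
qed

lemma lev_sgn: "lev k x p \<Longrightarrow> sgn (lead_coeff p) = (if 0 < x then 1 else if x = 0 then 0 else - 1)"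
proof -
  assume x: "lev k x p"
  have "lev k 0 0" using x by (intro lev_zero) (simp add: lev_def)
  from lev_eq_iff[OF x this] have "x = 0 \<longleftrightarrow> lead_coeff p = 0" by simp
  then show ?thesis using lev_pos_iff[OF x] by (auto simp: sgn_if)
qed

lemma sgn_eq_iff_lev:
  assumes "lev k x p" "lev k y q"
  shows "sgn x = sgn y \<longleftrightarrow> sgn (lead_coeff p) = sgn (lead_coeff q)"
  using lev_sgn[OF assms(1)] lev_sgn[OF assms(2)] by (auto simp: sgn_pz_def split: if_splits)

text \<open>A positive element presented by a constant is a positive integer, since constant terms
  are integral; every other positive element is infinite.\<close>

lemma pz_discrete: "0 < (x :: pz) \<Longrightarrow> 1 \<le> x"
proof -
  assume x: "0 < x"
  obtain k p where p: "lev k x p" using lev_exists by blast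
  have one: "lev k 1 1" using p by (intro lev_one) (simp add: lev_def)
  have lcp: "lead_coeff p > 0" using lev_pos_iff[OF p] x by simp
  have "p = 1 \<or> lead_coeff (p - 1) > 0"
  proof (cases "degree p = 0")
    case True
    then obtain a where a: "p = [:a:]" by (rule degree_eq_zeroE)
    then have "a \<in> \<int>" using lev_coeff_0[OF p] by simp
    then obtain n where "a = of_int n" by (rule Ints_cases)
    then have "a = 1 \<or> a > 1" using lcp a by auto
    then show ?thesis using a by (auto simp: one_pCons)
  next
    case False
    then have "degree (p - 1) = degree p" using degree_add_eq_left[of "-1" p] by simp
    then show ?thesis using lcp False by simp
  qed
  then show ?thesis using lev_less_iff[OF one p] lev_eq_iff[OF one p] by auto
qed

lemma pz_less_iff: "x < y \<longleftrightarrow> x + 1 \<le> (y :: pz)"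
proof
  assume "x < y"
  then show "x + 1 \<le> y" using pz_discrete[of "y - x"] by simp
next
  assume "x + 1 \<le> y"
  moreover have "x < x + 1" by simp
  ultimately show "x < y" by (rule less_le_trans[rotated])
qed

lemma pz_between: "m \<le> u \<Longrightarrow> u \<le> m + 1 \<Longrightarrow> u = m \<or> u = m + (1 :: pz)"
  by (metis order.antisym order.not_eq_order_implies_strict pz_less_iff)

definition levP :: "nat \<Rightarrow> pz poly \<Rightarrow> real poly poly \<Rightarrow> bool" where
  "levP k P Q \<longleftrightarrow> k > 0 \<and> (\<forall>i. lev k (coeff P i) (coeff Q i))"

lemma levP_raise:
  assumes "levP k P Q" "j > 0"
  shows "levP (k * j) P (map_poly (\<lambda>p. pcompose p (monom 1 j)) Q)"
  using assms by (auto simp: levP_def coeff_map_poly intro: lev_raise)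

lemma levP_exists: "\<exists>k Q. levP k P Q"
proof (induction P)
  case 0
  have "levP 1 0 0" by (simp add: levP_def lev_zero)
  then show ?case by blast
next
  case (pCons a P)
  obtain k Q where Q: "levP k P Q" using pCons.IH by blast
  obtain j p where p: "lev j a p" using lev_exists by blast
  have k: "k > 0" and j: "j > 0" using Q p by (auto simp: levP_def lev_def)
  let ?Q = "map_poly (\<lambda>p. pcompose p (monom 1 j)) Q"
  have "levP (k * j) (pCons a P) (pCons (pcompose p (monom 1 k)) ?Q)"
    using levP_raise[OF Q j] lev_raise[OF p k]
    by (auto simp: levP_def coeff_pCons mult.commute split: nat.split)
  then show ?case by blast
qed

lemma levP_poly:
  assumes "levP k P Q" "lev k x p"
  shows "lev k (poly P x) (poly Q p)"
  using assms(1)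
proof (induction P arbitrary: Q)
  case 0
  then have "coeff Q i = 0" for i
    using lev_unique[of k 0 "coeff Q i" 0] lev_zero by (auto simp: levP_def)
  then have "Q = 0" by (simp add: poly_eq_iff)
  then show ?case using 0 by (auto simp: levP_def intro: lev_zero)
next
  case (pCons a P)
  obtain b Q' where Q: "Q = pCons b Q'" by (rule pCons_cases)
  have "\<forall>i. lev k (coeff (pCons a P) i) (coeff Q i)" "k > 0" using pCons.prems by (auto simp: levP_def)
  then have "lev k a b" "levP k P Q'"
    unfolding Q levP_def by (metis coeff_pCons_0, metis coeff_pCons_Suc)
  then show ?case using pCons.IH[of Q'] Q assms(2) by (auto intro!: lev_plus lev_times)
qed

text \<open>The polynomial \<open>p\<close> in \<open>t\<close> becomes the Laurent series \<open>lp p\<close> in \<open>X = 1 / t\<close>, so the principal part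
  and the integer part of the constant term form the floor up to an error below \<open>1\<close>.\<close>
definition series_floor :: "real fls \<Rightarrow> real poly" where
  "series_floor a = fls_prpart a + [:of_int \<lfloor>a $$ 0\<rfloor>:]"

text \<open>The margins give both differences order 0 and a positive constant term, so the
  infinitesimal tail of \<open>a\<close> cannot affect their signs. In particular, \<open>a\<close>
  may lie infinitesimally below its own \<open>series_floor\<close>.\<close>

lemma series_floor_bounds: "pos (a - lp (series_floor a - 1))" "pos (lp (series_floor a + 2) - a)"
proof -
  let ?m = "series_floor a"
  have n: "lp ?m $$ n = (if n < 0 then a $$ n else if n = 0 then of_int \<lfloor>a $$ 0\<rfloor> else 0)" for n
    by (auto simp: lp_nth series_floor_def coeff_pCons split: nat.split)
  interpret l: comm_ring_hom lp by (rule comm_ring_hom_lp)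
  have two: "lp 2 = 2" using l.hom_add[of 1 1] l.hom_one by simp
  have 2: "(2 :: real fls) $$ n = (if n = 0 then 2 else 0)" for n
    by (simp only: one_add_one[symmetric] fls_plus_nth fls_one_nth) simp
  have fl: "of_int \<lfloor>a $$ 0\<rfloor> \<le> a $$ 0" "a $$ 0 < of_int \<lfloor>a $$ 0\<rfloor> + 1"
    using floor_correct[of "a $$ 0"] by simp_all
  have lower: "(a - lp (?m - 1)) $$ i = (if i < 0 then 0 else if i = 0 then a $$ 0 - of_int \<lfloor>a $$ 0\<rfloor> + 1 else a $$ i)" for i
    by (simp add: l.hom_diff l.hom_one n)
  have "(a - lp (?m - 1)) $$ 0 > 0" using fl unfolding lower by (simp only: less_irrefl if_False simp_thms if_True)
  moreover have "fls_subdegree (a - lp (?m - 1)) = 0"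
    by (rule fls_subdegree_eqI) (use calculation in simp, simp only: lower if_True)
  ultimately show "pos (a - lp (?m - 1))" by (simp add: pos_def lc_def)
  have upper: "(lp (?m + 2) - a) $$ i = (if i < 0 then 0 else if i = 0 then of_int \<lfloor>a $$ 0\<rfloor> + 2 - a $$ 0 else - (a $$ i))" for i
    by (simp add: l.hom_add two n 2)
  have "(lp (?m + 2) - a) $$ 0 > 0" using fl unfolding upper by (simp only: less_irrefl if_False simp_thms if_True)
  moreover have "fls_subdegree (lp (?m + 2) - a) = 0"
    by (rule fls_subdegree_eqI) (use calculation in simp, simp only: upper if_True)
  ultimately show "pos (lp (?m + 2) - a)" by (simp add: pos_def lc_def)
qed

text \<open>Over Puiseux series the sign of \<open>P\<close> at \<open>u\<close> is a fixed sign
  times the signs of the differences \<open>u - a\<close>, where \<open>a\<close> runs over the real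
  roots; the quadratic factors are positive. A change of sign between \<open>u\<close> and
  \<open>v\<close> therefore traps some \<open>a\<close>, hence its floor up to a bounded
  error.\<close>

theorem finite_sign_changes:
  fixes P :: "pz poly"
  shows "\<exists>C. finite C \<and> (\<forall>u v. u < v \<longrightarrow> sgn (poly P u) \<noteq> sgn (poly P v) \<longrightarrow> (\<exists>c\<in>C. u \<le> c \<and> c < v))"
proof (cases "P = 0")
  case True
  then show ?thesis by (intro HOL.exI[of _ "{}"]) simp
next
  case False
  interpret l: comm_ring_hom lp by (rule comm_ring_hom_lp)
  obtain k Q where Q: "levP k P Q" using levP_exists by blast
  have k: "k > 0" using Q by (simp add: levP_def)
  have "Q \<noteq> 0"
  proof
    assume "Q = 0"
    then have "lev k (coeff P i) 0" for i using Q by (simp add: levP_def)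
    then have "coeff P i = 0" for i using lev_eq_iff[OF _ lev_zero[OF k]] by blast
    then show False using False by (simp add: poly_eq_iff)
  qed
  have lp0: "lp p = 0 \<longleftrightarrow> p = 0" for p using lc_eq_0_iff[of "lp p"] by (simp add: lc_lp)
  define F where "F = map_poly lp Q"
  have "F \<noteq> 0" using \<open>Q \<noteq> 0\<close> by (simp add: F_def map_poly_eq_0_iff lp0)
  then obtain q c as bs where q: "q > 0" and c: "c \<noteq> 0" and bs: "\<forall>(a, b)\<in>set bs. b \<noteq> 0"
    and split: "ramify q F = smult c (prod_list (map (\<lambda>a. [:- a, 1:]) as) * prod_list (map (\<lambda>(a, b). quad a b) bs))"
    using real_puiseux_split by blast
  define m where "m a = ofp (k * q) (series_floor a)" for a
  have lm: "lev (k * q) (m a) (series_floor a)" for a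
    unfolding m_def using k q by (intro lev_ofp) (auto simp: series_floor_def)
  \<comment> \<open>The error of the floor leaves three candidates for each root, enough to find one
    with u <= c < v.\<close>
  define C where "C = (\<Union>a\<in>set as. {m a - 1, m a, m a + 1})"
  have "\<exists>c\<in>C. u \<le> c \<and> c < v" if uv: "u < v" and sg: "sgn (poly P u) \<noteq> sgn (poly P v)" for u v
  proof -
    \<comment> \<open>The level of \<open>u\<close> and \<open>v\<close> is unrelated to that of the
      splitting; both are raised to the common level \<open>r * j\<close>.\<close>
    obtain j0 p0 q0 where l0: "lev j0 u p0" "lev j0 v q0" using lev_common2 by blast
    define j where "j = j0"
    have j: "j > 0" using l0 by (simp add: lev_def j_def)
    define r where "r = k * q"
    have r: "r > 0" using k q by (simp add: r_def)
    define pu where "pu = pcompose p0 (monom 1 r)"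
    define pv where "pv = pcompose q0 (monom 1 r)"
    have lu: "lev (r * j) u pu" and lv: "lev (r * j) v pv"
      using lev_raise[OF l0(1) r] lev_raise[OF l0(2) r] by (simp_all add: pu_def pv_def j_def mult.commute)
    interpret t: comm_ring_hom "\<lambda>f :: real fls. fls_compose_power f j"
      using j by (rule comm_ring_hom_fls_compose_power)
    define Qj where "Qj = map_poly (\<lambda>p. pcompose p (monom 1 (q * j))) Q"
    have Qj: "levP (r * j) P Qj" using levP_raise[OF Q, of "q * j"] q j by (simp add: Qj_def r_def mult.assoc)
    have FQj: "map_poly lp Qj = ramify j (ramify q F)"
      using q j by (simp add: ramify_ramify) (rule poly_eqI, simp add: Qj_def F_def coeff_map_poly fls_compose_power_lp)
    have eval: "sgn (lead_coeff (poly Qj p)) = sgn (lc c) * prod_list (map (\<lambda>a. sgn (lc (lp p - fls_compose_power a j))) as)" for p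
    proof -
      have "lp (poly Qj p) = poly (ramify j (ramify q F)) (lp p)" by (simp add: l.hom_poly FQj)
      also have "\<dots> = fls_compose_power c j * (prod_list (map (\<lambda>a. lp p - fls_compose_power a j) as) *
          prod_list (map (\<lambda>(a, b). poly (quad (fls_compose_power a j) (fls_compose_power b j)) (lp p)) bs))"
      proof -
        have "poly (ramify j (prod_list (map (\<lambda>a. [:- a, 1:]) as))) x = prod_list (map (\<lambda>a. x - fls_compose_power a j) as)" for x
        proof (induction as)
          case (Cons a as)
          show ?case
            by (simp only: list.map prod_list.Cons t.map_poly_mult poly_mult Cons.IH)
              (use j in \<open>simp add: t.map_poly_pCons\<close>)
        qed (simp add: t.hom_one)
        moreover have "poly (ramify j (prod_list (map (\<lambda>(a, b). quad a b) bs))) x =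
            prod_list (map (\<lambda>(a, b). poly (quad (fls_compose_power a j) (fls_compose_power b j)) x) bs)" for x
          using j by (induction bs) (auto simp: t.map_poly_mult t.hom_one ramify_quad)
        ultimately show ?thesis by (simp add: split t.map_poly_smult t.map_poly_mult)
      qed
      moreover have "lc (prod_list (map (\<lambda>(a, b). f a b) xs)) = prod_list (map (\<lambda>(a, b). lc (f a b)) xs)"
        for f and xs :: "(real fls \<times> real fls) list"
        by (induction xs) (auto simp: lc_one lc_mult)
      ultimately have *: "lead_coeff (poly Qj p) = lc c * (prod_list (map (\<lambda>a. lc (lp p - fls_compose_power a j)) as) *
          prod_list (map (\<lambda>(a, b). lc (poly (quad (fls_compose_power a j) (fls_compose_power b j)) (lp p))) bs))"
        using j by (simp add: lc_mult lc_prod_list lc_compose_power comp_def flip: lc_lp)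
      have "prod_list (map (\<lambda>(a, b). lc (poly (quad (fls_compose_power a j) (fls_compose_power b j)) (lp p))) bs) > 0"
        using bs
      proof (induction bs)
        case (Cons ab bs)
        obtain a b where ab: "ab = (a, b)" by force
        have "pos (poly (quad (fls_compose_power a j) (fls_compose_power b j)) (lp p))"
          using Cons.prems j by (intro pos_quad) (simp add: ab fls_compose_power_eq_0_iff)
        then show ?case using Cons by (simp add: ab pos_def)
      qed simp
      moreover have "sgn (prod_list (map (\<lambda>a. lc (lp p - fls_compose_power a j)) xs)) =
          prod_list (map (\<lambda>a. sgn (lc (lp p - fls_compose_power a j))) xs)" for xs
        by (induction xs) (simp_all add: sgn_mult)
      ultimately show ?thesis unfolding * by (simp add: sgn_mult)
    qed
    have "\<exists>a\<in>set as. sgn (lc (lp pu - fls_compose_power a j)) \<noteq> sgn (lc (lp pv - fls_compose_power a j))"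
    proof (rule HOL.ccontr)
      assume "\<not> ?thesis"
      then have "map (\<lambda>a. sgn (lc (lp pu - fls_compose_power a j))) as = map (\<lambda>a. sgn (lc (lp pv - fls_compose_power a j))) as"
        by simp
      then have "sgn (lead_coeff (poly Qj pu)) = sgn (lead_coeff (poly Qj pv))" by (simp only: eval)
      then show False using sg sgn_eq_iff_lev[OF levP_poly[OF Qj lu] levP_poly[OF Qj lv]] by simp
    qed
    then obtain a where a: "a \<in> set as" and sa: "sgn (lc (lp pu - fls_compose_power a j)) \<noteq> sgn (lc (lp pv - fls_compose_power a j))"
      by blast
    define \<alpha> where "\<alpha> = fls_compose_power a j"
    define M where "M = pcompose (series_floor a) (monom 1 j)"
    have lM: "lev (r * j) (m a) M" using lev_raise[OF lm j] by (simp add: M_def r_def)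
    have one: "lev (r * j) 1 1" using r j by (intro lev_one) simp
    have two: "lev (r * j) 2 2" using lev_plus[OF one one] by simp
    have posj: "pos (fls_compose_power f j)" if "pos f" for f
      using that j by (simp add: pos_def lc_compose_power)
    have bd: "pos (\<alpha> - lp (M - 1))" "pos (lp (M + 2) - \<alpha>)"
    proof -
      have e: "fls_compose_power (lp (series_floor a - 1)) j = lp (M - 1)" 
        "fls_compose_power (lp (series_floor a + 2)) j = lp (M + 2)"
        using j pcompose_const[of 2] by (simp_all add: fls_compose_power_lp M_def pcompose_diff pcompose_add pcompose_1 numeral_poly)
      show "pos (\<alpha> - lp (M - 1))" "pos (lp (M + 2) - \<alpha>)"
        using posj[OF series_floor_bounds(1)[of a]] posj[OF series_floor_bounds(2)[of a]]
        by (simp_all add: t.hom_diff e \<alpha>_def)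
    qed
    have "pos (lp pv - lp pu)" using uv lev_less_iff[OF lu lv] by (simp add: pos_def lc_lp flip: l.hom_diff)
    note D = sgn_lc_neqD[OF sa[folded \<alpha>_def] this]
    have "pos (lp (M + 2) - lp pu)" using D(1) bd(2) pos_add[of "\<alpha> - lp pu" "lp (M + 2) - \<alpha>"] by auto
    then have u: "u < m a + 2"
      using lev_less_iff[OF lu lev_plus[OF lM two]] by (simp add: pos_def lc_lp flip: l.hom_diff)
    have "pos (lp pv - lp (M - 1))" using D(2) bd(1) pos_add[of "lp pv - \<alpha>" "\<alpha> - lp (M - 1)"] by auto
    then have v: "m a - 1 < v"
      using lev_less_iff[OF lev_minus[OF lM one] lv] by (simp add: pos_def lc_lp flip: l.hom_diff)
    have u': "u \<le> m a + 1" using u pz_less_iff[of u "m a + 2"] by simp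
    have "{m a - 1, m a, m a + 1} \<subseteq> C" using a by (auto simp: C_def)
    \<comment> \<open>If \<open>u\<close> exceeds \<open>m a - 1\<close>, discreteness leaves only
      \<open>m a\<close> and \<open>m a + 1\<close> for \<open>u\<close>, and \<open>u\<close>
      itself is the required point.\<close>
    moreover have "\<exists>c\<in>{m a - 1, m a, m a + 1}. u \<le> c \<and> c < v"
    proof (cases "u \<le> m a - 1")
      case True then show ?thesis using v by auto
    next
      case False
      then have "m a \<le> u" using pz_less_iff[of "m a - 1" u] by simp
      then have "u = m a \<or> u = m a + 1" using u' by (rule pz_between)
      then have "u \<in> {m a - 1, m a, m a + 1}" by simp
      then show ?thesis using uv order.refl by blast
    qed
    ultimately show ?thesis by blast
  qed
  moreover have "finite C" by (simp add: C_def)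
  ultimately show ?thesis by blast
qed

text \<open>Induction on the number of critical points below \<open>b\<close>. If \<open>c\<close>
  is the last one, the truth value is constant from \<open>c + 1\<close> to \<open>b\<close>, and
  the passage from \<open>c\<close> to \<open>c + 1\<close> is exactly what \<open>step\<close>
  covers.\<close>

theorem sign_determined_induction:
  assumes fin: "finite (\<P> :: pz poly set)"
    and det: "\<And>u v. 0 \<le> u \<Longrightarrow> 0 \<le> v \<Longrightarrow> (\<And>P. P \<in> \<P> \<Longrightarrow> sgn (poly P u) = sgn (poly P v)) \<Longrightarrow> \<theta> u \<longleftrightarrow> \<theta> v"
    and zero: "\<theta> 0" and step: "\<And>x. 0 \<le> x \<Longrightarrow> \<theta> x \<Longrightarrow> \<theta> (x + 1)"
    and "0 \<le> b"
  shows "\<theta> b"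
proof -
  define S where "S P C \<longleftrightarrow> finite C \<and> (\<forall>u v. u < v \<longrightarrow> sgn (poly P u) \<noteq> sgn (poly P v) \<longrightarrow> (\<exists>c\<in>C. u \<le> c \<and> c < v))"
    for P :: "pz poly" and C
  have "\<forall>P. \<exists>C. S P C" unfolding S_def by (intro HOL.allI finite_sign_changes)
  from choice[OF this] obtain D where D: "\<forall>P. S P (D P)" ..
  define C where "C = (\<Union>P\<in>\<P>. D P)"
  have finC: "finite C" using fin D unfolding S_def C_def by blast
  have const: "\<theta> u \<longleftrightarrow> \<theta> v" if "0 \<le> u" "u \<le> v" "\<And>c. c \<in> C \<Longrightarrow> u \<le> c \<Longrightarrow> c < v \<Longrightarrow> False" for u v
  proof (cases "u = v")
    case False
    show ?thesis
    proof (rule det)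
      fix P assume "P \<in> \<P>"
      then show "sgn (poly P u) = sgn (poly P v)" using D[rule_format, of P] that False unfolding C_def S_def by (meson UN_I less_le)
    qed (use that in auto)
  qed simp
  show ?thesis
    using \<open>0 \<le> b\<close>
  proof (induction "card {c\<in>C. 0 \<le> c \<and> c < b}" arbitrary: b rule: less_induct)
    case less
    let ?A = "{c\<in>C. 0 \<le> c \<and> c < b}"
    have finA: "finite ?A" using finC by simp
    show ?case
    proof (cases "?A = {}")
      case True
      then show ?thesis using const[of 0 b] zero less.prems by blast
    next
      case False
      define c where "c = Max ?A"
      have cA: "c \<in> ?A" unfolding c_def using finA False by (rule Max_in)
      have "{c'\<in>C. 0 \<le> c' \<and> c' < c} \<subset> ?A" using cA by auto
      then have "\<theta> c" using less.hyps[of c] cA psubset_card_mono[OF finA] by auto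
      then have "\<theta> (c + 1)" using step cA by auto
      moreover have "\<theta> (c + 1) \<longleftrightarrow> \<theta> b"
      proof (rule const)
        show "0 \<le> c + 1" using cA by auto
        show "c + 1 \<le> b" using cA pz_less_iff[of c b] by auto
        fix c' assume c': "c' \<in> C" "c + 1 \<le> c'" "c' < b"
        then have "c < c'" using pz_less_iff[of c c'] by simp
        moreover have "c' \<in> ?A" using c' cA \<open>c < c'\<close> by auto
        ultimately show False using Max_ge[OF finA, of c'] by (simp add: c_def)
      qed
      ultimately show ?thesis by simp
    qed
  qed
qed

section \<open>Soundness and completeness\<close>

text \<open>Equality is interpreted by an arbitrary relation, so that the Henkin model can be the set of all
  terms, without a quotient.\<close>
record 'a str =
  sZero :: 'a
  sOne :: 'a
  sAdd :: "'a \<Rightarrow> 'a \<Rightarrow> 'a"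
  sMul :: "'a \<Rightarrow> 'a \<Rightarrow> 'a"
  sLess :: "'a \<Rightarrow> 'a \<Rightarrow> bool"
  sEq :: "'a \<Rightarrow> 'a \<Rightarrow> bool"

primrec tval :: "'a str \<Rightarrow> (nat \<Rightarrow> 'a) \<Rightarrow> tm \<Rightarrow> 'a" where
  "tval K e (Var n) = e n"
| "tval K e \<^bold>0 = sZero K"
| "tval K e \<^bold>1 = sOne K"
| "tval K e (s \<^bold>+ t) = sAdd K (tval K e s) (tval K e t)"
| "tval K e (s \<^bold>* t) = sMul K (tval K e s) (tval K e t)"

primrec sat :: "'a str \<Rightarrow> (nat \<Rightarrow> 'a) \<Rightarrow> fm \<Rightarrow> bool" where
  "sat K e (s \<^bold>= t) \<longleftrightarrow> sEq K (tval K e s) (tval K e t)"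
| "sat K e (s \<^bold>< t) \<longleftrightarrow> sLess K (tval K e s) (tval K e t)"
| "sat K e \<^bold>\<bottom> \<longleftrightarrow> False"
| "sat K e (p \<^bold>\<longrightarrow> q) \<longleftrightarrow> (sat K e p \<longrightarrow> sat K e q)"
| "sat K e (p \<^bold>\<and> q) \<longleftrightarrow> sat K e p \<and> sat K e q"
| "sat K e (p \<^bold>\<or> q) \<longleftrightarrow> sat K e p \<or> sat K e q"
| "sat K e (All p) \<longleftrightarrow> (\<forall>x. sat K (case_nat x e) p)"
| "sat K e (Ex p) \<longleftrightarrow> (\<exists>x. sat K (case_nat x e) p)"

lemma tval_cong: "(\<And>n. n \<in> fv_tm t \<Longrightarrow> e n = e' n) \<Longrightarrow> tval K e t = tval K e' t"
  by (induction t) auto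

lemma sat_cong: "(\<And>n. n \<in> fv p \<Longrightarrow> e n = e' n) \<Longrightarrow> sat K e p \<longleftrightarrow> sat K e' p"
proof (induction p arbitrary: e e')
  case (Eq s t)
  then show ?case using tval_cong[of s e e' K] tval_cong[of t e e' K] by simp
next
  case (Less s t)
  then show ?case using tval_cong[of s e e' K] tval_cong[of t e e' K] by simp
next
  case (All p)
  have "sat K (case_nat x e) p \<longleftrightarrow> sat K (case_nat x e') p" for x
    by (rule All.IH) (use All.prems in \<open>auto split: nat.split\<close>)
  then show ?case by simp
next
  case (Ex p)
  have "sat K (case_nat x e) p \<longleftrightarrow> sat K (case_nat x e') p" for x
    by (rule Ex.IH) (use Ex.prems in \<open>auto split: nat.split\<close>)
  then show ?case by simp
next
  case (Imp p q)
  show ?case using Imp.prems Imp.IH(1)[of e e'] Imp.IH(2)[of e e'] by simp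
next
  case (Conj p q)
  show ?case using Conj.prems Conj.IH(1)[of e e'] Conj.IH(2)[of e e'] by simp
next
  case (Disj p q)
  show ?case using Disj.prems Disj.IH(1)[of e e'] Disj.IH(2)[of e e'] by simp
qed simp

lemma tval_subst: "tval K e (subst_tm \<sigma> t) = tval K (\<lambda>n. tval K e (\<sigma> n)) t"
  by (induction t) auto

lemma tval_under_binder:
  "(\<lambda>n. tval K (case_nat x e) (under_binder \<sigma> n)) = case_nat x (\<lambda>n. tval K e (\<sigma> n))"
  by (rule ext) (simp add: under_binder_def tval_subst split: nat.split)

lemma sat_subst: "sat K e (subst \<sigma> p) \<longleftrightarrow> sat K (\<lambda>n. tval K e (\<sigma> n)) p"
  by (induction p arbitrary: e \<sigma>) (simp_all add: tval_subst tval_under_binder)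

lemma sat_lift: "sat K (case_nat x e) (lift p) \<longleftrightarrow> sat K e p"
  by (simp add: lift_def sat_subst)

lemma sat_inst: "sat K e (inst p t) \<longleftrightarrow> sat K (case_nat (tval K e t) e) p"
proof -
  have "(\<lambda>n. tval K e (case_nat t Var n)) = case_nat (tval K e t) e"
    by (rule ext) (simp split: nat.split)
  then show ?thesis by (simp add: inst_def sat_subst)
qed

theorem soundness:
  assumes "\<Gamma> \<turnstile> p" "sEq K = (=)" "\<And>q. q \<in> \<Gamma> \<Longrightarrow> sat K e q"
  shows "sat K e p"
  using assms(1,3)
proof (induction arbitrary: e rule: derives.induct)
  case (allI \<Gamma> p)
  have "sat K (case_nat x e) p" for x
    by (rule allI.IH) (use allI.prems in \<open>auto simp: sat_lift\<close>)
  then show ?case by simp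
next
  case (exE \<Gamma> p q)
  then obtain x where "sat K (case_nat x e) p" by force
  then have "sat K (case_nat x e) (lift q)" using exE by (intro exE.IH(2)) (auto simp: sat_lift)
  then show ?case by (simp add: sat_lift)
next
  case (ccontr p \<Gamma>)
  then have "sat K e (\<^bold>\<not> p) \<Longrightarrow> sat K e \<^bold>\<bottom>" by (metis insert_iff)
  then show ?case by auto
next
  case (impI p \<Gamma> q)
  then have "sat K e p \<Longrightarrow> sat K e q" by (metis insert_iff)
  then show ?case by simp
next
  case (disjE \<Gamma> p q r)
  then have "sat K e p \<or> sat K e q" by force
  then show ?case using disjE.IH(2,3) disjE.prems by (metis insert_iff)
next
  case (allE \<Gamma> p t)
  then show ?case by (force simp: sat_inst)
next
  case (exI \<Gamma> p t)
  then show ?case by (force simp: sat_inst)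
next
  case (eqE \<Gamma> s t p)
  then show ?case using \<open>sEq K = (=)\<close> by (force simp: sat_inst)
qed (use assms(2) in \<open>force+\<close>)

lemma subst_tm_cong: "(\<And>n. n \<in> fv_tm t \<Longrightarrow> \<sigma> n = \<tau> n) \<Longrightarrow> subst_tm \<sigma> t = subst_tm \<tau> t"
  by (induction t) auto

lemma subst_cong: "(\<And>n. n \<in> fv p \<Longrightarrow> \<sigma> n = \<tau> n) \<Longrightarrow> subst \<sigma> p = subst \<tau> p"
proof (induction p arbitrary: \<sigma> \<tau>)
  case (All p)
  have "subst (under_binder \<sigma>) p = subst (under_binder \<tau>) p"
    by (rule All.IH) (use All.prems in \<open>auto simp: under_binder_def split: nat.split\<close>)
  then show ?case by simp
next
  case (Ex p)
  have "subst (under_binder \<sigma>) p = subst (under_binder \<tau>) p"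
    by (rule Ex.IH) (use Ex.prems in \<open>auto simp: under_binder_def split: nat.split\<close>)
  then show ?case by simp
next
  case (Imp p q)
  show ?case using Imp.prems Imp.IH(1)[of \<sigma> \<tau>] Imp.IH(2)[of \<sigma> \<tau>] by simp
next
  case (Conj p q)
  show ?case using Conj.prems Conj.IH(1)[of \<sigma> \<tau>] Conj.IH(2)[of \<sigma> \<tau>] by simp
next
  case (Disj p q)
  show ?case using Disj.prems Disj.IH(1)[of \<sigma> \<tau>] Disj.IH(2)[of \<sigma> \<tau>] by simp
qed (auto intro!: subst_tm_cong)

lemma subst_tm_subst_tm: "subst_tm \<sigma> (subst_tm \<tau> t) = subst_tm (\<lambda>n. subst_tm \<sigma> (\<tau> n)) t"
  by (induction t) auto

lemma under_binder_comp:
  "(\<lambda>n. subst_tm (under_binder \<sigma>) (under_binder \<tau> n)) = under_binder (\<lambda>n. subst_tm \<sigma> (\<tau> n))"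
  by (rule ext) (simp add: under_binder_def subst_tm_subst_tm split: nat.split)

lemma subst_subst: "subst \<sigma> (subst \<tau> p) = subst (\<lambda>n. subst_tm \<sigma> (\<tau> n)) p"
  by (induction p arbitrary: \<sigma> \<tau>) (simp_all add: subst_tm_subst_tm under_binder_comp)

lemma subst_tm_Var: "subst_tm Var t = t"
  by (induction t) auto

lemma under_binder_Var: "under_binder Var = Var"
  by (rule ext) (simp add: under_binder_def split: nat.split)

lemma subst_Var: "subst Var p = p"
  by (induction p) (simp_all add: subst_tm_Var under_binder_Var)

lemma subst_under_binder_lift: "subst (under_binder \<sigma>) (lift p) = lift (subst \<sigma> p)"
  by (simp add: lift_def subst_subst under_binder_def)

lemma subst_inst: "subst \<sigma> (inst p t) = inst (subst (under_binder \<sigma>) p) (subst_tm \<sigma> t)"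
proof -
  have "(\<lambda>n. subst_tm \<sigma> (case_nat t Var n)) =
      (\<lambda>n. subst_tm (case_nat (subst_tm \<sigma> t) Var) (under_binder \<sigma> n))"
    by (rule ext) (simp add: under_binder_def subst_tm_subst_tm subst_tm_Var split: nat.split)
  then show ?thesis by (simp add: inst_def subst_subst)
qed

text \<open>Closure under substitution is what turns a free variable into the eigenvariable of
  \<open>exE\<close> in \<open>consistent_witness\<close>.\<close>

lemma derives_subst: "\<Gamma> \<turnstile> p \<Longrightarrow> subst \<sigma> ` \<Gamma> \<turnstile> subst \<sigma> p"
proof (induction arbitrary: \<sigma> rule: derives.induct)
  case (allI \<Gamma> p)
  have "subst (under_binder \<sigma>) ` lift ` \<Gamma> = lift ` subst \<sigma> ` \<Gamma>"
    by (simp add: image_image subst_under_binder_lift)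
  then show ?case using allI.IH[of "under_binder \<sigma>"] by (auto intro: derives.allI)
next
  case (exE \<Gamma> p q)
  have "subst (under_binder \<sigma>) ` insert p (lift ` \<Gamma>) = insert (subst (under_binder \<sigma>) p) (lift ` subst \<sigma> ` \<Gamma>)"
    by (simp add: image_image subst_under_binder_lift)
  then show ?case using exE.IH(1)[of \<sigma>] exE.IH(2)[of "under_binder \<sigma>"]
    by (auto intro: derives.exE simp: subst_under_binder_lift)
next
  case (eqE \<Gamma> s t p)
  show ?case using derives.eqE[OF eqE.IH(1)[of \<sigma>, simplified]] eqE.IH(2)[of \<sigma>] by (simp add: subst_inst)
next
  case (disjE \<Gamma> p q r)
  show ?case
    by (rule derives.disjE[of _ "subst \<sigma> p" "subst \<sigma> q"])
      (use disjE.IH(1)[of \<sigma>] disjE.IH(2)[of \<sigma>] disjE.IH(3)[of \<sigma>] in simp_all)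
next
  case (impE \<Gamma> p q)
  show ?case by (rule derives.impE[of _ "subst \<sigma> p"]) (use impE.IH[of \<sigma>] in simp_all)
next
  case (conjE1 \<Gamma> p q)
  show ?case by (rule derives.conjE1[of _ _ "subst \<sigma> q"]) (use conjE1.IH[of \<sigma>] in simp)
next
  case (conjE2 \<Gamma> p q)
  show ?case by (rule derives.conjE2[of _ "subst \<sigma> p"]) (use conjE2.IH[of \<sigma>] in simp)
next
  case (allE \<Gamma> p t)
  show ?case using derives.allE[of "subst \<sigma> ` \<Gamma>" "subst (under_binder \<sigma>) p"] allE.IH[of \<sigma>] by (simp add: subst_inst)
next
  case (exI \<Gamma> p t)
  show ?case using derives.exI[of "subst \<sigma> ` \<Gamma>" "subst (under_binder \<sigma>) p"] exI.IH[of \<sigma>] by (simp add: subst_inst)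
next
  case (assm p \<Gamma>)
  then show ?case by (auto intro: derives.assm)
next
  case (impI p \<Gamma> q)
  then show ?case using impI.IH[of \<sigma>] by (auto intro: derives.impI)
next
  case (ccontr p \<Gamma>)
  then show ?case using ccontr.IH[of \<sigma>] by (auto intro: derives.ccontr)
next
  case (conjI \<Gamma> p q)
  then show ?case by (auto intro: derives.conjI)
next
  case (disjI1 \<Gamma> p q)
  then show ?case by (auto intro: derives.disjI1)
next
  case (disjI2 \<Gamma> q p)
  then show ?case by (auto intro: derives.disjI2)
next
  case (eqI \<Gamma> t)
  then show ?case by (auto intro: derives.eqI)
qed

lemma derives_mono: "\<Gamma> \<turnstile> p \<Longrightarrow> \<Gamma> \<subseteq> \<Delta> \<Longrightarrow> \<Delta> \<turnstile> p"
proof (induction arbitrary: \<Delta> rule: derives.induct)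
  case (allI \<Gamma> p)
  then show ?case by (meson derives.allI image_mono)
next
  case (exE \<Gamma> p q)
  then show ?case by (meson derives.exE image_mono insert_mono)
qed (meson derives.intros insert_mono subsetD)+

section \<open>Finiteness of derivations\<close>

definition fin_derives :: "fm set \<Rightarrow> fm \<Rightarrow> bool" where
  "fin_derives \<Gamma> p \<longleftrightarrow> (\<exists>\<Delta>. finite \<Delta> \<and> \<Delta> \<subseteq> \<Gamma> \<and> \<Delta> \<turnstile> p)"

lemma fin_derivesI: "finite \<Delta> \<Longrightarrow> \<Delta> \<subseteq> \<Gamma> \<Longrightarrow> \<Delta> \<turnstile> p \<Longrightarrow> fin_derives \<Gamma> p"
  unfolding fin_derives_def by metis

lemma fin_derives_insertE:
  assumes "fin_derives (insert p \<Gamma>) q"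
  obtains \<Delta> where "finite \<Delta>" "\<Delta> \<subseteq> \<Gamma>" "insert p \<Delta> \<turnstile> q"
proof -
  obtain \<Delta> where D: "finite \<Delta>" "\<Delta> \<subseteq> insert p \<Gamma>" "\<Delta> \<turnstile> q"
    using assms unfolding fin_derives_def by blast
  have "\<Delta> - {p} \<subseteq> \<Gamma>" using D(2) by auto
  moreover have "insert p (\<Delta> - {p}) \<turnstile> q" using D(3) by (rule derives_mono) auto
  ultimately show thesis using that[of "\<Delta> - {p}"] D(1) by simp
qed

lemma fin_derives_2:
  assumes "fin_derives \<Gamma> p" "fin_derives \<Gamma> q" "\<And>\<Delta>. \<Delta> \<turnstile> p \<Longrightarrow> \<Delta> \<turnstile> q \<Longrightarrow> \<Delta> \<turnstile> r"
  shows "fin_derives \<Gamma> r"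
proof -
  obtain A B where A: "finite A" "A \<subseteq> \<Gamma>" "A \<turnstile> p" and B: "finite B" "B \<subseteq> \<Gamma>" "B \<turnstile> q"
    using assms unfolding fin_derives_def by blast
  have "A \<union> B \<turnstile> r"
    using derives_mono[OF A(3) Un_upper1] derives_mono[OF B(3) Un_upper2] by (rule assms(3))
  then show ?thesis using A B by (intro fin_derivesI[of "A \<union> B"]) simp_all
qed

lemma fin_derives_1:
  assumes "fin_derives \<Gamma> p" "\<And>\<Delta>. \<Delta> \<turnstile> p \<Longrightarrow> \<Delta> \<turnstile> r"
  shows "fin_derives \<Gamma> r"
  using assms unfolding fin_derives_def by blast

lemma derives_imp_fin_derives: "\<Gamma> \<turnstile> p \<Longrightarrow> fin_derives \<Gamma> p"
proof (induction rule: derives.induct)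
  case (assm p \<Gamma>)
  then show ?case by (intro fin_derivesI[of "{p}"]) (simp_all add: derives.assm)
next
  case (impI p \<Gamma> q)
  from impI.IH obtain \<Delta> where "finite \<Delta>" "\<Delta> \<subseteq> \<Gamma>" "insert p \<Delta> \<turnstile> q" by (rule fin_derives_insertE)
  then show ?case by (intro fin_derivesI[of \<Delta>] derives.impI)
next
  case (ccontr p \<Gamma>)
  from ccontr.IH obtain \<Delta> where "finite \<Delta>" "\<Delta> \<subseteq> \<Gamma>" "insert (\<^bold>\<not> p) \<Delta> \<turnstile> \<^bold>\<bottom>" by (rule fin_derives_insertE)
  then show ?case using fin_derivesI[OF _ _ derives.ccontr] by simp
next
  case (disjE \<Gamma> p q r)
  from disjE.IH(1) obtain A where A: "finite A" "A \<subseteq> \<Gamma>" "A \<turnstile> p \<^bold>\<or> q" unfolding fin_derives_def by blast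
  from disjE.IH(2) obtain B where B: "finite B" "B \<subseteq> \<Gamma>" "insert p B \<turnstile> r" by (rule fin_derives_insertE)
  from disjE.IH(3) obtain C where C: "finite C" "C \<subseteq> \<Gamma>" "insert q C \<turnstile> r" by (rule fin_derives_insertE)
  have "A \<union> B \<union> C \<turnstile> p \<^bold>\<or> q" "insert p (A \<union> B \<union> C) \<turnstile> r" "insert q (A \<union> B \<union> C) \<turnstile> r"
    by (rule derives_mono[OF A(3)] derives_mono[OF B(3)] derives_mono[OF C(3)], blast)+
  then have "A \<union> B \<union> C \<turnstile> r" by (rule derives.disjE)
  then show ?case using A B C by (intro fin_derivesI[of "A \<union> B \<union> C"]) simp_all
next
  case (allI \<Gamma> p)
  from allI.IH obtain \<Delta> where D: "finite \<Delta>" "\<Delta> \<subseteq> lift ` \<Gamma>" "\<Delta> \<turnstile> p" unfolding fin_derives_def by blast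
  obtain A where A: "A \<subseteq> \<Gamma>" "finite A" "\<Delta> = lift ` A" using finite_subset_image[OF D(1,2)] by blast
  then show ?case using D(3) by (intro fin_derivesI[of A] derives.allI) simp_all
next
  case (exE \<Gamma> p q)
  from exE.IH(1) obtain A where A: "finite A" "A \<subseteq> \<Gamma>" "A \<turnstile> Ex p" unfolding fin_derives_def by blast
  from exE.IH(2) obtain B where B: "finite B" "B \<subseteq> lift ` \<Gamma>" "insert p B \<turnstile> lift q" by (rule fin_derives_insertE)
  obtain C where C: "C \<subseteq> \<Gamma>" "finite C" "B = lift ` C" using finite_subset_image[OF B(1,2)] by blast
  have "insert p (lift ` (A \<union> C)) \<turnstile> lift q" using B(3) by (rule derives_mono) (auto simp: C(3))
  moreover have "A \<union> C \<turnstile> Ex p" using A(3) by (rule derives_mono) simp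
  ultimately have "A \<union> C \<turnstile> q" by (rule derives.exE[rotated])
  then show ?case using A C by (intro fin_derivesI[of "A \<union> C"]) simp_all
next
  case (eqI \<Gamma> t)
  show ?case by (intro fin_derivesI[of "{}"]) (simp_all add: derives.eqI)
next
  case (impE \<Gamma> p q)
  from impE.IH show ?case by (rule fin_derives_2) (rule derives.impE)
next
  case (conjI \<Gamma> p q)
  from conjI.IH show ?case by (rule fin_derives_2) (rule derives.conjI)
next
  case (eqE \<Gamma> s t p)
  from eqE.IH show ?case by (rule fin_derives_2) (rule derives.eqE)
next
  case (conjE1 \<Gamma> p q)
  from conjE1.IH show ?case by (rule fin_derives_1) (rule derives.conjE1)
next
  case (conjE2 \<Gamma> p q)
  from conjE2.IH show ?case by (rule fin_derives_1) (rule derives.conjE2)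
next
  case (disjI1 \<Gamma> p q)
  from disjI1.IH show ?case by (rule fin_derives_1) (rule derives.disjI1)
next
  case (disjI2 \<Gamma> q p)
  from disjI2.IH show ?case by (rule fin_derives_1) (rule derives.disjI2)
next
  case (allE \<Gamma> p t)
  from allE.IH show ?case by (rule fin_derives_1) (rule derives.allE)
next
  case (exI \<Gamma> p t)
  from exI.IH show ?case by (rule fin_derives_1) (rule derives.exI)
qed

section \<open>The Henkin construction\<close>

instance tm :: countable by countable_datatype
instance fm :: countable by countable_datatype

lemma finite_fv_tm: "finite (fv_tm t)"
  by (induction t) auto

lemma finite_fv: "finite (fv p)"
proof (induction p)
  case (All p)
  then show ?case using finite_vimageI[of "fv p" Suc] by (simp add: vimage_def)
next
  case (Ex p)
  then show ?case using finite_vimageI[of "fv p" Suc] by (simp add: vimage_def)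
qed (simp_all add: finite_fv_tm)

lemma derives_contr: "insert p \<Gamma> \<turnstile> \<^bold>\<bottom> \<Longrightarrow> \<Gamma> \<turnstile> \<^bold>\<not> p"
  by (rule derives.impI)

lemma derives_contradiction: "\<^bold>\<not> p \<in> \<Gamma> \<Longrightarrow> p \<in> \<Gamma> \<Longrightarrow> \<Gamma> \<turnstile> \<^bold>\<bottom>"
  by (rule derives.impE[OF derives.assm derives.assm])

lemma derives_cut: "\<Gamma> \<turnstile> p \<Longrightarrow> insert p \<Gamma> \<turnstile> q \<Longrightarrow> \<Gamma> \<turnstile> q"
  by (rule derives.impE[OF derives.impI])

text \<open>The renaming \<sigma> sends the variable \<open>k\<close> to 0 and every other variable
  up by one. On formulas without \<open>k\<close> it agrees with \<open>lift\<close>, and it turns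
  the witness instance back into \<open>q\<close>; so a contradiction becomes the premise of
  \<open>exE\<close>.\<close>

lemma consistent_witness:
  assumes "consistent (insert (Ex q) H)" and fresh: "\<And>p. p \<in> insert (Ex q) H \<Longrightarrow> k \<notin> fv p"
  shows "consistent (insert (inst q (Var k)) (insert (Ex q) H))"
  unfolding consistent_def
proof
  assume *: "insert (inst q (Var k)) (insert (Ex q) H) \<turnstile> \<^bold>\<bottom>"
  define \<sigma> where "\<sigma> n = (if n = k then Var 0 else Var (Suc n))" for n
  have lift: "subst \<sigma> p = lift p" if "p \<in> insert (Ex q) H" for p
    unfolding lift_def by (rule subst_cong) (use fresh[OF that] in \<open>auto simp: \<sigma>_def\<close>)
  have "subst \<sigma> (inst q (Var k)) = subst (\<lambda>n. subst_tm \<sigma> (case_nat (Var k) Var n)) q"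
    by (simp add: inst_def subst_subst)
  also have "\<dots> = subst Var q"
  proof (rule subst_cong)
    fix n assume "n \<in> fv q"
    moreover have "Suc k \<notin> fv q" using fresh[of "Ex q"] by simp
    ultimately show "subst_tm \<sigma> (case_nat (Var k) Var n) = Var n"
      by (auto simp: \<sigma>_def split: nat.split)
  qed
  finally have inst: "subst \<sigma> (inst q (Var k)) = q" by (simp add: subst_Var)
  have "subst \<sigma> ` insert (Ex q) H = lift ` insert (Ex q) H"
    using lift by (intro image_cong) simp_all
  then have "subst \<sigma> ` insert (inst q (Var k)) (insert (Ex q) H) = insert q (lift ` insert (Ex q) H)"
    unfolding image_insert inst by simp
  then have "insert q (lift ` insert (Ex q) H) \<turnstile> lift \<^bold>\<bottom>"
    using derives_subst[OF *, of \<sigma>] by (simp add: lift_def)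
  moreover have "insert (Ex q) H \<turnstile> Ex q" by (rule derives.assm) simp
  ultimately have "insert (Ex q) H \<turnstile> \<^bold>\<bottom>" by (rule derives.exE[rotated])
  then show False using assms(1) by (simp add: consistent_def)
qed

definition fresh :: "fm set \<Rightarrow> nat" where
  "fresh H = (SOME k. \<forall>p\<in>H. k \<notin> fv p)"

fun witness :: "fm set \<Rightarrow> fm \<Rightarrow> fm set" where
  "witness H (Ex q) = insert (inst q (Var (fresh (insert (Ex q) H)))) (insert (Ex q) H)"
| "witness H p = insert p H"

text \<open>Free variables serve as Henkin constants. The axioms are sentences and each stage adds
  only finitely many formulas, so a fresh variable always remains, and a single enumeration of the
  formulas provides both maximality and witnesses.\<close>

primrec henkin :: "fm set \<Rightarrow> nat \<Rightarrow> fm set" where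
  "henkin A 0 = A"
| "henkin A (Suc n) = (let p = from_nat n in
     if consistent (insert p (henkin A n)) then witness (henkin A n) p else henkin A n)"

context
  fixes A :: "fm set"
  assumes sen: "\<forall>p\<in>A. sentence p" and con: "consistent A"
begin

lemma henkin_finite: "finite (henkin A n - A)"
proof (induction n)
  case (Suc n)
  have "finite (witness (henkin A n) p - A)" for p
    using Suc by (cases p) (simp_all add: insert_Diff_if)
  then show ?case using Suc by (simp add: Let_def)
qed simp

lemma henkin_fresh: "p \<in> insert q (henkin A n) \<Longrightarrow> fresh (insert q (henkin A n)) \<notin> fv p"
proof -
  let ?B = "insert q (henkin A n - A)"
  have "finite (\<Union> (fv ` ?B))" using henkin_finite[of n] by (simp add: finite_fv)
  then obtain k where "k \<notin> \<Union> (fv ` ?B)" using ex_new_if_finite infinite_UNIV_nat by blast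
  moreover have "k \<notin> fv p" if "p \<in> A" for p using sen that by (simp add: sentence_def)
  ultimately have "\<forall>p\<in>insert q (henkin A n). k \<notin> fv p" by blast
  then have "\<forall>p\<in>insert q (henkin A n). fresh (insert q (henkin A n)) \<notin> fv p"
    unfolding fresh_def by (rule someI)
  then show "p \<in> insert q (henkin A n) \<Longrightarrow> fresh (insert q (henkin A n)) \<notin> fv p" by blast
qed

lemma henkin_consistent: "consistent (henkin A n)"
proof (induction n)
  case (Suc n)
  have "consistent (witness (henkin A n) p)" if "consistent (insert p (henkin A n))" for p
  proof (cases "\<exists>q. p = Ex q")
    case True
    then obtain q where q: "p = Ex q" ..
    show ?thesis unfolding q witness.simps
      by (rule consistent_witness) (use that q henkin_fresh in auto)
  next
    case False
    then have "witness (henkin A n) p = insert p (henkin A n)" by (cases p) auto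
    then show ?thesis using that by simp
  qed
  then show ?case using Suc by (simp add: Let_def)
qed (simp add: con)

lemma witness_subset: "insert p H \<subseteq> witness H p"
  by (cases p) auto

lemma henkin_mono: "m \<le> n \<Longrightarrow> henkin A m \<subseteq> henkin A n"
proof (rule lift_Suc_mono_le[of "henkin A"])
  show "henkin A n \<subseteq> henkin A (Suc n)" for n
    using witness_subset by (auto simp: Let_def)
qed

definition "henkin_hull = (\<Union>n. henkin A n)"

lemma subset_henkin_hull: "A \<subseteq> henkin_hull"
proof
  fix p assume "p \<in> A"
  then have "p \<in> henkin A 0" by simp
  then show "p \<in> henkin_hull" unfolding henkin_hull_def by (rule UN_I[OF UNIV_I])
qed

lemma henkin_hull_consistent: "consistent henkin_hull"
  unfolding consistent_def
proof
  assume "henkin_hull \<turnstile> \<^bold>\<bottom>"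
  then have "fin_derives henkin_hull \<^bold>\<bottom>" by (rule derives_imp_fin_derives)
  then obtain D where D: "finite D" "D \<subseteq> henkin_hull" "D \<turnstile> \<^bold>\<bottom>" unfolding fin_derives_def by blast
  have "\<exists>n. D \<subseteq> henkin A n"
    using D(1,2)
  proof (induction D)
    case (insert p D)
    then obtain m n where "p \<in> henkin A m" "D \<subseteq> henkin A n" by (auto simp: henkin_hull_def)
    then have "insert p D \<subseteq> henkin A (max m n)"
      using henkin_mono[of m "max m n"] henkin_mono[of n "max m n"] by auto
    then show ?case ..
  qed simp
  then obtain n where "D \<subseteq> henkin A n" ..
  then have "henkin A n \<turnstile> \<^bold>\<bottom>" using D(3) by (rule derives_mono[rotated])
  then show False using henkin_consistent[of n] by (simp add: consistent_def)
qed

text \<open>The stage indexed by the code of \<open>p\<close> adds \<open>p\<close>, together with a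
  witness if \<open>p\<close> is existential, because consistency with the hull implies consistency
  with that stage.\<close>

lemma henkin_hull_maximal:
  assumes "consistent (insert p henkin_hull)"
  shows "p \<in> henkin_hull" "p = Ex q \<Longrightarrow> \<exists>t. inst q t \<in> henkin_hull"
proof -
  obtain n where n: "p = from_nat n" using surj_from_nat by (metis surjD)
  have "insert p (henkin A n) \<subseteq> insert p henkin_hull" by (auto simp: henkin_hull_def)
  then have "consistent (insert p (henkin A n))"
    using assms derives_mono unfolding consistent_def by blast
  then have "henkin A (Suc n) = witness (henkin A n) p" by (simp add: n)
  then have sub: "witness (henkin A n) p \<subseteq> henkin_hull" unfolding henkin_hull_def by blast
  then show "p \<in> henkin_hull" using witness_subset by blast
  show "\<exists>t. inst q t \<in> henkin_hull" if "p = Ex q" using sub unfolding that by auto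
qed

lemma henkin_hull_derives: "henkin_hull \<turnstile> p \<longleftrightarrow> p \<in> henkin_hull"
proof
  assume p: "henkin_hull \<turnstile> p"
  have "consistent (insert p henkin_hull)"
    using derives_cut[OF p] henkin_hull_consistent by (auto simp: consistent_def)
  then show "p \<in> henkin_hull" by (rule henkin_hull_maximal)
qed (rule derives.assm)

lemma henkin_hull_Neg: "\<^bold>\<not> p \<in> henkin_hull \<longleftrightarrow> p \<notin> henkin_hull"
proof
  assume "\<^bold>\<not> p \<in> henkin_hull"
  then show "p \<notin> henkin_hull" using henkin_hull_consistent derives.impE[of henkin_hull p "\<^bold>\<bottom>"] by (auto simp: henkin_hull_derives consistent_def)
next
  assume "p \<notin> henkin_hull"
  then have "\<not> consistent (insert p henkin_hull)" using henkin_hull_maximal(1) by blast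
  then have "henkin_hull \<turnstile> \<^bold>\<not> p" using derives_contr by (simp add: consistent_def)
  then show "\<^bold>\<not> p \<in> henkin_hull" by (simp add: henkin_hull_derives)
qed

lemma henkin_hull_Fls: "\<^bold>\<bottom> \<notin> henkin_hull"
  using henkin_hull_consistent derives.assm by (auto simp: consistent_def)

lemma henkin_hull_Imp: "(p \<^bold>\<longrightarrow> q) \<in> henkin_hull \<longleftrightarrow> (p \<in> henkin_hull \<longrightarrow> q \<in> henkin_hull)"
proof
  assume "(p \<^bold>\<longrightarrow> q) \<in> henkin_hull"
  then show "p \<in> henkin_hull \<longrightarrow> q \<in> henkin_hull" using derives.impE[of henkin_hull p q] by (simp add: henkin_hull_derives)
next
  assume *: "p \<in> henkin_hull \<longrightarrow> q \<in> henkin_hull"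
  have "insert p henkin_hull \<turnstile> q"
  proof (cases "p \<in> henkin_hull")
    case True
    then show ?thesis using * by (intro derives.assm) simp
  next
    case False
    then have "\<^bold>\<not> p \<in> henkin_hull" by (simp add: henkin_hull_Neg)
    then have "insert p henkin_hull \<turnstile> \<^bold>\<bottom>" by (intro derives_contradiction[of p]) simp_all
    then have "insert (\<^bold>\<not> q) (insert p henkin_hull) \<turnstile> \<^bold>\<bottom>" by (rule derives_mono) auto
    then show ?thesis by (rule derives.ccontr)
  qed
  then show "(p \<^bold>\<longrightarrow> q) \<in> henkin_hull" using derives.impI by (simp flip: henkin_hull_derives)
qed

lemma henkin_hull_Conj: "(p \<^bold>\<and> q) \<in> henkin_hull \<longleftrightarrow> p \<in> henkin_hull \<and> q \<in> henkin_hull"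
  using derives.conjI[of henkin_hull p q] derives.conjE1[of henkin_hull p q] derives.conjE2[of henkin_hull p q]
  unfolding henkin_hull_derives by blast

lemma henkin_hull_Disj: "(p \<^bold>\<or> q) \<in> henkin_hull \<longleftrightarrow> p \<in> henkin_hull \<or> q \<in> henkin_hull"
proof
  assume *: "(p \<^bold>\<or> q) \<in> henkin_hull"
  show "p \<in> henkin_hull \<or> q \<in> henkin_hull"
  proof (rule HOL.ccontr)
    assume "\<not> ?thesis"
    then have "\<^bold>\<not> p \<in> henkin_hull" "\<^bold>\<not> q \<in> henkin_hull" by (simp_all add: henkin_hull_Neg)
    then have "insert p henkin_hull \<turnstile> \<^bold>\<bottom>" "insert q henkin_hull \<turnstile> \<^bold>\<bottom>"
      using derives_contradiction[of p "insert p henkin_hull"] derives_contradiction[of q "insert q henkin_hull"] by simp_all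
    then have "henkin_hull \<turnstile> \<^bold>\<bottom>" by (rule derives.disjE[OF derives.assm[OF *]])
    then show False using henkin_hull_consistent by (simp add: consistent_def)
  qed
next
  assume "p \<in> henkin_hull \<or> q \<in> henkin_hull"
  then show "(p \<^bold>\<or> q) \<in> henkin_hull" using derives.disjI1 derives.disjI2 by (metis henkin_hull_derives)
qed

lemma henkin_hull_Ex: "Ex p \<in> henkin_hull \<longleftrightarrow> (\<exists>t. inst p t \<in> henkin_hull)"
proof
  assume "Ex p \<in> henkin_hull"
  then have "consistent (insert (Ex p) henkin_hull)" using henkin_hull_consistent by (simp add: insert_absorb)
  then show "\<exists>t. inst p t \<in> henkin_hull" by (rule henkin_hull_maximal(2)) simp
next
  assume "\<exists>t. inst p t \<in> henkin_hull"
  then show "Ex p \<in> henkin_hull" using derives.exI by (metis henkin_hull_derives)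
qed

lemma henkin_hull_All: "All p \<in> henkin_hull \<longleftrightarrow> (\<forall>t. inst p t \<in> henkin_hull)"
proof
  assume "All p \<in> henkin_hull"
  then show "\<forall>t. inst p t \<in> henkin_hull" using derives.allE by (metis henkin_hull_derives)
next
  assume *: "\<forall>t. inst p t \<in> henkin_hull"
  have "Ex (\<^bold>\<not> p) \<notin> henkin_hull" using * by (auto simp: henkin_hull_Ex henkin_hull_Neg inst_def)
  then have "\<^bold>\<not> (Ex (\<^bold>\<not> p)) \<in> henkin_hull" by (simp add: henkin_hull_Neg)
  moreover have "{\<^bold>\<not> (Ex (\<^bold>\<not> p))} \<turnstile> All p"
  proof (rule derives.allI, rule derives.ccontr)
    let ?G = "insert (\<^bold>\<not> p) (lift ` {\<^bold>\<not> (Ex (\<^bold>\<not> p))})"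
    \<comment> \<open>Lifting shifts the free variables under the binder; instantiating with
      \<open>Var 0\<close> shifts them back.\<close>
    have "inst (subst (under_binder (\<lambda>n. Var (Suc n))) p) (Var 0) = p"
    proof -
      have "(\<lambda>n. subst_tm (case_nat (Var 0) Var) (under_binder (\<lambda>n. Var (Suc n)) n)) = Var"
        by (rule ext) (simp add: under_binder_def split: nat.split)
      then show ?thesis by (simp add: inst_def subst_subst subst_Var)
    qed
    then have "?G \<turnstile> inst (\<^bold>\<not> (subst (under_binder (\<lambda>n. Var (Suc n))) p)) (Var 0)"
      by (intro derives.assm) (simp add: inst_def)
    then have "?G \<turnstile> Ex (\<^bold>\<not> (subst (under_binder (\<lambda>n. Var (Suc n))) p))" by (rule derives.exI)
    moreover have "?G \<turnstile> \<^bold>\<not> (Ex (\<^bold>\<not> (subst (under_binder (\<lambda>n. Var (Suc n))) p)))"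
      by (rule derives.assm) (simp add: lift_def)
    ultimately show "?G \<turnstile> \<^bold>\<bottom>" by (rule derives.impE[rotated])
  qed
  ultimately have "henkin_hull \<turnstile> All p" by (intro derives_mono[of "{\<^bold>\<not> (Ex (\<^bold>\<not> p))}" "All p" henkin_hull]) simp_all
  then show "All p \<in> henkin_hull" by (simp add: henkin_hull_derives)
qed

definition "term_str = \<lparr>sZero = \<^bold>0, sOne = \<^bold>1, sAdd = (\<^bold>+), sMul = (\<^bold>*),
  sLess = (\<lambda>s t. (s \<^bold>< t) \<in> henkin_hull), sEq = (\<lambda>s t. (s \<^bold>= t) \<in> henkin_hull)\<rparr>"

lemma tval_term_str: "tval term_str \<sigma> t = subst_tm \<sigma> t"
  by (induction t) (simp_all add: term_str_def)

lemma inst_under_binder: "inst (subst (under_binder \<sigma>) p) t = subst (case_nat t \<sigma>) p"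
proof -
  have "(\<lambda>n. subst_tm (case_nat t Var) (under_binder \<sigma> n)) = case_nat t \<sigma>"
    by (rule ext) (simp add: under_binder_def subst_tm_subst_tm subst_tm_Var split: nat.split)
  then show ?thesis by (simp add: inst_def subst_subst)
qed

text \<open>Valuations in the term structure are substitutions. Generalising over all of them
  reduces the quantifier cases to instances.\<close>

lemma truth_lemma: "sat term_str \<sigma> p \<longleftrightarrow> subst \<sigma> p \<in> henkin_hull"
proof (induction p arbitrary: \<sigma>)
  case (Eq s t)
  show ?case by (simp add: tval_term_str) (simp add: term_str_def)
next
  case (Less s t)
  show ?case by (simp add: tval_term_str) (simp add: term_str_def)
qed (simp_all add: henkin_hull_Fls henkin_hull_Imp henkin_hull_Conj henkin_hull_Disj henkin_hull_All henkin_hull_Ex inst_under_binder)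

lemma henkin_hull_eqE: "(s \<^bold>= t) \<in> henkin_hull \<Longrightarrow> inst p s \<in> henkin_hull \<Longrightarrow> inst p t \<in> henkin_hull"
  using derives.eqE[of henkin_hull s t p] unfolding henkin_hull_derives by blast

end

definition eq_congruence :: "'a str \<Rightarrow> bool" where
  "eq_congruence K \<longleftrightarrow>
    (\<forall>x. sEq K x x) \<and> (\<forall>x y. sEq K x y \<longrightarrow> sEq K y x) \<and>
    (\<forall>x y z. sEq K x y \<longrightarrow> sEq K y z \<longrightarrow> sEq K x z) \<and>
    (\<forall>x x' y y'. sEq K x x' \<longrightarrow> sEq K y y' \<longrightarrow> sEq K (sAdd K x y) (sAdd K x' y')) \<and>
    (\<forall>x x' y y'. sEq K x x' \<longrightarrow> sEq K y y' \<longrightarrow> sEq K (sMul K x y) (sMul K x' y')) \<and>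
    (\<forall>x x' y y'. sEq K x x' \<longrightarrow> sEq K y y' \<longrightarrow> sLess K x y \<longrightarrow> sLess K x' y')"

abbreviation wk :: "tm \<Rightarrow> tm" where
  "wk \<equiv> subst_tm (\<lambda>n. Var (Suc n))"

lemma subst_tm_case_wk: "subst_tm (case_nat t Var) (wk s) = s"
  by (simp add: subst_tm_subst_tm subst_tm_Var)

context
  fixes A :: "fm set"
  assumes sen: "\<forall>p\<in>A. sentence p" and con: "consistent A"
begin

lemma eq_congruence_term_str: "eq_congruence (term_str A)"
proof -
  note eqE = henkin_hull_eqE[OF sen con]
  have refl: "(t \<^bold>= t) \<in> henkin_hull A" for t
    using henkin_hull_derives[OF sen con] derives.eqI by blast
  have sym: "(t \<^bold>= s) \<in> henkin_hull A" if "(s \<^bold>= t) \<in> henkin_hull A" for s t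
    using eqE[OF that, of "Var 0 \<^bold>= wk s"] refl[of s] by (simp add: inst_def subst_tm_case_wk)
  have trans: "(r \<^bold>= t) \<in> henkin_hull A" if "(r \<^bold>= s) \<in> henkin_hull A" "(s \<^bold>= t) \<in> henkin_hull A" for r s t
    using eqE[OF that(2), of "wk r \<^bold>= Var 0"] that(1) by (simp add: inst_def subst_tm_case_wk)
  have add: "(s \<^bold>+ t \<^bold>= s' \<^bold>+ t') \<in> henkin_hull A" if "(s \<^bold>= s') \<in> henkin_hull A" "(t \<^bold>= t') \<in> henkin_hull A" for s s' t t'
    using eqE[OF that(2), of "wk s \<^bold>+ wk t \<^bold>= wk s' \<^bold>+ Var 0"]
      eqE[OF that(1), of "wk s \<^bold>+ wk t \<^bold>= Var 0 \<^bold>+ wk t"] refl[of "s \<^bold>+ t"]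
    by (simp add: inst_def subst_tm_case_wk)
  have mul: "(s \<^bold>* t \<^bold>= s' \<^bold>* t') \<in> henkin_hull A" if "(s \<^bold>= s') \<in> henkin_hull A" "(t \<^bold>= t') \<in> henkin_hull A" for s s' t t'
    using eqE[OF that(2), of "wk s \<^bold>* wk t \<^bold>= wk s' \<^bold>* Var 0"]
      eqE[OF that(1), of "wk s \<^bold>* wk t \<^bold>= Var 0 \<^bold>* wk t"] refl[of "s \<^bold>* t"]
    by (simp add: inst_def subst_tm_case_wk)
  have less: "(s' \<^bold>< t') \<in> henkin_hull A" if "(s \<^bold>= s') \<in> henkin_hull A" "(t \<^bold>= t') \<in> henkin_hull A" "(s \<^bold>< t) \<in> henkin_hull A" for s s' t t'
    using eqE[OF that(2), of "wk s' \<^bold>< Var 0"]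
      eqE[OF that(1), of "Var 0 \<^bold>< wk t"] that(3)
    by (simp add: inst_def subst_tm_case_wk)
  show ?thesis
    unfolding eq_congruence_def term_str_def[OF sen con] str.simps
    by (intro HOL.conjI HOL.allI HOL.impI) ((rule refl) | (rule sym trans add mul less; assumption))+
qed

lemma term_str_model: "p \<in> A \<Longrightarrow> sat (term_str A) Var p"
proof -
  have "A \<subseteq> henkin_hull A" using subset_henkin_hull[OF sen con] .
  then show "p \<in> A \<Longrightarrow> sat (term_str A) Var p"
    using truth_lemma[OF sen con] by (auto simp: subst_Var)
qed

end

text \<open>Equality in the term structure is membership of the equation in the hull, which is only
  a congruence; hence validity is demanded in all structures with
  \<open>eq_congruence\<close>.\<close>

theorem completeness:
  assumes "\<And>p. p \<in> A \<Longrightarrow> sentence p" "sentence \<psi>"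
    and valid: "\<And>(K :: tm str) e. eq_congruence K \<Longrightarrow> (\<And>p. p \<in> A \<Longrightarrow> sat K e p) \<Longrightarrow> sat K e \<psi>"
  shows "A \<turnstile> \<psi>"
proof (rule HOL.ccontr)
  assume "\<not> A \<turnstile> \<psi>"
  then have con: "consistent (insert (\<^bold>\<not> \<psi>) A)" unfolding consistent_def using derives.ccontr by blast
  have sen: "\<forall>p\<in>insert (\<^bold>\<not> \<psi>) A. sentence p"
    using assms(1,2) by (auto simp: sentence_def)
  let ?K = "term_str (insert (\<^bold>\<not> \<psi>) A)"
  have "sat ?K Var \<psi>"
    by (rule valid[OF eq_congruence_term_str[OF sen con]]) (auto intro: term_str_model[OF sen con])
  moreover have "sat ?K Var (\<^bold>\<not> \<psi>)" by (rule term_str_model[OF sen con]) auto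
  ultimately show False by simp
qed

lemma tval_wk: "tval K (case_nat x e) (wk t) = tval K e t"
  by (simp add: tval_subst)

section \<open>The bounded copy of a structure\<close>

definition leK :: "'a str \<Rightarrow> 'a \<Rightarrow> 'a \<Rightarrow> bool" where
  "leK K x y \<longleftrightarrow> sLess K x y \<or> sEq K x y"

definition BEx :: "nat \<Rightarrow> fm \<Rightarrow> fm" where
  "BEx b p = Ex (Var 0 \<^bold>\<le> Var (Suc b) \<^bold>\<and> p)"

definition BAll :: "nat \<Rightarrow> fm \<Rightarrow> fm" where
  "BAll b p = All (Var 0 \<^bold>\<le> Var (Suc b) \<^bold>\<longrightarrow> p)"

lemma sat_BEx: "sat K e (BEx b p) \<longleftrightarrow> (\<exists>x. leK K x (e b) \<and> sat K (case_nat x e) p)"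
  by (simp add: BEx_def leK_def)

lemma sat_BAll: "sat K e (BAll b p) \<longleftrightarrow> (\<forall>x. leK K x (e b) \<longrightarrow> sat K (case_nat x e) p)"
  by (simp add: BAll_def leK_def)

text \<open>In \<open>DvdF\<close>, \<open>ConF\<close>, \<dots>, \<open>b\<close> is the index of the variable \<open>B\<close> that bounds all quantifiers and \<open>t\<close> is the
  infinite monomial; \<open>dvdK\<close>, \<open>conK\<close>, \<dots> are the relations that these formulas define.\<close>
definition DvdF :: "nat \<Rightarrow> tm \<Rightarrow> tm \<Rightarrow> fm" where
  "DvdF b x y = BEx b (wk x \<^bold>* Var 0 \<^bold>= wk y)"

definition dvdK :: "'a str \<Rightarrow> 'a \<Rightarrow> 'a \<Rightarrow> 'a \<Rightarrow> bool" where
  "dvdK K B x y \<longleftrightarrow> (\<exists>q. leK K q B \<and> sEq K (sMul K x q) y)"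

text \<open>In the model a positive real \<open>c\<close> is represented by the product \<open>c * t\<close>: the divisors of \<open>t * t\<close> are
  monomials, and \<open>z + t\<close> is a monomial only if \<open>z\<close> is a real multiple of \<open>t\<close>.\<close>
definition ConF :: "nat \<Rightarrow> tm \<Rightarrow> tm \<Rightarrow> fm" where
  "ConF b t z = (DvdF b z (t \<^bold>* t) \<^bold>\<and> DvdF b (z \<^bold>+ t) (t \<^bold>* t))"

definition conK :: "'a str \<Rightarrow> 'a \<Rightarrow> 'a \<Rightarrow> 'a \<Rightarrow> bool" where
  "conK K B t z \<longleftrightarrow> dvdK K B z (sMul K t t) \<and> dvdK K B (sAdd K z t) (sMul K t t)"

text \<open>If \<open>u\<close> is a finite real then so is \<open>u + 1\<close>, and both divide \<open>t\<close>; so the second conjunct leaves the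
  infinite monomials.\<close>
definition MonF :: "nat \<Rightarrow> tm \<Rightarrow> tm \<Rightarrow> fm" where
  "MonF b t u = (DvdF b u t \<^bold>\<and> \<^bold>\<not> (DvdF b (u \<^bold>+ \<^bold>1) t))"

definition monK :: "'a str \<Rightarrow> 'a \<Rightarrow> 'a \<Rightarrow> 'a \<Rightarrow> bool" where
  "monK K B t u \<longleftrightarrow> dvdK K B u t \<and> \<not> dvdK K B (sAdd K u (sOne K)) t"

text \<open>Congruence of \<open>x\<close> and \<open>y\<close> modulo \<open>a - c\<close>, written
  without subtraction; the two disjuncts are the two signs of the quotient.\<close>

definition CongF :: "nat \<Rightarrow> tm \<Rightarrow> tm \<Rightarrow> tm \<Rightarrow> tm \<Rightarrow> fm" where
  "CongF b a c x y = BEx b (wk x \<^bold>+ wk c \<^bold>* Var 0 \<^bold>= wk y \<^bold>+ wk a \<^bold>* Var 0 \<^bold>\<or>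
     wk x \<^bold>+ wk a \<^bold>* Var 0 \<^bold>= wk y \<^bold>+ wk c \<^bold>* Var 0)"

definition congK :: "'a str \<Rightarrow> 'a \<Rightarrow> 'a \<Rightarrow> 'a \<Rightarrow> 'a \<Rightarrow> 'a \<Rightarrow> bool" where
  "congK K B a c x y \<longleftrightarrow> (\<exists>q. leK K q B \<and>
     (sEq K (sAdd K x (sMul K c q)) (sAdd K y (sMul K a q)) \<or>
      sEq K (sAdd K x (sMul K a q)) (sAdd K y (sMul K c q))))"

text \<open>\<open>x\<close> takes the value \<open>(y - z) / t\<close> at the point where \<open>v\<close> takes the value \<open>r / t\<close>: the point is the
  zero of \<open>t * w - s\<close> for a monomial \<open>w\<close> and a constant \<open>s\<close>, and \<open>w\<close> may have so small an exponent
  that \<open>x\<close> and \<open>v\<close> are polynomials in \<open>w\<close>.\<close>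
definition ZeroF :: "nat \<Rightarrow> tm \<Rightarrow> tm \<Rightarrow> tm \<Rightarrow> tm \<Rightarrow> tm \<Rightarrow> tm \<Rightarrow> fm" where
  "ZeroF b t x z y v r = BEx b (BEx (b + 1) (let T = wk (wk t) in
     MonF (b + 2) T (Var 1) \<^bold>\<and> ConF (b + 2) T (Var 0) \<^bold>\<and>
     CongF (b + 2) (T \<^bold>* Var 1) (Var 0) (T \<^bold>* (T \<^bold>* wk (wk x) \<^bold>+ wk (wk z))) (T \<^bold>* wk (wk y)) \<^bold>\<and>
     CongF (b + 2) (T \<^bold>* Var 1) (Var 0) (T \<^bold>* (T \<^bold>* wk (wk v))) (T \<^bold>* wk (wk r))))"

definition zeroK :: "'a str \<Rightarrow> 'a \<Rightarrow> 'a \<Rightarrow> 'a \<Rightarrow> 'a \<Rightarrow> 'a \<Rightarrow> 'a \<Rightarrow> 'a \<Rightarrow> bool" where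
  "zeroK K B t x z y v r \<longleftrightarrow> (\<exists>w. leK K w B \<and> (\<exists>s. leK K s B \<and>
     monK K B t w \<and> conK K B t s \<and>
     congK K B (sMul K t w) s (sMul K t (sAdd K (sMul K t x) z)) (sMul K t y) \<and>
     congK K B (sMul K t w) s (sMul K t (sMul K t v)) (sMul K t r)))"

text \<open>\<open>(v, x)\<close> and \<open>(v', x')\<close> code the same element if \<open>x\<close> and \<open>x'\<close> agree wherever \<open>v\<close> and \<open>v'\<close> agree.
  The bound by \<open>t ^ 5\<close> leaves room for the witnesses.\<close>
definition EqF :: "nat \<Rightarrow> tm \<Rightarrow> tm \<Rightarrow> tm \<Rightarrow> tm \<Rightarrow> tm \<Rightarrow> fm" where
  "EqF b t v x v' x' = (t \<^bold>* t \<^bold>* t \<^bold>* t \<^bold>* t \<^bold>< Var b \<^bold>\<and>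
     BAll b (ConF (b + 1) (wk t) (Var 0) \<^bold>\<longrightarrow>
       BEx (b + 1) (BEx (b + 2) (let T = wk (wk (wk t)) in
         ConF (b + 3) T (Var 1) \<^bold>\<and> ConF (b + 3) T (Var 0) \<^bold>\<and>
         ZeroF (b + 3) T (wk (wk (wk x))) (Var 1) (Var 0) (wk (wk (wk v))) (Var 2) \<^bold>\<and>
         ZeroF (b + 3) T (wk (wk (wk x'))) (Var 1) (Var 0) (wk (wk (wk v'))) (Var 2)))))"

definition eqK :: "'a str \<Rightarrow> 'a \<Rightarrow> 'a \<Rightarrow> 'a \<Rightarrow> 'a \<Rightarrow> 'a \<Rightarrow> 'a \<Rightarrow> bool" where
  "eqK K B t v x v' x' \<longleftrightarrow>
     sLess K (sMul K (sMul K (sMul K (sMul K t t) t) t) t) B \<and>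
     (\<forall>r. leK K r B \<longrightarrow> conK K B t r \<longrightarrow> (\<exists>z. leK K z B \<and> (\<exists>y. leK K y B \<and>
       conK K B t z \<and> conK K B t y \<and> zeroK K B t x z y v r \<and> zeroK K B t x' z y v' r)))"

definition DomF :: "nat \<Rightarrow> tm \<Rightarrow> tm \<Rightarrow> tm \<Rightarrow> fm" where
  "DomF b t v x = (MonF b t v \<^bold>\<and> x \<^bold>\<le> t)"

definition domK :: "'a str \<Rightarrow> 'a \<Rightarrow> 'a \<Rightarrow> 'a \<Rightarrow> 'a \<Rightarrow> bool" where
  "domK K B t v x \<longleftrightarrow> monK K B t v \<and> leK K x t"

text \<open>Three codes are first brought to a common monomial, where the operations act on the second
  components.\<close>
definition TriF :: "fm \<Rightarrow> nat \<Rightarrow> tm \<Rightarrow> tm \<Rightarrow> tm \<Rightarrow> tm \<Rightarrow> tm \<Rightarrow> tm \<Rightarrow> tm \<Rightarrow> fm" where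
  "TriF p b t v1 x1 v2 x2 v3 x3 = BEx b (BEx (b + 1) (BEx (b + 2) (BEx (b + 3)
     (let W = (\<lambda>t. wk (wk (wk (wk t)))); T = W t in
      DomF (b + 4) T (Var 3) (Var 2) \<^bold>\<and> DomF (b + 4) T (Var 3) (Var 1) \<^bold>\<and> DomF (b + 4) T (Var 3) (Var 0) \<^bold>\<and>
      EqF (b + 4) T (W v1) (W x1) (Var 3) (Var 2) \<^bold>\<and>
      EqF (b + 4) T (W v2) (W x2) (Var 3) (Var 1) \<^bold>\<and>
      EqF (b + 4) T (W v3) (W x3) (Var 3) (Var 0) \<^bold>\<and> p))))"

definition triK :: "('a \<Rightarrow> 'a \<Rightarrow> 'a \<Rightarrow> bool) \<Rightarrow> 'a str \<Rightarrow> 'a \<Rightarrow> 'a \<Rightarrow> 'a \<Rightarrow> 'a \<Rightarrow> 'a \<Rightarrow> 'a \<Rightarrow> 'a \<Rightarrow> 'a \<Rightarrow> bool" where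
  "triK P K B t v1 x1 v2 x2 v3 x3 \<longleftrightarrow> (\<exists>v. leK K v B \<and> (\<exists>z1. leK K z1 B \<and> (\<exists>z2. leK K z2 B \<and> (\<exists>z3. leK K z3 B \<and>
     domK K B t v z1 \<and> domK K B t v z2 \<and> domK K B t v z3 \<and>
     eqK K B t v1 x1 v z1 \<and> eqK K B t v2 x2 v z2 \<and> eqK K B t v3 x3 v z3 \<and> P z1 z2 z3))))"

text \<open>From \<open>1\<close> on, every standard odd number divides \<open>t\<close>, which makes the constant term of \<open>t\<close> zero; a factor other
  than a monomial could be scaled to have constant term \<open>1\<close> or \<open>-1\<close>, and adding \<open>2\<close> to it would give
  further divisors.\<close>
definition GoodF :: "nat \<Rightarrow> tm \<Rightarrow> fm" where
  "GoodF b t = (t \<^bold>* t \<^bold>* t \<^bold>* t \<^bold>* t \<^bold>< Var b \<^bold>\<and> \<^bold>0 \<^bold>< t \<^bold>\<and>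
     BAll b (DvdF (b + 1) (Var 0 \<^bold>+ Var 0 \<^bold>+ \<^bold>1) (wk t) \<^bold>\<longrightarrow>
       DvdF (b + 1) (Var 0 \<^bold>+ Var 0 \<^bold>+ \<^bold>1 \<^bold>+ \<^bold>1 \<^bold>+ \<^bold>1) (wk t)))"

definition goodK :: "'a str \<Rightarrow> 'a \<Rightarrow> 'a \<Rightarrow> bool" where
  "goodK K B t \<longleftrightarrow> sLess K (sMul K (sMul K (sMul K (sMul K t t) t) t) t) B \<and> sLess K (sZero K) t \<and>
     (\<forall>d. leK K d B \<longrightarrow> dvdK K B (sAdd K (sAdd K d d) (sOne K)) t \<longrightarrow>
       dvdK K B (sAdd K (sAdd K (sAdd K (sAdd K d d) (sOne K)) (sOne K)) (sOne K)) t)"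

lemma sat_DvdF: "sat K e (DvdF b x y) \<longleftrightarrow> dvdK K (e b) (tval K e x) (tval K e y)"
  by (simp add: DvdF_def dvdK_def sat_BEx tval_wk)

lemma sat_ConF: "sat K e (ConF b t z) \<longleftrightarrow> conK K (e b) (tval K e t) (tval K e z)"
  by (simp add: ConF_def conK_def sat_DvdF)

lemma sat_MonF: "sat K e (MonF b t z) \<longleftrightarrow> monK K (e b) (tval K e t) (tval K e z)"
  by (simp add: MonF_def monK_def sat_DvdF)

lemma sat_CongF: "sat K e (CongF b a c x y) \<longleftrightarrow>
    congK K (e b) (tval K e a) (tval K e c) (tval K e x) (tval K e y)"
  by (simp add: CongF_def congK_def sat_BEx tval_wk)

lemma sat_ZeroF: "sat K e (ZeroF b t x z y v r) \<longleftrightarrow>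
    zeroK K (e b) (tval K e t) (tval K e x) (tval K e z) (tval K e y) (tval K e v) (tval K e r)"
  by (simp add: ZeroF_def zeroK_def Let_def sat_BEx tval_wk sat_MonF sat_ConF sat_CongF)

lemma sat_EqF: "sat K e (EqF b t v x v' x') \<longleftrightarrow>
    eqK K (e b) (tval K e t) (tval K e v) (tval K e x) (tval K e v') (tval K e x')"
  by (simp add: EqF_def eqK_def Let_def sat_BEx sat_BAll tval_wk sat_ConF sat_ZeroF eval_nat_numeral)

lemma sat_DomF: "sat K e (DomF b t v x) \<longleftrightarrow> domK K (e b) (tval K e t) (tval K e v) (tval K e x)"
  by (simp add: DomF_def domK_def sat_MonF leK_def)

lemma sat_TriF:
  assumes "\<And>z1 z2 z3 e. sat K (case_nat z3 (case_nat z2 (case_nat z1 e))) p \<longleftrightarrow> P z1 z2 z3"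
  shows "sat K e (TriF p b t v1 x1 v2 x2 v3 x3) \<longleftrightarrow> triK P K (e b) (tval K e t)
    (tval K e v1) (tval K e x1) (tval K e v2) (tval K e x2) (tval K e v3) (tval K e x3)"
  by (simp add: TriF_def triK_def Let_def sat_BEx tval_wk sat_DomF sat_EqF assms eval_nat_numeral)

lemma sat_GoodF: "sat K e (GoodF b t) \<longleftrightarrow> goodK K (e b) (tval K e t)"
  by (simp add: GoodF_def goodK_def sat_BAll sat_DvdF tval_wk)

definition "addP = (Var 2 \<^bold>+ Var 1 \<^bold>= Var 0)"
definition "mulP = (Var 2 \<^bold>* Var 1 \<^bold>= Var 0)"
definition "lessP = (Var 2 \<^bold>< Var 1)"

abbreviation "addK K \<equiv> triK (\<lambda>x y z. sEq K (sAdd K x y) z) K"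
abbreviation "mulK K \<equiv> triK (\<lambda>x y z. sEq K (sMul K x y) z) K"
abbreviation "lessK K \<equiv> triK (\<lambda>x y z. sLess K x y) K"

lemma sat_TriF_inst:
  "sat K e (TriF addP b t v1 x1 v2 x2 v3 x3) \<longleftrightarrow> addK K (e b) (tval K e t)
    (tval K e v1) (tval K e x1) (tval K e v2) (tval K e x2) (tval K e v3) (tval K e x3)"
  "sat K e (TriF mulP b t v1 x1 v2 x2 v3 x3) \<longleftrightarrow> mulK K (e b) (tval K e t)
    (tval K e v1) (tval K e x1) (tval K e v2) (tval K e x2) (tval K e v3) (tval K e x3)"
  "sat K e (TriF lessP b t v1 x1 v2 x2 v3 x3) \<longleftrightarrow> lessK K (e b) (tval K e t)
    (tval K e v1) (tval K e x1) (tval K e v2) (tval K e x2) (tval K e v3) (tval K e x3)"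
  by (rule sat_TriF; simp add: addP_def mulP_def lessP_def eval_nat_numeral)+

section \<open>The defining formulas are Delta_0\<close>

lemma delta0_BEx: "delta0 p \<Longrightarrow> delta0 (BEx b p)"
  unfolding BEx_def by (rule delta0.intros)

lemma delta0_BAll: "delta0 p \<Longrightarrow> delta0 (BAll b p)"
  unfolding BAll_def by (rule delta0.intros)

lemmas delta0_intros = delta0.intros(1-6) delta0_BEx delta0_BAll

lemma delta0_DvdF: "delta0 (DvdF b x y)"
  unfolding DvdF_def by (intro delta0_intros)

lemma delta0_ConF: "delta0 (ConF b t z)"
  unfolding ConF_def by (intro delta0_intros delta0_DvdF)

lemma delta0_MonF: "delta0 (MonF b t z)"
  unfolding MonF_def by (intro delta0_intros delta0_DvdF)

lemma delta0_CongF: "delta0 (CongF b a c x y)"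
  unfolding CongF_def by (intro delta0_intros)

lemma delta0_ZeroF: "delta0 (ZeroF b t x z y v r)"
  unfolding ZeroF_def Let_def by (intro delta0_intros delta0_MonF delta0_ConF delta0_CongF)

lemma delta0_EqF: "delta0 (EqF b t v x v' x')"
  unfolding EqF_def Let_def by (intro delta0_intros delta0_ConF delta0_ZeroF)

lemma delta0_DomF: "delta0 (DomF b t v x)"
  unfolding DomF_def by (intro delta0_intros delta0_MonF)

lemma delta0_atoms: "delta0 addP" "delta0 mulP" "delta0 lessP"
  unfolding addP_def mulP_def lessP_def by (intro delta0_intros)+

lemma delta0_TriF: "delta0 p \<Longrightarrow> delta0 (TriF p b t v1 x1 v2 x2 v3 x3)"
  unfolding TriF_def Let_def by (intro delta0_intros delta0_DomF delta0_EqF)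

lemma delta0_GoodF: "delta0 (GoodF b t)"
  unfolding GoodF_def by (intro delta0_intros delta0_DvdF)

text \<open>\<open>trt d k s v x\<close> says that \<open>(v, x)\<close> codes the value of \<open>s\<close>. The variable \<open>i\<close> of the original formula
  becomes the pair of the variables \<open>d + 2 * i + 1\<close> and \<open>d + 2 * i\<close>, and \<open>t\<close> and \<open>B\<close> are the variables
  \<open>k\<close> and \<open>k + 1\<close>.\<close>
primrec trt :: "nat \<Rightarrow> nat \<Rightarrow> tm \<Rightarrow> tm \<Rightarrow> tm \<Rightarrow> fm" where
  "trt d k (Var i) v x = EqF (k + 1) (Var k) (Var (d + 2 * i + 1)) (Var (d + 2 * i)) v x"
| "trt d k \<^bold>0 v x = (x \<^bold>= \<^bold>0)"
| "trt d k \<^bold>1 v x = (x \<^bold>= \<^bold>1)"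
| "trt d k (s \<^bold>+ s') v x = BEx (k + 1) (BEx (k + 2) (BEx (k + 3) (BEx (k + 4)
     (DomF (k + 5) (Var (k + 4)) (Var 3) (Var 2) \<^bold>\<and> DomF (k + 5) (Var (k + 4)) (Var 1) (Var 0) \<^bold>\<and>
      trt (d + 4) (k + 4) s (Var 3) (Var 2) \<^bold>\<and> trt (d + 4) (k + 4) s' (Var 1) (Var 0) \<^bold>\<and>
      TriF addP (k + 5) (Var (k + 4)) (Var 3) (Var 2) (Var 1) (Var 0) (wk (wk (wk (wk v)))) (wk (wk (wk (wk x))))))))"
| "trt d k (s \<^bold>* s') v x = BEx (k + 1) (BEx (k + 2) (BEx (k + 3) (BEx (k + 4)
     (DomF (k + 5) (Var (k + 4)) (Var 3) (Var 2) \<^bold>\<and> DomF (k + 5) (Var (k + 4)) (Var 1) (Var 0) \<^bold>\<and>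
      trt (d + 4) (k + 4) s (Var 3) (Var 2) \<^bold>\<and> trt (d + 4) (k + 4) s' (Var 1) (Var 0) \<^bold>\<and>
      TriF mulP (k + 5) (Var (k + 4)) (Var 3) (Var 2) (Var 1) (Var 0) (wk (wk (wk (wk v)))) (wk (wk (wk (wk x))))))))"

text \<open>Each quantifier becomes two bounded ones, over \<open>v\<close> and then
  \<open>x\<close>, so the variable \<open>i\<close> sits at \<open>2 * i + 1\<close> and
  \<open>2 * i\<close>, while \<open>t\<close> and \<open>B\<close> move up by two. Two terms are
  equal if one pair codes both values. The order concerns only two codes, so the second is repeated
  in the third place of \<open>TriF\<close>.\<close>

primrec tr :: "nat \<Rightarrow> fm \<Rightarrow> fm" where
  "tr k (s \<^bold>= s') = BEx (k + 1) (BEx (k + 2) (DomF (k + 3) (Var (k + 2)) (Var 1) (Var 0) \<^bold>\<and>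
     trt 2 (k + 2) s (Var 1) (Var 0) \<^bold>\<and> trt 2 (k + 2) s' (Var 1) (Var 0)))"
| "tr k (s \<^bold>< s') = BEx (k + 1) (BEx (k + 2) (BEx (k + 3) (BEx (k + 4)
     (DomF (k + 5) (Var (k + 4)) (Var 3) (Var 2) \<^bold>\<and> DomF (k + 5) (Var (k + 4)) (Var 1) (Var 0) \<^bold>\<and>
      trt 4 (k + 4) s (Var 3) (Var 2) \<^bold>\<and> trt 4 (k + 4) s' (Var 1) (Var 0) \<^bold>\<and>
      TriF lessP (k + 5) (Var (k + 4)) (Var 3) (Var 2) (Var 1) (Var 0) (Var 1) (Var 0)))))"
| "tr k \<^bold>\<bottom> = \<^bold>\<bottom>"
| "tr k (p \<^bold>\<longrightarrow> q) = (tr k p \<^bold>\<longrightarrow> tr k q)"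
| "tr k (p \<^bold>\<and> q) = (tr k p \<^bold>\<and> tr k q)"
| "tr k (p \<^bold>\<or> q) = (tr k p \<^bold>\<or> tr k q)"
| "tr k (All p) = BAll (k + 1) (BAll (k + 2) (DomF (k + 3) (Var (k + 2)) (Var 1) (Var 0) \<^bold>\<longrightarrow> tr (k + 2) p))"
| "tr k (Ex p) = BEx (k + 1) (BEx (k + 2) (DomF (k + 3) (Var (k + 2)) (Var 1) (Var 0) \<^bold>\<and> tr (k + 2) p))"

lemma delta0_trt: "delta0 (trt d k s v x)"
  by (induction s arbitrary: d k v x)
    (auto intro!: delta0_intros delta0_EqF delta0_DomF delta0_TriF delta0_atoms)

lemma delta0_tr: "delta0 (tr k p)"
  by (induction p arbitrary: k)
    (auto intro!: delta0_intros delta0_DomF delta0_TriF delta0_atoms delta0_trt)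

text \<open>The code of \<open>y\<close> itself is \<open>(t, y)\<close>. The bound for comparing with it depends on \<open>y\<close>, so it is
  quantified here.\<close>
definition SameF :: "tm \<Rightarrow> tm \<Rightarrow> tm \<Rightarrow> tm \<Rightarrow> fm" where
  "SameF t v x y = Ex (EqF 0 (wk t) (wk v) (wk x) (wk t) (wk y))"

definition CodesF :: "nat \<Rightarrow> tm \<Rightarrow> tm \<Rightarrow> tm \<Rightarrow> tm \<Rightarrow> fm" where
  "CodesF b t v x y = (v \<^bold>\<le> Var b \<^bold>\<and> x \<^bold>\<le> Var b \<^bold>\<and> DomF b t v x \<^bold>\<and> SameF t v x y)"

definition codes :: "'a str \<Rightarrow> 'a \<Rightarrow> 'a \<Rightarrow> 'a \<Rightarrow> 'a \<Rightarrow> 'a \<Rightarrow> bool" where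
  "codes K B t v x y \<longleftrightarrow> leK K v B \<and> leK K x B \<and> domK K B t v x \<and> (\<exists>B'. eqK K B' t v x t y)"

lemma sat_CodesF: "sat K e (CodesF b t v x y) \<longleftrightarrow>
    codes K (e b) (tval K e t) (tval K e v) (tval K e x) (tval K e y)"
  by (simp add: CodesF_def SameF_def codes_def sat_DomF sat_EqF tval_wk leK_def)

definition Iff :: "fm \<Rightarrow> fm \<Rightarrow> fm" where
  "Iff p q = ((p \<^bold>\<longrightarrow> q) \<^bold>\<and> (q \<^bold>\<longrightarrow> p))"

lemma sat_Iff: "sat K e (Iff p q) \<longleftrightarrow> (sat K e p \<longleftrightarrow> sat K e q)"
  by (auto simp: Iff_def)

text \<open>Says that \<open>codes\<close> induces an isomorphism between the bounded copy modulo
  \<open>eqK\<close> and the whole structure: it is total in both directions and respects 0, 1,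
  equality, order and the operations. Outside all quantifiers, \<open>t\<close> is the variable 0
  and \<open>B\<close> the variable 1.\<close>

definition FaithfulF :: fm where
  "FaithfulF =
    (All (Ex (Ex (CodesF 4 (Var 3) (Var 1) (Var 0) (Var 2)))) \<^bold>\<and>
     All (All (Var 1 \<^bold>\<le> Var 3 \<^bold>\<and> Var 0 \<^bold>\<le> Var 3 \<^bold>\<and> DomF 3 (Var 2) (Var 1) (Var 0) \<^bold>\<longrightarrow>
       Ex (CodesF 4 (Var 3) (Var 2) (Var 1) (Var 0)))) \<^bold>\<and>
     All (All (All (CodesF 4 (Var 3) (Var 2) (Var 1) (Var 0) \<^bold>\<longrightarrow> Iff (Var 1 \<^bold>= \<^bold>0) (Var 0 \<^bold>= \<^bold>0)))) \<^bold>\<and>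
     All (All (All (CodesF 4 (Var 3) (Var 2) (Var 1) (Var 0) \<^bold>\<longrightarrow> Iff (Var 1 \<^bold>= \<^bold>1) (Var 0 \<^bold>= \<^bold>1)))) \<^bold>\<and>
     (All ^^ 6) (CodesF 7 (Var 6) (Var 5) (Var 4) (Var 3) \<^bold>\<longrightarrow> CodesF 7 (Var 6) (Var 2) (Var 1) (Var 0) \<^bold>\<longrightarrow>
       Iff (EqF 7 (Var 6) (Var 5) (Var 4) (Var 2) (Var 1)) (Var 3 \<^bold>= Var 0)) \<^bold>\<and>
     (All ^^ 6) (CodesF 7 (Var 6) (Var 5) (Var 4) (Var 3) \<^bold>\<longrightarrow> CodesF 7 (Var 6) (Var 2) (Var 1) (Var 0) \<^bold>\<longrightarrow>
       Iff (TriF lessP 7 (Var 6) (Var 5) (Var 4) (Var 2) (Var 1) (Var 2) (Var 1)) (Var 3 \<^bold>< Var 0)) \<^bold>\<and>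
     (All ^^ 9) (CodesF 10 (Var 9) (Var 8) (Var 7) (Var 6) \<^bold>\<longrightarrow> CodesF 10 (Var 9) (Var 5) (Var 4) (Var 3) \<^bold>\<longrightarrow>
       CodesF 10 (Var 9) (Var 2) (Var 1) (Var 0) \<^bold>\<longrightarrow>
       Iff (TriF addP 10 (Var 9) (Var 8) (Var 7) (Var 5) (Var 4) (Var 2) (Var 1)) (Var 6 \<^bold>+ Var 3 \<^bold>= Var 0)) \<^bold>\<and>
     (All ^^ 9) (CodesF 10 (Var 9) (Var 8) (Var 7) (Var 6) \<^bold>\<longrightarrow> CodesF 10 (Var 9) (Var 5) (Var 4) (Var 3) \<^bold>\<longrightarrow>
       CodesF 10 (Var 9) (Var 2) (Var 1) (Var 0) \<^bold>\<longrightarrow>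
       Iff (TriF mulP 10 (Var 9) (Var 8) (Var 7) (Var 5) (Var 4) (Var 2) (Var 1)) (Var 6 \<^bold>* Var 3 \<^bold>= Var 0)))"

definition faithful :: "'a str \<Rightarrow> 'a \<Rightarrow> 'a \<Rightarrow> bool" where
  "faithful K B t \<longleftrightarrow>
    (\<forall>y. \<exists>v x. codes K B t v x y) \<and>
    (\<forall>v x. leK K v B \<and> leK K x B \<and> domK K B t v x \<longrightarrow> (\<exists>y. codes K B t v x y)) \<and>
    (\<forall>v x y. codes K B t v x y \<longrightarrow> (sEq K x (sZero K) \<longleftrightarrow> sEq K y (sZero K))) \<and>
    (\<forall>v x y. codes K B t v x y \<longrightarrow> (sEq K x (sOne K) \<longleftrightarrow> sEq K y (sOne K))) \<and>
    (\<forall>v x y v' x' y'. codes K B t v x y \<longrightarrow> codes K B t v' x' y' \<longrightarrow>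
      (eqK K B t v x v' x' \<longleftrightarrow> sEq K y y')) \<and>
    (\<forall>v x y v' x' y'. codes K B t v x y \<longrightarrow> codes K B t v' x' y' \<longrightarrow>
      (lessK K B t v x v' x' v' x' \<longleftrightarrow> sLess K y y')) \<and>
    (\<forall>v x y v' x' y' v'' x'' y''. codes K B t v x y \<longrightarrow> codes K B t v' x' y' \<longrightarrow> codes K B t v'' x'' y'' \<longrightarrow>
      (addK K B t v x v' x' v'' x'' \<longleftrightarrow> sEq K (sAdd K y y') y'')) \<and>
    (\<forall>v x y v' x' y' v'' x'' y''. codes K B t v x y \<longrightarrow> codes K B t v' x' y' \<longrightarrow> codes K B t v'' x'' y'' \<longrightarrow>
      (mulK K B t v x v' x' v'' x'' \<longleftrightarrow> sEq K (sMul K y y') y''))"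

lemma sat_FaithfulF: "sat K (case_nat t (case_nat B e)) FaithfulF \<longleftrightarrow> faithful K B t"
  unfolding FaithfulF_def faithful_def
  by (simp add: sat_CodesF sat_Iff sat_EqF sat_TriF_inst sat_DomF eval_nat_numeral leK_def[of K _ B, symmetric])

context
  fixes K :: "'a str" and B t :: 'a
  assumes cong: "eq_congruence K" and ok: "faithful K B t"
begin

lemma codes_onto: "\<exists>v x. codes K B t v x y"
  using ok[unfolded faithful_def, THEN conjunct1] by simp

lemma codes_total: "leK K v B \<Longrightarrow> leK K x B \<Longrightarrow> domK K B t v x \<Longrightarrow> \<exists>y. codes K B t v x y"
  using ok[unfolded faithful_def, THEN conjunct2, THEN conjunct1, rule_format] by simp

lemma codes_dom: "codes K B t v x y \<Longrightarrow> leK K v B \<and> leK K x B \<and> domK K B t v x"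
  unfolding codes_def by blast

lemma codes_zero: "codes K B t v x y \<Longrightarrow> sEq K x (sZero K) \<longleftrightarrow> sEq K y (sZero K)"
  using ok[unfolded faithful_def, THEN conjunct2, THEN conjunct2, THEN conjunct1, rule_format] .

lemma codes_one: "codes K B t v x y \<Longrightarrow> sEq K x (sOne K) \<longleftrightarrow> sEq K y (sOne K)"
  using ok[unfolded faithful_def, THEN conjunct2, THEN conjunct2, THEN conjunct2, THEN conjunct1, rule_format] .

lemma codes_eq: "codes K B t v x y \<Longrightarrow> codes K B t v' x' y' \<Longrightarrow> eqK K B t v x v' x' \<longleftrightarrow> sEq K y y'"
  using ok[unfolded faithful_def, THEN conjunct2, THEN conjunct2, THEN conjunct2, THEN conjunct2, THEN conjunct1, rule_format] .

lemma codes_less: "codes K B t v x y \<Longrightarrow> codes K B t v' x' y' \<Longrightarrow>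
    lessK K B t v x v' x' v' x' \<longleftrightarrow> sLess K y y'"
  using ok[unfolded faithful_def, THEN conjunct2, THEN conjunct2, THEN conjunct2, THEN conjunct2, THEN conjunct2, THEN conjunct1, rule_format] .

lemma codes_add: "codes K B t v x y \<Longrightarrow> codes K B t v' x' y' \<Longrightarrow> codes K B t v'' x'' y'' \<Longrightarrow>
    addK K B t v x v' x' v'' x'' \<longleftrightarrow> sEq K (sAdd K y y') y''"
  using ok[unfolded faithful_def, THEN conjunct2, THEN conjunct2, THEN conjunct2, THEN conjunct2, THEN conjunct2, THEN conjunct2, THEN conjunct1, rule_format] .

lemma codes_mul: "codes K B t v x y \<Longrightarrow> codes K B t v' x' y' \<Longrightarrow> codes K B t v'' x'' y'' \<Longrightarrow>
    mulK K B t v x v' x' v'' x'' \<longleftrightarrow> sEq K (sMul K y y') y''"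
  using ok[unfolded faithful_def, THEN conjunct2, THEN conjunct2, THEN conjunct2, THEN conjunct2, THEN conjunct2, THEN conjunct2, THEN conjunct2, rule_format] .

lemma bex2I: "leK K v B \<Longrightarrow> leK K x B \<Longrightarrow> P v x \<Longrightarrow> \<exists>v. leK K v B \<and> (\<exists>x. leK K x B \<and> P v x)"
  by blast

lemma bex4I: "leK K v B \<Longrightarrow> leK K x B \<Longrightarrow> leK K v' B \<Longrightarrow> leK K x' B \<Longrightarrow> P v x v' x' \<Longrightarrow>
    \<exists>v. leK K v B \<and> (\<exists>x. leK K x B \<and> (\<exists>v'. leK K v' B \<and> (\<exists>x'. leK K x' B \<and> P v x v' x')))"
  by blast

lemma eq_refl: "sEq K x x"
  using cong[unfolded eq_congruence_def, THEN conjunct1] by simp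

lemma eq_sym: "sEq K x y \<longleftrightarrow> sEq K y x"
  using cong[unfolded eq_congruence_def, THEN conjunct2, THEN conjunct1, rule_format] by metis

lemma eq_trans: "sEq K x y \<Longrightarrow> sEq K y z \<Longrightarrow> sEq K x z"
  using cong[unfolded eq_congruence_def, THEN conjunct2, THEN conjunct2, THEN conjunct1, rule_format] .

lemma eq_add: "sEq K x x' \<Longrightarrow> sEq K y y' \<Longrightarrow> sEq K (sAdd K x y) (sAdd K x' y')"
  using cong[unfolded eq_congruence_def, THEN conjunct2, THEN conjunct2, THEN conjunct2, THEN conjunct1, rule_format] .

lemma eq_mul: "sEq K x x' \<Longrightarrow> sEq K y y' \<Longrightarrow> sEq K (sMul K x y) (sMul K x' y')"
  using cong[unfolded eq_congruence_def, THEN conjunct2, THEN conjunct2, THEN conjunct2, THEN conjunct2, THEN conjunct1, rule_format] .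

lemma eq_less: "sEq K x x' \<Longrightarrow> sEq K y y' \<Longrightarrow> sLess K x y \<Longrightarrow> sLess K x' y'"
  using cong[unfolded eq_congruence_def, THEN conjunct2, THEN conjunct2, THEN conjunct2, THEN conjunct2, THEN conjunct2, rule_format] .

text \<open>The values of subterms receive codes by \<open>codes_onto\<close>, and conversely the
  codes found for subterms have values by \<open>codes_total\<close>; the clauses of
  \<open>faithful\<close> then compare the results.\<close>

lemma sat_trt:
  assumes "e k = t" "e (k + 1) = B"
    and "\<And>i. i \<in> fv_tm s \<Longrightarrow> codes K B t (e (d + 2 * i + 1)) (e (d + 2 * i)) (f i)"
    and "codes K B t (tval K e v) (tval K e x) y"
  shows "sat K e (trt d k s v x) \<longleftrightarrow> sEq K (tval K f s) y"
  using assms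
proof (induction s arbitrary: d k e v x y)
  case (Var i)
  then show ?case using codes_eq[of "e (d + 2 * i + 1)" "e (d + 2 * i)" "f i"] by (simp add: sat_EqF)
next
  case Zero
  then show ?case using codes_zero[OF Zero.prems(4)] eq_sym by simp
next
  case One
  then show ?case using codes_one[OF One.prems(4)] eq_sym by simp
next
  case (Add s1 s2)
  let ?e = "\<lambda>v1 x1 v2 x2. case_nat x2 (case_nat v2 (case_nat x1 (case_nat v1 e)))"
  have IH1: "sat K (?e v1 x1 v2 x2) (trt (d + 4) (k + 4) s1 (Var 3) (Var 2)) \<longleftrightarrow> sEq K (tval K f s1) y1"
    if "codes K B t v1 x1 y1" for v1 x1 v2 x2 y1
    by (rule Add.IH(1)) (use Add.prems that in \<open>simp_all add: eval_nat_numeral\<close>)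
  have IH2: "sat K (?e v1 x1 v2 x2) (trt (d + 4) (k + 4) s2 (Var 1) (Var 0)) \<longleftrightarrow> sEq K (tval K f s2) y2"
    if "codes K B t v2 x2 y2" for v1 x1 v2 x2 y2
    by (rule Add.IH(2)) (use Add.prems that in \<open>simp_all add: eval_nat_numeral\<close>)
  have body: "sat K e (trt d k (s1 \<^bold>+ s2) v x) \<longleftrightarrow>
      (\<exists>v1. leK K v1 B \<and> (\<exists>x1. leK K x1 B \<and> (\<exists>v2. leK K v2 B \<and> (\<exists>x2. leK K x2 B \<and>
        domK K B t v1 x1 \<and> domK K B t v2 x2 \<and>
        sat K (?e v1 x1 v2 x2) (trt (d + 4) (k + 4) s1 (Var 3) (Var 2)) \<and>
        sat K (?e v1 x1 v2 x2) (trt (d + 4) (k + 4) s2 (Var 1) (Var 0)) \<and>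
        addK K B t v1 x1 v2 x2 (tval K e v) (tval K e x)))))"
    using Add.prems(1,2) by (simp add: sat_BEx sat_DomF sat_TriF_inst tval_wk eval_nat_numeral)
  show ?case
  proof
    assume "sat K e (trt d k (s1 \<^bold>+ s2) v x)"
    then obtain v1 x1 v2 x2 where l: "leK K v1 B" "leK K x1 B" "leK K v2 B" "leK K x2 B"
      "domK K B t v1 x1" "domK K B t v2 x2" and
      s: "sat K (?e v1 x1 v2 x2) (trt (d + 4) (k + 4) s1 (Var 3) (Var 2))"
        "sat K (?e v1 x1 v2 x2) (trt (d + 4) (k + 4) s2 (Var 1) (Var 0))"
      and a: "addK K B t v1 x1 v2 x2 (tval K e v) (tval K e x)"
      unfolding body by blast
    obtain y1 y2 where c: "codes K B t v1 x1 y1" "codes K B t v2 x2 y2"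
      using codes_total[OF l(1,2,5)] codes_total[OF l(3,4,6)] by blast
    have "sEq K (tval K f s1) y1" "sEq K (tval K f s2) y2" using IH1[OF c(1)] IH2[OF c(2)] s by simp_all
    then have "sEq K (sAdd K (tval K f s1) (tval K f s2)) (sAdd K y1 y2)" by (rule eq_add)
    moreover have "sEq K (sAdd K y1 y2) y" using codes_add[OF c Add.prems(4)] a by simp
    ultimately show "sEq K (tval K f (s1 \<^bold>+ s2)) y" using eq_trans by simp
  next
    assume *: "sEq K (tval K f (s1 \<^bold>+ s2)) y"
    obtain v1 x1 v2 x2 where c: "codes K B t v1 x1 (tval K f s1)" "codes K B t v2 x2 (tval K f s2)"
      using codes_onto by blast
    show "sat K e (trt d k (s1 \<^bold>+ s2) v x)"
      unfolding body using codes_dom[OF c(1)] codes_dom[OF c(2)]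
      by (intro bex4I[of v1 x1 v2 x2] HOL.conjI)
        (use IH1[OF c(1), of x2 v2] IH2[OF c(2), of x1 v1] codes_add[OF c Add.prems(4)] * eq_refl in simp_all)
  qed
next
  case (Mul s1 s2)
  let ?e = "\<lambda>v1 x1 v2 x2. case_nat x2 (case_nat v2 (case_nat x1 (case_nat v1 e)))"
  have IH1: "sat K (?e v1 x1 v2 x2) (trt (d + 4) (k + 4) s1 (Var 3) (Var 2)) \<longleftrightarrow> sEq K (tval K f s1) y1"
    if "codes K B t v1 x1 y1" for v1 x1 v2 x2 y1
    by (rule Mul.IH(1)) (use Mul.prems that in \<open>simp_all add: eval_nat_numeral\<close>)
  have IH2: "sat K (?e v1 x1 v2 x2) (trt (d + 4) (k + 4) s2 (Var 1) (Var 0)) \<longleftrightarrow> sEq K (tval K f s2) y2"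
    if "codes K B t v2 x2 y2" for v1 x1 v2 x2 y2
    by (rule Mul.IH(2)) (use Mul.prems that in \<open>simp_all add: eval_nat_numeral\<close>)
  have body: "sat K e (trt d k (s1 \<^bold>* s2) v x) \<longleftrightarrow>
      (\<exists>v1. leK K v1 B \<and> (\<exists>x1. leK K x1 B \<and> (\<exists>v2. leK K v2 B \<and> (\<exists>x2. leK K x2 B \<and>
        domK K B t v1 x1 \<and> domK K B t v2 x2 \<and>
        sat K (?e v1 x1 v2 x2) (trt (d + 4) (k + 4) s1 (Var 3) (Var 2)) \<and>
        sat K (?e v1 x1 v2 x2) (trt (d + 4) (k + 4) s2 (Var 1) (Var 0)) \<and>
        mulK K B t v1 x1 v2 x2 (tval K e v) (tval K e x)))))"
    using Mul.prems(1,2) by (simp add: sat_BEx sat_DomF sat_TriF_inst tval_wk eval_nat_numeral)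
  show ?case
  proof
    assume "sat K e (trt d k (s1 \<^bold>* s2) v x)"
    then obtain v1 x1 v2 x2 where l: "leK K v1 B" "leK K x1 B" "leK K v2 B" "leK K x2 B"
      "domK K B t v1 x1" "domK K B t v2 x2" and
      s: "sat K (?e v1 x1 v2 x2) (trt (d + 4) (k + 4) s1 (Var 3) (Var 2))"
        "sat K (?e v1 x1 v2 x2) (trt (d + 4) (k + 4) s2 (Var 1) (Var 0))"
      and a: "mulK K B t v1 x1 v2 x2 (tval K e v) (tval K e x)"
      unfolding body by blast
    obtain y1 y2 where c: "codes K B t v1 x1 y1" "codes K B t v2 x2 y2"
      using codes_total[OF l(1,2,5)] codes_total[OF l(3,4,6)] by blast
    have "sEq K (tval K f s1) y1" "sEq K (tval K f s2) y2" using IH1[OF c(1)] IH2[OF c(2)] s by simp_all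
    then have "sEq K (sMul K (tval K f s1) (tval K f s2)) (sMul K y1 y2)" by (rule eq_mul)
    moreover have "sEq K (sMul K y1 y2) y" using codes_mul[OF c Mul.prems(4)] a by simp
    ultimately show "sEq K (tval K f (s1 \<^bold>* s2)) y" using eq_trans by simp
  next
    assume *: "sEq K (tval K f (s1 \<^bold>* s2)) y"
    obtain v1 x1 v2 x2 where c: "codes K B t v1 x1 (tval K f s1)" "codes K B t v2 x2 (tval K f s2)"
      using codes_onto by blast
    show "sat K e (trt d k (s1 \<^bold>* s2) v x)"
      unfolding body using codes_dom[OF c(1)] codes_dom[OF c(2)]
      by (intro bex4I[of v1 x1 v2 x2] HOL.conjI)
        (use IH1[OF c(1), of x2 v2] IH2[OF c(2), of x1 v1] codes_mul[OF c Mul.prems(4)] * eq_refl in simp_all)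
  qed
qed

text \<open>Invariance of truth under the isomorphism given by \<open>codes\<close>. It holds in
  every structure with a congruence, as it must be applied to unknown models of the axioms.\<close>

lemma sat_tr:
  assumes "e k = t" "e (k + 1) = B"
    and "\<And>i. i \<in> fv p \<Longrightarrow> codes K B t (e (2 * i + 1)) (e (2 * i)) (f i)"
  shows "sat K e (tr k p) \<longleftrightarrow> sat K f p"
  using assms
proof (induction p arbitrary: k e f)
  case (Eq s s')
  let ?e = "\<lambda>v x. case_nat x (case_nat v e)"
  have s: "sat K (?e v x) (trt 2 (k + 2) s (Var 1) (Var 0)) \<longleftrightarrow> sEq K (tval K f s) y"
    "sat K (?e v x) (trt 2 (k + 2) s' (Var 1) (Var 0)) \<longleftrightarrow> sEq K (tval K f s') y"
    if "codes K B t v x y" for v x y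
    by (rule sat_trt; use Eq.prems that in \<open>simp add: eval_nat_numeral\<close>)+
  have body: "sat K e (tr k (s \<^bold>= s')) \<longleftrightarrow> (\<exists>v. leK K v B \<and> (\<exists>x. leK K x B \<and> domK K B t v x \<and>
      sat K (?e v x) (trt 2 (k + 2) s (Var 1) (Var 0)) \<and> sat K (?e v x) (trt 2 (k + 2) s' (Var 1) (Var 0))))"
    using Eq.prems(1,2) by (simp add: sat_BEx sat_DomF eval_nat_numeral)
  show ?case
  proof
    assume "sat K e (tr k (s \<^bold>= s'))"
    then obtain v x where *: "leK K v B" "leK K x B" "domK K B t v x"
      "sat K (?e v x) (trt 2 (k + 2) s (Var 1) (Var 0))" "sat K (?e v x) (trt 2 (k + 2) s' (Var 1) (Var 0))"
      unfolding body by blast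
    obtain y where "codes K B t v x y" using codes_total[OF *(1-3)] by blast
    then have "sEq K (tval K f s) y" "sEq K (tval K f s') y" using s *(4,5) by blast+
    then show "sat K f (s \<^bold>= s')" using eq_sym eq_trans by (metis sat.simps(1))
  next
    assume *: "sat K f (s \<^bold>= s')"
    obtain v x where c: "codes K B t v x (tval K f s')" using codes_onto[of "tval K f s'"] by (elim HOL.exE)
    show "sat K e (tr k (s \<^bold>= s'))"
      unfolding body using codes_dom[OF c]
      by (intro bex2I[of v x] HOL.conjI) (use s[OF c] * eq_refl in simp_all)
  qed
next
  case (Less s s')
  let ?e = "\<lambda>v1 x1 v2 x2. case_nat x2 (case_nat v2 (case_nat x1 (case_nat v1 e)))"
  have s1: "sat K (?e v1 x1 v2 x2) (trt 4 (k + 4) s (Var 3) (Var 2)) \<longleftrightarrow> sEq K (tval K f s) y"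
    if "codes K B t v1 x1 y" for v1 x1 v2 x2 y
    by (rule sat_trt; use Less.prems that in \<open>simp add: eval_nat_numeral\<close>)
  have s2: "sat K (?e v1 x1 v2 x2) (trt 4 (k + 4) s' (Var 1) (Var 0)) \<longleftrightarrow> sEq K (tval K f s') y"
    if "codes K B t v2 x2 y" for v1 x1 v2 x2 y
    by (rule sat_trt; use Less.prems that in \<open>simp add: eval_nat_numeral\<close>)
  have body: "sat K e (tr k (s \<^bold>< s')) \<longleftrightarrow>
      (\<exists>v1. leK K v1 B \<and> (\<exists>x1. leK K x1 B \<and> (\<exists>v2. leK K v2 B \<and> (\<exists>x2. leK K x2 B \<and>
        domK K B t v1 x1 \<and> domK K B t v2 x2 \<and>
        sat K (?e v1 x1 v2 x2) (trt 4 (k + 4) s (Var 3) (Var 2)) \<and>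
        sat K (?e v1 x1 v2 x2) (trt 4 (k + 4) s' (Var 1) (Var 0)) \<and>
        lessK K B t v1 x1 v2 x2 v2 x2))))"
    using Less.prems(1,2) by (simp add: sat_BEx sat_DomF sat_TriF_inst eval_nat_numeral)
  show ?case
  proof
    assume "sat K e (tr k (s \<^bold>< s'))"
    then obtain v1 x1 v2 x2 where l: "leK K v1 B" "leK K x1 B" "leK K v2 B" "leK K x2 B"
      "domK K B t v1 x1" "domK K B t v2 x2" and
      s: "sat K (?e v1 x1 v2 x2) (trt 4 (k + 4) s (Var 3) (Var 2))"
        "sat K (?e v1 x1 v2 x2) (trt 4 (k + 4) s' (Var 1) (Var 0))"
      and a: "lessK K B t v1 x1 v2 x2 v2 x2"
      unfolding body by blast
    obtain y1 y2 where c: "codes K B t v1 x1 y1" "codes K B t v2 x2 y2"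
      using codes_total[OF l(1,2,5)] codes_total[OF l(3,4,6)] by blast
    have "sEq K y1 (tval K f s)" "sEq K y2 (tval K f s')"
      using s1[OF c(1)] s2[OF c(2)] s eq_sym by blast+
    moreover have "sLess K y1 y2" using codes_less[OF c] a by simp
    ultimately have "sLess K (tval K f s) (tval K f s')" by (rule eq_less)
    then show "sat K f (s \<^bold>< s')" by simp
  next
    assume *: "sat K f (s \<^bold>< s')"
    obtain v1 x1 v2 x2 where c: "codes K B t v1 x1 (tval K f s)" "codes K B t v2 x2 (tval K f s')"
      using codes_onto by blast
    show "sat K e (tr k (s \<^bold>< s'))"
      unfolding body using codes_dom[OF c(1)] codes_dom[OF c(2)]
      by (intro bex4I[of v1 x1 v2 x2] HOL.conjI)
        (use s1[OF c(1), of x2 v2] s2[OF c(2), of x1 v1] codes_less[OF c] * eq_refl in simp_all)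
  qed
next
  case (All p)
  have IH: "sat K (case_nat x (case_nat v e)) (tr (k + 2) p) \<longleftrightarrow> sat K (case_nat y f) p"
    if "codes K B t v x y" for v x y
  proof (rule All.IH)
    show "codes K B t (case_nat x (case_nat v e) (2 * i + 1)) (case_nat x (case_nat v e) (2 * i)) (case_nat y f i)"
      if "i \<in> fv p" for i
      using \<open>codes K B t v x y\<close> All.prems(3) that by (cases i) simp_all
  qed (use All.prems in simp_all)
  have body: "sat K e (tr k (All p)) \<longleftrightarrow> (\<forall>v. leK K v B \<longrightarrow> (\<forall>x. leK K x B \<longrightarrow> domK K B t v x \<longrightarrow>
      sat K (case_nat x (case_nat v e)) (tr (k + 2) p)))"
    using All.prems(1,2) by (simp add: sat_BAll sat_DomF eval_nat_numeral)
  show ?case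
  proof
    assume *: "sat K e (tr k (All p))"
    have "sat K (case_nat y f) p" for y
    proof -
      obtain v x where c: "codes K B t v x y" using codes_onto[of y] by (elim HOL.exE)
      show ?thesis using *[unfolded body, rule_format, of v x] codes_dom[OF c] IH[OF c] by simp
    qed
    then show "sat K f (All p)" by simp
  next
    assume *: "sat K f (All p)"
    show "sat K e (tr k (All p))"
      unfolding body
    proof (intro HOL.allI HOL.impI)
      fix v x assume "leK K v B" "leK K x B" "domK K B t v x"
      then have "\<exists>y. codes K B t v x y" by (rule codes_total)
      then obtain y where c: "codes K B t v x y" ..
      show "sat K (case_nat x (case_nat v e)) (tr (k + 2) p)" using * IH[OF c] by simp
    qed
  qed
next
  case (Ex p)
  have IH: "sat K (case_nat x (case_nat v e)) (tr (k + 2) p) \<longleftrightarrow> sat K (case_nat y f) p"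
    if "codes K B t v x y" for v x y
  proof (rule Ex.IH)
    show "codes K B t (case_nat x (case_nat v e) (2 * i + 1)) (case_nat x (case_nat v e) (2 * i)) (case_nat y f i)"
      if "i \<in> fv p" for i
      using \<open>codes K B t v x y\<close> Ex.prems(3) that by (cases i) simp_all
  qed (use Ex.prems in simp_all)
  have body: "sat K e (tr k (Ex p)) \<longleftrightarrow> (\<exists>v. leK K v B \<and> (\<exists>x. leK K x B \<and> domK K B t v x \<and>
      sat K (case_nat x (case_nat v e)) (tr (k + 2) p)))"
    using Ex.prems(1,2) by (simp add: sat_BEx sat_DomF eval_nat_numeral)
  show ?case
  proof
    assume "sat K e (tr k (Ex p))"
    then obtain v x where *: "leK K v B" "leK K x B" "domK K B t v x"
      "sat K (case_nat x (case_nat v e)) (tr (k + 2) p)" unfolding body by blast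
    obtain y where "codes K B t v x y" using codes_total[OF *(1-3)] by blast
    then show "sat K f (Ex p)" using IH *(4) by auto
  next
    assume "sat K f (Ex p)"
    then obtain y where y: "sat K (case_nat y f) p" by auto
    obtain v x where c: "codes K B t v x y" using codes_onto[of y] by (elim HOL.exE)
    show "sat K e (tr k (Ex p))" unfolding body using codes_dom[OF c]
      by (intro bex2I[of v x] HOL.conjI) (use IH[OF c] y in simp_all)
  qed
next
  case Fls
  show ?case by simp
next
  case (Imp p q)
  have "sat K e (tr k p) \<longleftrightarrow> sat K f p" "sat K e (tr k q) \<longleftrightarrow> sat K f q"
    by (rule Imp.IH; use Imp.prems in simp)+
  then show ?case by simp
next
  case (Conj p q)
  have "sat K e (tr k p) \<longleftrightarrow> sat K f p" "sat K e (tr k q) \<longleftrightarrow> sat K f q"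
    by (rule Conj.IH; use Conj.prems in simp)+
  then show ?case by simp
next
  case (Disj p q)
  have "sat K e (tr k p) \<longleftrightarrow> sat K f p" "sat K e (tr k q) \<longleftrightarrow> sat K f q"
    by (rule Disj.IH; use Disj.prems in simp)+
  then show ?case by simp
qed

end

section \<open>Closures, the single axiom and the Sigma_1 versions of sentences\<close>

lemma fv_funpow_All: "fv ((All ^^ k) p) = {n. n + k \<in> fv p}"
  by (induction k) auto

lemma fv_funpow_Ex: "fv ((Ex ^^ k) p) = {n. n + k \<in> fv p}"
  by (induction k) auto

lemma fv_bound: "fv p \<subseteq> {..<(LEAST k. fv p \<subseteq> {..<k})}"
proof (rule LeastI_ex)
  show "\<exists>k. fv p \<subseteq> {..<k}"
    using finite_fv[of p] unfolding finite_nat_set_iff_bounded by blast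
qed

lemma sentence_univ_closure: "sentence (univ_closure p)"
  using fv_bound[of p] by (fastforce simp: sentence_def univ_closure_def fv_funpow_All)

text \<open>Closing existentially makes \<open>bounded_version\<close> a sentence without a
  computation of the free variables of a translated formula, and it stays Sigma_1.\<close>

definition ex_closure :: "fm \<Rightarrow> fm" where
  "ex_closure p = (Ex ^^ (LEAST k. fv p \<subseteq> {..<k})) p"

lemma sentence_ex_closure: "sentence (ex_closure p)"
  using fv_bound[of p] by (fastforce simp: sentence_def ex_closure_def fv_funpow_Ex)

lemma sat_funpow_All: "fv p \<subseteq> {..<k} \<Longrightarrow> sat K e ((All ^^ k) p) \<Longrightarrow> sat K e' p"
proof (induction k arbitrary: p e')
  case 0
  then show ?case using sat_cong[of p e e' K] by auto
next
  case (Suc k)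
  have "sat K e ((All ^^ k) (All p))" using Suc.prems(2) by (simp only: funpow_Suc_right comp_def)
  moreover have "fv (All p) \<subseteq> {..<k}" using Suc.prems(1) by auto
  ultimately have "sat K (\<lambda>n. e' (Suc n)) (All p)" by (rule Suc.IH[rotated])
  then have "sat K (case_nat (e' 0) (\<lambda>n. e' (Suc n))) p" by simp
  moreover have "case_nat (e' 0) (\<lambda>n. e' (Suc n)) = e'" by (rule ext) (simp split: nat.split)
  ultimately show ?case by simp
qed

lemma sat_univ_closure: "sat K e (univ_closure p) \<longleftrightarrow> (\<forall>e'. sat K e' p)"
proof
  show "\<forall>e'. sat K e' p" if "sat K e (univ_closure p)"
    using that sat_funpow_All[OF fv_bound] unfolding univ_closure_def by blast
  have "sat K e ((All ^^ k) p)" if "\<forall>e'. sat K e' p" for k e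
    using that by (induction k arbitrary: e) simp_all
  then show "\<forall>e'. sat K e' p \<Longrightarrow> sat K e (univ_closure p)" by (simp add: univ_closure_def)
qed

lemma sat_ex_closureD: "sat K e (ex_closure p) \<Longrightarrow> \<exists>e'. sat K e' p"
proof -
  have "\<exists>e'. sat K e' p" if "sat K e ((Ex ^^ k) p)" for k e
    using that
  proof (induction k arbitrary: e)
    case (Suc k)
    then obtain x where "sat K (case_nat x e) ((Ex ^^ k) p)" by auto
    then show ?case by (rule Suc.IH)
  qed (simp, rule HOL.exI)
  then show "sat K e (ex_closure p) \<Longrightarrow> \<exists>e'. sat K e' p" by (simp add: ex_closure_def)
qed

lemma sat_ex_closureI: "(\<And>e'. sat K e' p) \<Longrightarrow> sat K e (ex_closure p)"
proof -
  assume *: "\<And>e'. sat K e' p"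
  have "sat K e ((Ex ^^ k) p)" for k e
    by (induction k arbitrary: e) (simp_all add: *)
  then show ?thesis by (simp add: ex_closure_def)
qed

lemma sigma1_ex_closure: "sigma1 p \<Longrightarrow> sigma1 (ex_closure p)"
proof -
  assume p: "sigma1 p"
  have "sigma1 ((Ex ^^ k) p)" for k
    by (induction k) (simp_all add: p sigma1.intros(2))
  then show ?thesis by (simp add: ex_closure_def)
qed

text \<open>A witness of \<open>bounded_version\<close> is known only to be good, since faithfulness
  is too complex to be required there. So the axiom has to assert that every good pair is faithful,
  besides the existence of a good pair.\<close>

definition copy_axiom :: fm where
  "copy_axiom = univ_closure (Ex (Ex (GoodF 1 (Var 0))) \<^bold>\<and> All (All (GoodF 1 (Var 0) \<^bold>\<longrightarrow> FaithfulF)))"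

lemma sat_copy_axiom: "sat K e copy_axiom \<longleftrightarrow> (\<exists>B t. goodK K B t) \<and> (\<forall>B t. goodK K B t \<longrightarrow> faithful K B t)"
  by (simp add: copy_axiom_def sat_univ_closure sat_GoodF sat_FaithfulF)

definition bounded_version :: "fm \<Rightarrow> fm" where
  "bounded_version p = ex_closure (Ex (Ex (GoodF 1 (Var 0) \<^bold>\<and> tr 0 p)))"

lemma sigma1_bounded_version: "sigma1 (bounded_version p)"
  unfolding bounded_version_def
  by (rule sigma1_ex_closure, rule sigma1.intros(2), rule sigma1.intros(2), rule sigma1.intros(1),
      intro delta0_intros delta0_GoodF delta0_tr)

lemma sat_bounded_version:
  assumes K: "eq_congruence K" and copy_axiom: "sat K e copy_axiom" and p: "sentence p"
  shows "sat K e (bounded_version p) \<longleftrightarrow> sat K e p"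
proof -
  have good_tr: "sat K (case_nat t (case_nat B e')) (tr 0 p) \<longleftrightarrow> sat K e p" if "goodK K B t" for B t e'
    using copy_axiom that p by (intro sat_tr[OF K]) (simp_all add: sat_copy_axiom sentence_def)
  have "sat K e' (Ex (Ex (GoodF 1 (Var 0) \<^bold>\<and> tr 0 p))) \<longleftrightarrow> sat K e p" for e'
    using copy_axiom good_tr[of _ _ e'] by (auto simp: sat_GoodF sat_copy_axiom)
  then show ?thesis unfolding bounded_version_def using sat_ex_closureD sat_ex_closureI by blast
qed

section \<open>Monomial divisors\<close>

abbreviation ev :: "real \<Rightarrow> pz \<Rightarrow> real" where
  "ev s x \<equiv> Rep_pz x s"

lemma ev_simps [simp]:
  "ev s 0 = 0" "ev s 1 = 1" "ev s (x + y) = ev s x + ev s y" "ev s (x * y) = ev s x * ev s y"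
  "ev s (- x) = - ev s x" "ev s (x - y) = ev s x - ev s y"
proof -
  show minus: "ev s (x - y) = ev s x - ev s y"
    unfolding minus_pz_def by (simp only: plus_pz.rep_eq uminus_pz.rep_eq)
qed (simp_all add: zero_pz.rep_eq one_pz.rep_eq plus_pz.rep_eq times_pz.rep_eq uminus_pz.rep_eq)

lemma pz_eqI: "(\<And>s. ev s x = ev s y) \<Longrightarrow> x = y"
  by (simp add: Rep_pz_inject[symmetric] fun_eq_iff)

lemma lev_iff: "lev k x p \<longleftrightarrow> k > 0 \<and> (\<forall>s. ev s x = poly p (exp (s / real k)))"
  by (auto simp: lev_def pval_def)

lemma lev_multiple: "\<exists>j>0. \<forall>n>0. \<exists>p. lev (n * j) x p"
proof -
  obtain k p where p: "lev k x p" using lev_exists by blast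
  then have "k > 0" by (simp add: lev_def)
  moreover have "\<exists>p. lev (n * k) x p" if "n > 0" for n
    using lev_raise[OF p that] by (auto simp: mult.commute)
  ultimately show ?thesis by blast
qed

lemma lev_monom_raise: "lev k x (monom c m) \<Longrightarrow> j > 0 \<Longrightarrow> lev (k * j) x (monom c (m * j))"
  by (simp add: lev_iff poly_monom field_simps flip: exp_of_nat_mult)

text \<open>Once the powers of X are split off both factors, the rest multiplies to a constant and
  hence is constant.\<close>

lemma monom_factor:
  fixes u q :: "'a::field poly"
  assumes eq: "u * q = monom c m" and c: "c \<noteq> 0"
  shows "\<exists>a i. u = monom a i \<and> a \<noteq> 0"
proof -
  have nz: "u * q \<noteq> 0" using eq c by simp
  then have u0: "u \<noteq> 0" and q0: "q \<noteq> 0" by auto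
  obtain u1 where u1: "u = [:- 0, 1:] ^ order 0 u * u1" "\<not> [:- 0, 1:] dvd u1" using order_decomp[OF u0] by blast
  obtain q1 where q1: "q = [:- 0, 1:] ^ order 0 q * q1" using order_decomp[OF q0] by blast
  have "order 0 u + order 0 q = order 0 (monom c m)" using order_mult[OF nz, of 0] eq by simp
  also have "\<dots> = m"
    using c order_power_n_n[of "0 :: 'a" m] by (simp add: order_smult monom_altdef)
  finally have m: "order 0 u + order 0 q = m" .
  have "[:0, 1:] ^ m * (u1 * q1) = u * q"
    by (subst u1(1), subst q1) (simp add: mult_ac m[symmetric] power_add)
  also have "\<dots> = [:0, 1:] ^ m * [:c:]" unfolding eq by (simp add: monom_altdef)
  finally have "u1 * q1 = [:c:]" by (rule mult_left_cancel[THEN iffD1, rotated]) simp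
  then have "u1 dvd [:c:]" by (metis dvd_triv_left)
  then have "degree u1 = 0" using c by (metis dvd_imp_degree_le degree_pCons_0 le_zero_eq pCons_eq_0_iff)
  then obtain a where a: "u1 = [:a:]" by (rule degree_eq_zeroE)
  then have "u = monom a (order 0 u)" using u1(1) by (simp add: monom_altdef)
  moreover have "a \<noteq> 0" using u1(2) a by auto
  ultimately show ?thesis by blast
qed

lemma dvd_monomial:
  assumes z: "lev K z (monom c n)" "c \<noteq> 0" and "u dvd z"
  shows "\<exists>j>0. \<exists>a i. lev (K * j) u (monom a i) \<and> a \<noteq> 0"
proof -
  obtain q where q: "z = u * q" using \<open>u dvd z\<close> by (rule dvdE)
  have K: "K > 0" using z by (simp add: lev_def)
  obtain ku where ku: "ku > 0" "\<forall>n>0. \<exists>p. lev (n * ku) u p" using lev_multiple by blast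
  obtain kq where kq: "kq > 0" "\<forall>n>0. \<exists>p. lev (n * kq) q p" using lev_multiple by blast
  obtain pu where pu: "lev (K * (ku * kq)) u pu"
    using ku(2)[rule_format, of "K * kq"] K kq(1) by (auto simp: mult_ac)
  obtain pq where pq: "lev (K * (ku * kq)) q pq"
    using kq(2)[rule_format, of "K * ku"] K ku(1) by (auto simp: mult_ac)
  have "ku * kq > 0" using ku kq by simp
  then have "pu * pq = monom c (n * (ku * kq))"
    using lev_unique[OF lev_times[OF pu pq]] lev_monom_raise[OF z(1)] by (simp flip: q)
  then obtain a i where "pu = monom a i" "a \<noteq> 0" using monom_factor z(2) by blast
  then show ?thesis using pu \<open>ku * kq > 0\<close> by blast
qed

lemma monom_add_monom:
  assumes "monom a i + monom b j = monom c l" "a \<noteq> 0" "b \<noteq> (0 :: real)"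
  shows "i = j"
proof (rule HOL.ccontr)
  assume "i \<noteq> j"
  have "coeff (monom a i + monom b j) i = a" "coeff (monom a i + monom b j) j = b"
    using \<open>i \<noteq> j\<close> by simp_all
  then show False unfolding assms(1) using assms(2,3) \<open>i \<noteq> j\<close> by (auto split: if_splits)
qed

lemma lead_coeff_monom: "lead_coeff (monom c n) = c"
  by (cases "c = 0") (simp_all add: degree_monom_eq)

lemma pcompose_monom_1: "pcompose (monom 1 i) q = (q :: 'a::comm_ring_1 poly) ^ i"
  by (induction i) (simp_all add: monom_Suc pcompose_pCons pcompose_1)

text \<open>The substitution of e^d t^(i/n) for t. Because \<open>i > 0\<close>, the substituted
  monomial vanishes at 0, so the constant term stays integral.\<close>

lemma sub_exists:
  assumes "i > 0" "n > 0"
  shows "\<exists>x. \<forall>s. ev s x = ev (real i / real n * s + d) y"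
proof -
  obtain k p where p: "lev k y p" using lev_exists by blast
  have k: "k > 0" using p by (simp add: lev_def)
  let ?p = "pcompose p (monom (exp (d / real k)) i)"
  have "coeff ?p 0 = coeff p 0"
  proof -
    have "poly (monom (exp (d / real k)) i) 0 = 0" using assms(1) by (simp add: poly_monom power_0_left)
    then show ?thesis unfolding poly_0_coeff_0[symmetric] poly_pcompose by simp
  qed
  then obtain x where x: "lev (k * n) x ?p" using ex_lev_iff[of "k * n" ?p] lev_coeff_0[OF p] k assms(2) by auto
  have "exp (d / real k) * exp (s / real (k * n)) ^ i = exp ((real i / real n * s + d) / real k)" for s
  proof -
    have "exp (d / real k) * exp (s / real (k * n)) ^ i = exp (d / real k + real i * (s / real (k * n)))"
      by (simp only: exp_add exp_of_nat_mult)
    also have "d / real k + real i * (s / real (k * n)) = (real i / real n * s + d) / real k"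
      by (simp add: add_divide_distrib ac_simps)
    finally show ?thesis .
  qed
  then have "ev s x = ev (real i / real n * s + d) y" for s
    using x p by (simp add: lev_iff poly_pcompose poly_monom)
  then show ?thesis by blast
qed

text \<open>An increasing affine change of \<open>s\<close> preserves behaviour at infinity, which
  is what the order consists of.\<close>

lemma sub_pos_iff:
  assumes sub: "\<And>s. ev s x = ev (a * s + d) y" and a: "a > 0"
  shows "0 < x \<longleftrightarrow> 0 < y"
proof -
  have pos: "0 < x" if sub: "\<And>s. ev s x = ev (a * s + d) y" and "0 < y" for x y
  proof -
    have "filterlim (\<lambda>s. d + a * s) at_top at_top"
      by (intro filterlim_tendsto_add_at_top[OF tendsto_const]
          filterlim_tendsto_pos_mult_at_top[OF tendsto_const a filterlim_ident])
    then have "filterlim (\<lambda>s. a * s + d) at_top at_top" by (simp only: add.commute)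
    moreover have "eventually (\<lambda>s. 0 < ev s y) at_top" using \<open>0 < y\<close> by (simp add: less_pz.rep_eq)
    ultimately have "eventually (\<lambda>s. 0 < ev (a * s + d) y) at_top" by (rule eventually_compose_filterlim[rotated])
    then show "0 < x" by (simp add: less_pz.rep_eq sub)
  qed
  have "x = 0 \<longleftrightarrow> y = 0"
  proof
    assume "x = 0"
    have "ev s y = 0" for s
    proof -
      have "ev s y = ev ((s - d) / a) x" using a by (simp add: sub)
      then show ?thesis by (simp add: \<open>x = 0\<close>)
    qed
    then show "y = 0" by (intro pz_eqI) simp
  next
    assume "y = 0"
    then show "x = 0" by (intro pz_eqI) (simp add: sub)
  qed
  moreover have "0 < y \<Longrightarrow> 0 < x" using sub by (rule pos)
  moreover have "0 < - y \<Longrightarrow> 0 < - x" by (rule pos[of "- x" "- y"]) (simp_all add: sub)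
  ultimately show ?thesis by (metis less_irrefl less_trans linorder_neqE_linordered_idom neg_0_less_iff_less)
qed

text \<open>The quotient by \<open>c\<close> is a monomial of positive exponent, whose constant term
  is 0, and its coefficient may be any real.\<close>

lemma odd_constant_dvd:
  assumes t: "lev k t (monom b m)" "b > 0" "m > 0" and c: "c \<noteq> 0" and u: "\<And>s. ev s u = c"
  shows "u dvd t"
proof -
  have "k > 0" using t by (simp add: lev_def)
  then obtain q where "lev k q (monom (b / c) m)" using ex_lev_iff[of k "monom (b / c) m"] t(3) by auto
  then have "t = u * q" using t c by (intro pz_eqI) (simp add: lev_iff poly_monom u)
  then show ?thesis by simp
qed

text \<open>Let X^i h present \<open>t\<close>, with X not dividing \<open>h\<close>. If
  \<open>h\<close> had positive degree, its multiple \<open>g\<close> with constant term 1 or -1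
  would have the form 2 d + 1 and divide \<open>t\<close>, the cofactor c X^i having constant term
  0. Then g + 2 would divide \<open>t\<close> too, although it is coprime to both X and g.\<close>

lemma odd_divisor_chain_monomial:
  assumes t: "0 < t" and good: "\<And>d. 0 \<le> d \<Longrightarrow> (2 * d + 1) dvd t \<Longrightarrow> (2 * d + 3) dvd t"
  shows "\<exists>k b m. lev k t (monom b m) \<and> b > 0 \<and> m > 0"
proof -
  obtain k p where p: "lev k t p" using lev_exists by blast
  have k: "k > 0" using p by (simp add: lev_def)
  have lp: "lead_coeff p > 0" using lev_pos_iff[OF p] t by simp
  have p0: "p \<noteq> 0" using lp by auto
  have odd: "(2 * of_nat n + 1) dvd t" for n
  proof (induction n)
    case (Suc n)
    have "(2 * of_nat n + 3) dvd t" using Suc by (intro good) simp_all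
    then show ?case by (simp add: algebra_simps)
  qed simp
  obtain z where z: "coeff p 0 = of_int z" using lev_coeff_0[OF p] by (auto elim: Ints_cases)
  have of_nat: "lev j (of_nat n) [:of_nat n:]" if "j > 0" for j n
  proof (induction n)
    case (Suc n)
    then show ?case using lev_plus[OF lev_one[OF that] Suc] by (simp add: one_pCons)
  qed (simp add: lev_zero that)
  \<comment> \<open>Divisibility by a standard integer passes to the integral constant
    terms.\<close>
  have zdvd: "int (2 * n + 1) dvd z" for n
  proof -
    obtain q where q: "t = (2 * of_nat n + 1) * q" using odd[of n] by (rule dvdE)
    obtain j where j: "j > 0" "\<forall>n>0. \<exists>p. lev (n * j) q p" using lev_multiple by blast
    obtain pq where pq: "lev (k * j) q pq" using j(2) k by blast
    have kj: "k * j > 0" using k j by simp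
    have "lev (k * j) (of_nat (2 * n + 1) * q) ([:of_nat (2 * n + 1):] * pq)" by (rule lev_times[OF of_nat[OF kj] pq])
    moreover have "of_nat (2 * n + 1) * q = t" unfolding q by simp
    ultimately have "lev (k * j) t ([:of_nat (2 * n + 1):] * pq)" by (simp only:)
    then have "pcompose p (monom 1 j) = [:of_nat (2 * n + 1):] * pq" by (rule lev_unique[OF lev_raise[OF p j(1)]])
    then have "coeff (pcompose p (monom 1 j)) 0 = of_nat (2 * n + 1) * coeff pq 0" by simp
    moreover obtain y where "coeff pq 0 = of_int y" using lev_coeff_0[OF pq] by (auto elim: Ints_cases)
    ultimately have "real_of_int z = of_int (int (2 * n + 1) * y)" using z coeff_0_pcompose_monom[OF j(1), of p] by simp
    then have "z = int (2 * n + 1) * y" by (simp only: of_int_eq_iff)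
    then show ?thesis by simp
  qed
  \<comment> \<open>The odd number 2 |z| + 1 is too large to divide a nonzero z.\<close>
  have "z = 0"
  proof (rule HOL.ccontr)
    assume "z \<noteq> 0"
    from dvd_imp_le_int[OF this zdvd[of "nat \<bar>z\<bar>"]] show False by simp
  qed
  then have c0: "coeff p 0 = 0" using z by simp
  obtain h where h: "p = [:- 0, 1:] ^ order 0 p * h" "\<not> [:- 0, 1:] dvd h" using order_decomp[OF p0] by blast
  define i where "i = order 0 p"
  have i: "i > 0" using c0 p0 by (simp add: i_def order_gt_0_iff poly_0_coeff_0)
  have ph: "p = monom 1 i * h" using h(1) by (simp add: i_def monom_altdef)
  have h0: "coeff h 0 \<noteq> 0" using h(2) poly_eq_0_iff_dvd[of h 0] by (simp add: poly_0_coeff_0)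
  have lh: "lead_coeff h = lead_coeff p" unfolding ph by (simp only: lead_coeff_mult lead_coeff_monom mult_1_left)
  have "degree h = 0"
  proof (rule HOL.ccontr)
    assume dh: "degree h \<noteq> 0"
    define c where "c = \<bar>coeff h 0\<bar>"
    have c: "c > 0" using h0 by (simp add: c_def)
    define g where "g = smult (1 / c) h"
    have g0: "coeff g 0 = 1 \<or> coeff g 0 = -1" using h0 by (auto simp: g_def c_def abs_if)
    have dg: "degree g = degree h" using c by (simp add: g_def)
    have lg: "lead_coeff g > 0" using lp lh c by (simp add: g_def)
    have hg: "h = smult c g" using c by (simp add: g_def)
    \<comment> \<open>The constant term of \<open>g\<close> is 1 or -1, so that of \<open>g2\<close>
      is 0 or -1 and \<open>g2\<close> presents an element.\<close>
    define g2 where "g2 = smult (1 / 2) (g - 1)"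
    have "coeff g2 0 \<in> \<int>" using g0 by (auto simp: g2_def)
    then obtain d where d: "lev k d g2" using ex_lev_iff[OF k] by blast
    have "degree (g - 1) = degree g" using degree_add_eq_left[of "-1" g] dg dh by simp
    then have "lead_coeff g2 = lead_coeff g / 2" using dg dh by (simp add: g2_def)
    then have "0 < d" using lg lev_pos_iff[OF d] by simp
    have one: "lev k 1 1" using k by (rule lev_one)
    have "g2 + g2 = smult (1 / 2 + 1 / 2) (g - 1)" unfolding g2_def by (simp only: smult_add_left)
    then have g2g: "g2 + g2 + 1 = g" by simp
    have D: "lev k (2 * d + 1) g"
      using lev_plus[OF lev_plus[OF d d] one] by (simp only: g2g mult_2)
    obtain q where q: "lev k q (monom c i)" using ex_lev_iff[OF k, of "monom c i"] i by auto
    have "monom c i = smult c (monom 1 i)" by (simp add: smult_monom)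
    then have "g * monom c i = p" unfolding ph hg by (simp only: mult_smult_left mult_smult_right mult.commute)
    then have "lev k ((2 * d + 1) * q) p" using lev_times[OF D q] by (simp only:)
    then have "t = (2 * d + 1) * q" using lev_eq_iff[OF p] by (simp only:)
    then have "(2 * d + 1) dvd t" by simp
    then have "(2 * d + 3) dvd t" using \<open>0 < d\<close> by (intro good) simp_all
    then obtain r where r: "t = (2 * d + 3) * r" by (rule dvdE)
    obtain j where j: "j > 0" "\<forall>n>0. \<exists>p. lev (n * j) r p" using lev_multiple by blast
    obtain pr where pr: "lev (k * j) r pr" using j(2) k by blast
    define g' where "g' = pcompose g (monom 1 j)"
    have g'0: "coeff g' 0 = coeff g 0" by (simp only: g'_def coeff_0_pcompose_monom[OF j(1)])
    have D': "lev (k * j) (2 * d + 1) g'" using lev_raise[OF D j(1)] by (simp add: g'_def)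
    have kj1: "lev (k * j) 1 1" using k j by (intro lev_one) simp
    have "lev (k * j) (2 * d + 1 + 1 + 1) (g' + 1 + 1)" by (rule lev_plus[OF lev_plus[OF D' kj1] kj1])
    moreover have "2 * d + 1 + 1 + 1 = 2 * d + 3" "g' + 1 + 1 = g' + 2" by simp_all
    ultimately have "lev (k * j) (2 * d + 3) (g' + 2)" by (simp only:)
    then have "lev (k * j) t ((g' + 2) * pr)" unfolding r using pr by (rule lev_times)
    then have "(g' + 2) * pr = pcompose p (monom 1 j)" using lev_raise[OF p j(1)] by (rule lev_unique)
    also have "\<dots> = smult c (monom 1 (i * j) * g')"
      unfolding ph hg g'_def pcompose_mult pcompose_smult pcompose_monom_1 monom_power
      by (simp only: mult_smult_right mult.commute power_one)
    finally have "(g' + 2) * pr = smult c ([:0, 1:] ^ (i * j) * g')"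
      by (simp only: monom_altdef smult_1_left)
    then have "(g' + 2) dvd smult c ([:0, 1:] ^ (i * j) * g')" using dvd_triv_left[of "g' + 2" pr] by simp
    then have dv: "(g' + 2) dvd [:0, 1:] ^ (i * j) * g'" using c by (simp add: dvd_smult_iff)
    \<comment> \<open>A common divisor divides the unit 2.\<close>
    have "coprime (g' + 2) g'"
    proof (rule coprimeI)
      fix e assume "e dvd g' + 2" "e dvd g'"
      then have "e dvd (g' + 2) - g'" by (rule dvd_diff)
      then have "e dvd [:2:]" by (simp add: numeral_poly)
      then show "is_unit e" by (rule dvd_unit_imp_unit) (rule is_unit_triv, simp)
    qed
    then have dv: "(g' + 2) dvd [:0, 1:] ^ (i * j)" using dv by (simp add: coprime_dvd_mult_left_iff)
    \<comment> \<open>The constant term of \<open>g' + 2\<close> is 3 or 1.\<close>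
    have "coprime [:0, 1:] (g' + 2)"
    proof (rule prime_elem_imp_coprime)
      show "prime_elem [:0, 1 :: real:]" by (rule prime_elem_linear_field_poly) simp
      have "poly (g' + 2) 0 \<noteq> 0" using g0 g'0 by (auto simp: poly_0_coeff_0 numeral_poly)
      then show "\<not> [:0, 1:] dvd g' + 2" using poly_eq_0_iff_dvd[of "g' + 2" 0] by simp
    qed
    then have "coprime (g' + 2) ([:0, 1:] ^ (i * j))" by (simp add: coprime_commute coprime_power_left_iff)
    then have "is_unit (g' + 2)" using dv by (metis coprime_common_divisor dvd_refl)
    then have "degree (g' + 2) = 0" by (auto simp: is_unit_poly_iff)
    moreover have "degree g' = degree g * j" by (simp add: g'_def degree_pcompose degree_monom_eq)
    moreover have "degree (g' + 2) = degree g'"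
      using \<open>degree g' = degree g * j\<close> dg dh j(1) by (intro degree_add_eq_left) simp
    ultimately show False using dg dh j(1) by simp
  qed
  then obtain c where "h = [:c:]" by (rule degree_eq_zeroE)
  then have "p = monom c i" by (simp add: ph monom_altdef)
  then show ?thesis using p i lp lead_coeff_monom by metis
qed

section \<open>The model\<close>

typedef pm = "{x :: pz. 0 \<le> x}"
  by (rule HOL.exI[of _ 0]) simp

definition PM :: "pm str" where
  "PM = \<lparr>sZero = Abs_pm 0, sOne = Abs_pm 1,
     sAdd = (\<lambda>x y. Abs_pm (Rep_pm x + Rep_pm y)), sMul = (\<lambda>x y. Abs_pm (Rep_pm x * Rep_pm y)),
     sLess = (\<lambda>x y. Rep_pm x < Rep_pm y), sEq = (=)\<rparr>"

abbreviation R :: "pm \<Rightarrow> pz" where "R \<equiv> Rep_pm"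

lemma R_nonneg [simp]: "0 \<le> R x"
  using Rep_pm[of x] by simp

lemma R_Abs [simp]: "0 \<le> x \<Longrightarrow> R (Abs_pm x) = x"
  by (simp add: Abs_pm_inverse)

lemma PM_simps [simp]:
  "R (sZero PM) = 0" "R (sOne PM) = 1" "R (sAdd PM x y) = R x + R y" "R (sMul PM x y) = R x * R y"
  "sLess PM x y \<longleftrightarrow> R x < R y" "sEq PM x y \<longleftrightarrow> R x = R y"
  by (simp_all add: PM_def Rep_pm_inject)

lemma leK_PM [simp]: "leK PM x y \<longleftrightarrow> R x \<le> R y"
  by (auto simp: leK_def)

lemma eq_congruence_PM: "eq_congruence PM"
  by (simp add: eq_congruence_def)

lemma dvd_ex: "x dvd y \<Longrightarrow> \<exists>q. x * q = y"
  by (auto simp: dvd_def)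

lemma lev_pos_monom: "lev k x (monom c n) \<Longrightarrow> 0 < x \<longleftrightarrow> 0 < c"
  using lev_pos_iff[of k x "monom c n"] by (simp only: lead_coeff_monom)

text \<open>A positive element is at least 1, so a quotient never exceeds the dividend. This is why
  bounded divisibility agrees with divisibility.\<close>

lemma factor_le:
  assumes "x * q = (y :: pz)" "0 \<le> x" "0 \<le> y" "x \<noteq> 0"
  shows "0 \<le> q" "q \<le> y"
proof -
  have x: "1 \<le> x" using assms(2,4) pz_discrete[of x] by simp
  show q: "0 \<le> q"
  proof (rule HOL.ccontr)
    assume "\<not> 0 \<le> q"
    then have "x * q < 0" using x by (intro mult_pos_neg) auto
    then show False using assms(1,3) by simp
  qed
  show "q \<le> y" using mult_right_mono[OF x q] assms(1) by simp
qed

lemma dvdK_PM: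
  assumes "R y \<le> R B"
  shows "dvdK PM B x y \<longleftrightarrow> R x dvd R y"
proof
  assume "dvdK PM B x y"
  then obtain q where "R x * R q = R y" by (auto simp: dvdK_def)
  then show "R x dvd R y" by (metis dvd_triv_left)
next
  assume "R x dvd R y"
  then obtain q where q: "R x * q = R y" using dvd_ex by blast
  have "\<exists>q. 0 \<le> q \<and> q \<le> R B \<and> R x * q = R y"
  proof (cases "R x = 0")
    \<comment> \<open>If \<open>x\<close> is 0, the given quotient is arbitrary and may be negative
      or exceed \<open>B\<close>; so 0 is taken instead.\<close>
    case True
    then show ?thesis using q by (intro HOL.exI[of _ 0]) simp
  next
    case False
    then show ?thesis using factor_le[OF q] q assms order_trans by (intro HOL.exI[of _ q]) auto
  qed
  then obtain q where "0 \<le> q" "q \<le> R B" "R x * q = R y" by blast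
  then show "dvdK PM B x y" unfolding dvdK_def by (intro HOL.exI[of _ "Abs_pm q"]) simp
qed

lemma congK_PM_D:
  assumes "congK PM B a c x y"
  shows "\<exists>q. (R a - R c) * q = R x - R y"
proof -
  obtain q where "R x + R c * R q = R y + R a * R q \<or> R x + R a * R q = R y + R c * R q"
    using assms by (auto simp: congK_def)
  then have "(R a - R c) * R q = R x - R y \<or> (R a - R c) * (- R q) = R x - R y"
    by (auto simp: algebra_simps)
  then show ?thesis by blast
qed

text \<open>The quotient may be negative, but its absolute value lies in the model. It is at most
  \<open>B\<close> because the modulus is nonzero and both sides lie between 0 and
  \<open>B\<close>.\<close>

lemma congK_PM_I:
  assumes q: "(R a - R c) * q = R x - R y" and ne: "R a \<noteq> R c" and B: "R x \<le> R B" "R y \<le> R B"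
  shows "congK PM B a c x y"
proof -
  have "\<bar>R a - R c\<bar> * \<bar>q\<bar> = \<bar>R x - R y\<bar>" using q by (simp flip: abs_mult)
  then have "\<bar>q\<bar> \<le> \<bar>R x - R y\<bar>" by (rule factor_le(2)) (use ne in simp_all)
  also have "\<dots> \<le> R B" using B R_nonneg[of x] R_nonneg[of y] by (simp add: abs_le_iff) (meson add_increasing2 diff_le_eq order_trans R_nonneg)
  finally have qB: "\<bar>q\<bar> \<le> R B" .
  have "R x + R c * \<bar>q\<bar> = R y + R a * \<bar>q\<bar> \<or> R x + R a * \<bar>q\<bar> = R y + R c * \<bar>q\<bar>"
    using q by (cases "q < 0") (simp_all add: algebra_simps)
  then show ?thesis using qB unfolding congK_def by (intro HOL.exI[of _ "Abs_pm \<bar>q\<bar>"]) simp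
qed

text \<open>\<open>ev s v\<close> runs through all positive reals, so this says that the elements coded by \<open>(v, x)\<close> and
  \<open>(v', x')\<close> are the same function of \<open>t\<close>.\<close>
definition eqR :: "pz \<Rightarrow> pz \<Rightarrow> pz \<Rightarrow> pz \<Rightarrow> bool" where
  "eqR v x v' x' \<longleftrightarrow> (\<forall>s s'. ev s v = ev s' v' \<longrightarrow> ev s x = ev s' x')"

definition mon :: "pz \<Rightarrow> pz \<Rightarrow> bool" where
  "mon t u \<longleftrightarrow> 0 < u \<and> u dvd t \<and> \<not> (u + 1) dvd t"

definition con :: "pz \<Rightarrow> real \<Rightarrow> pz \<Rightarrow> bool" where
  "con t c r \<longleftrightarrow> c > 0 \<and> (\<forall>s. ev s r = c * ev s t)"

context
  fixes t :: pz and k m :: nat and b :: real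
  assumes t: "lev k t (monom b m)" and b: "b > 0" and m: "m > 0"
begin

lemma k0: "k > 0"
  using t by (simp add: lev_def)

lemma ev_t: "ev s t = b * exp (real m * (s / real k))"
  using t unfolding lev_iff poly_monom by (simp only: exp_of_nat_mult)

lemma ev_t_pos: "ev s t > 0"
  using b by (simp add: ev_t)

lemma ev_t_inj: "ev s t = ev s' t \<Longrightarrow> s = s'"
  using b m k0 by (simp add: ev_t)

lemma ev_t_surj: "c > 0 \<Longrightarrow> \<exists>s. ev s t = c"
proof -
  assume c: "c > 0"
  have "ev (real k / real m * ln (c / b)) t = c" using b m k0 c by (simp add: ev_t)
  then show ?thesis ..
qed

lemma t_gt: "of_nat n < t"
proof -
  have "lev k (of_nat n) [:of_nat n:]"
  proof (induction n)
    case (Suc n)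
    then show ?case using lev_plus[OF lev_one[OF k0] Suc] by (simp add: one_pCons)
  qed (simp add: lev_zero k0)
  from lev_minus[OF t this] have l: "lev k (t - of_nat n) (monom b m - [:of_nat n:])" .
  have eq: "monom b m - [:of_nat n:] = monom b m + [:- of_nat n:]" by simp
  have "degree (monom b m + [:- of_nat n:]) = degree (monom b m)"
    by (rule degree_add_eq_left) (use b m in \<open>simp add: degree_monom_eq\<close>)
  then have "lead_coeff (monom b m - [:of_nat n:]) = b"
    unfolding eq using b m by (simp add: degree_monom_eq coeff_pCons split: nat.split)
  then have "0 < t - of_nat n" using lev_pos_iff[OF l] b by simp
  then show ?thesis by simp
qed

lemma t_ge: "2 \<le> t" "0 < t" "1 \<le> t"
  using t_gt[of 2] t_gt[of 0] t_gt[of 1] by simp_all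

lemma t_lev: "j > 0 \<Longrightarrow> lev (k * j) t (monom b (m * j))"
  using lev_monom_raise[OF t] .

lemma dvd_t: "u dvd t \<Longrightarrow> \<exists>j a i. j > 0 \<and> lev (k * j) u (monom a i) \<and> a \<noteq> 0"
  using dvd_monomial[OF t, of u] b by auto

lemma dvd_tt: "u dvd t * t \<Longrightarrow> \<exists>j a i. j > 0 \<and> lev (k * j) u (monom a i) \<and> a \<noteq> 0"
proof -
  have tt: "lev k (t * t) (monom (b * b) (m + m))" using lev_times[OF t t] by (simp add: mult_monom)
  show "u dvd t * t \<Longrightarrow> ?thesis" using dvd_monomial[OF tt, of u] b by auto
qed

lemma con_exists: "c > 0 \<Longrightarrow> \<exists>r. con t c r \<and> 0 \<le> r"
proof -
  assume c: "c > 0"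
  obtain r where r: "lev k r (monom (c * b) m)" using ex_lev_iff[OF k0, of "monom (c * b) m"] m by auto
  have "0 < r" using lev_pos_monom[OF r] c b by simp
  moreover have "con t c r" using c r t by (simp add: con_def lev_iff poly_monom)
  ultimately show ?thesis by (meson less_imp_le)
qed

lemma con_iff:
  assumes "0 \<le> r"
  shows "r dvd t * t \<and> (r + t) dvd t * t \<longleftrightarrow> (\<exists>c. con t c r)"
proof
  assume d: "r dvd t * t \<and> (r + t) dvd t * t"
  obtain j a i where r: "j > 0" "lev (k * j) r (monom a i)" "a \<noteq> 0"
    using dvd_tt[of r] d by blast
  obtain j' a' i' where rt: "j' > 0" "lev (k * j') (r + t) (monom a' i')"
    using dvd_tt[of "r + t"] d by blast
  have "lev (k * j * j') (r + t) (monom a (i * j') + monom b (m * j * j'))"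
    using lev_plus[OF lev_monom_raise[OF r(2) rt(1)] lev_monom_raise[OF t_lev[OF r(1)] rt(1)]] .
  moreover have "lev (k * j * j') (r + t) (monom a' (i' * j))"
    using lev_monom_raise[OF rt(2) r(1)] by (simp only: mult.assoc mult.commute[of j' j])
  ultimately have "monom a (i * j') + monom b (m * j * j') = monom a' (i' * j)" by (rule lev_unique)
  then have "i * j' = m * j * j'" using monom_add_monom r(3) b by blast
  then have i: "i = m * j" using rt(1) by simp
  have "r \<noteq> 0" using d t_ge by auto
  then have "0 < r" using assms by simp
  then have "a > 0" using lev_pos_monom[OF r(2)] by simp
  moreover have "ev s r = a / b * ev s t" for s
    using r(2) t_lev[OF r(1)] b by (simp add: lev_iff poly_monom i)
  ultimately have "con t (a / b) r" using b by (simp add: con_def)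
  then show "\<exists>c. con t c r" ..
next
  assume "\<exists>c. con t c r"
  then obtain c where c: "c > 0" and r: "\<And>s. ev s r = c * ev s t" by (auto simp: con_def)
  have dv: "u dvd t * t" if c: "c > 0" and u: "\<And>s. ev s u = c * ev s t" for c u
  proof -
    obtain q where q: "con t (1 / c) q" using con_exists[of "1 / c"] c by auto
    have "t * t = u * q" by (rule pz_eqI) (use q c u in \<open>simp add: con_def\<close>)
    then show ?thesis by simp
  qed
  show "r dvd t * t \<and> (r + t) dvd t * t"
    using dv[OF c r] dv[of "c + 1" "r + t"] c by (simp add: r algebra_simps)
qed

lemma con_le:
  assumes "con t c r" "0 \<le> r"
  shows "r \<le> t * t"
proof -
  have "r dvd t * t" using con_iff[OF assms(2)] assms(1) by blast
  then obtain q where "r * q = t * t" using dvd_ex by blast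
  then have q: "q * r = t * t" by (simp add: mult.commute)
  have tt: "0 < t * t" using t_ge by simp
  have "r \<noteq> 0" "q \<noteq> 0" using q tt by auto
  have "0 \<le> q" by (rule factor_le(1)[of r q "t * t"]) (use q \<open>r \<noteq> 0\<close> assms tt in \<open>auto simp: mult.commute\<close>)
  then show ?thesis using factor_le(2)[OF q] \<open>q \<noteq> 0\<close> tt by simp
qed

text \<open>The exponent lies strictly between 0 and that of \<open>t\<close>: the quotient by
  \<open>u\<close> is then a monomial with constant term 0, so it exists, and \<open>u + 1\<close>
  is a sum of monomials of different exponents, so it does not divide \<open>t\<close>.\<close>

lemma monI:
  assumes u: "lev (k * j) u (monom a i)" and "j > 0" "a > 0" "i > 0" "i < m * j"
  shows "mon t u"
proof -
  have kj: "k * j > 0" using k0 assms(2) by simp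
  have "coeff (monom (b / a) (m * j - i)) 0 = 0" using assms(5) by simp
  then obtain q where q: "lev (k * j) q (monom (b / a) (m * j - i))"
    using ex_lev_iff[OF kj, of "monom (b / a) (m * j - i)"] by auto
  have "lev (k * j) (u * q) (monom b (m * j))"
    using lev_times[OF u q] assms by (simp add: mult_monom)
  then have "t = u * q" using lev_eq_iff[OF t_lev[OF assms(2)]] by blast
  moreover have "\<not> (u + 1) dvd t"
  proof
    assume "(u + 1) dvd t"
    then obtain j' a' i' where *: "j' > 0" "lev (k * j') (u + 1) (monom a' i')"
      using dvd_t by blast
    have one: "lev (k * j * j') 1 (monom 1 0)" using lev_one[of "k * j * j'"] kj *(1) by (simp add: monom_0 one_pCons)
    have "lev (k * j * j') (u + 1) (monom a (i * j') + monom 1 0)"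
      by (rule lev_plus[OF lev_monom_raise[OF u *(1)] one])
    moreover have "lev (k * j * j') (u + 1) (monom a' (i' * j))"
      using lev_monom_raise[OF *(2) assms(2)] by (simp only: mult.assoc mult.commute[of j' j])
    ultimately have "monom a (i * j') + monom 1 0 = monom a' (i' * j)" by (rule lev_unique)
    then have "i * j' = 0" using monom_add_monom[of a "i * j'" 1 0] assms(3) by auto
    then show False using assms(4) *(1) by simp
  qed
  moreover have "0 < u" using lev_pos_monom[OF u] assms(3) by simp
  ultimately show ?thesis by (simp add: mon_def)
qed

text \<open>In the variable \<open>s\<close> the exponent of \<open>u\<close> becomes a slope and
  its coefficient a translation. Constants are excluded because \<open>u + 1\<close> would then
  divide \<open>t\<close>.\<close>

lemma mon_affine:
  assumes "mon t u"
  shows "\<exists>i n d. i > 0 \<and> n > 0 \<and> (\<forall>s. ev s u = ev (real i / real n * s + d) t)"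
proof -
  obtain j a i where u: "j > 0" "lev (k * j) u (monom a i)" "a \<noteq> 0"
    using dvd_t assms unfolding mon_def by blast
  have a: "a > 0" using lev_pos_monom[OF u(2)] assms by (simp add: mon_def)
  have i: "i > 0"
  proof (rule HOL.ccontr)
    assume "\<not> i > 0"
    then have "ev s u = a" for s using u(2) by (simp add: lev_iff poly_monom)
    then have "(u + 1) dvd t" using a by (intro odd_constant_dvd[OF t b m, of "a + 1"]) simp_all
    then show False using assms by (simp add: mon_def)
  qed
  \<comment> \<open>Chosen so that the translation by \<open>d\<close> multiplies \<open>t\<close>
    by \<open>a / b\<close>.\<close>
  define d where "d = real k / real m * ln (a / b)"
  have "ev s u = ev (real i / real (m * j) * s + d) t" for s
  proof -
    have "ev s u = a * exp (real i * (s / real (k * j)))"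
      using u(2) unfolding lev_iff poly_monom by (simp only: exp_of_nat_mult)
    moreover have "real m * ((real i / real (m * j) * s + d) / real k) = real i * (s / real (k * j)) + ln (a / b)"
    proof -
      have 1: "real m * (real i / real (m * j)) = real i / real j" using m by simp
      have 2: "real m * d / real k = ln (a / b)" using m k0 by (simp add: d_def)
      have gen: "M * ((A * s + d) / K) = M * A * s / K + M * d / K" for M A K :: real
        by (simp add: add_divide_distrib distrib_left mult.assoc)
      have "real m * ((real i / real (m * j) * s + d) / real k) =
          real m * (real i / real (m * j)) * s / real k + real m * d / real k"
        by (rule gen)
      also have "\<dots> = real i / real j * s / real k + ln (a / b)" unfolding 1 2 ..
      also have "real i / real j * s / real k = real i * (s / real (k * j))" by (simp add: mult.commute)
      finally show ?thesis .
    qed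
    ultimately show ?thesis using a b by (simp add: ev_t exp_add)
  qed
  then show ?thesis using i m u(1) by (intro HOL.exI[of _ i] HOL.exI[of _ "m * j"] HOL.exI[of _ d]) simp
qed

lemma mon_inj: "mon t u \<Longrightarrow> ev s u = ev s' u \<Longrightarrow> s = s'"
  using mon_affine[of u] ev_t_inj by fastforce

lemma mon_pos: "mon t u \<Longrightarrow> ev s u > 0"
  using mon_affine[of u] ev_t_pos by fastforce

lemma mon_surj: "mon t u \<Longrightarrow> c > 0 \<Longrightarrow> \<exists>s. ev s u = c"
proof -
  assume u: "mon t u" and c: "c > 0"
  obtain i n d where a: "i > 0" "n > 0" "\<forall>s. ev s u = ev (real i / real n * s + d) t"
    using mon_affine[OF u] by blast
  obtain s where s: "ev s t = c" using ev_t_surj[OF c] by blast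
  have "ev ((s - d) / (real i / real n)) u = c" using a s by simp
  then show ?thesis ..
qed

text \<open>The exponent of \<open>t\<close> itself is outside the range of \<open>monI\<close>;
  here \<open>t + 1\<close> fails to divide \<open>t\<close> by its size.\<close>

lemma mon_t: "mon t t"
proof -
  have "\<not> (t + 1) dvd t"
  proof
    assume "(t + 1) dvd t"
    then obtain q where "(t + 1) * q = t" using dvd_ex by blast
    then have q: "q * (t + 1) = t" by (simp add: mult.commute)
    have "q \<noteq> 0" using q t_ge by auto
    have "0 \<le> q" by (rule factor_le(1)[of "t + 1" q t]) (use q t_ge in \<open>auto simp: mult.commute\<close>)
    then have "t + 1 \<le> t" using factor_le(2)[OF q] t_ge \<open>q \<noteq> 0\<close> by simp
    then show False by simp
  qed
  then show ?thesis using t_ge by (simp add: mon_def)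
qed

lemma mon_le: "mon t u \<Longrightarrow> u \<le> t"
proof -
  assume u: "mon t u"
  then obtain q where q: "u * q = t" unfolding mon_def using dvd_ex by blast
  then have "0 \<le> q" using factor_le(1)[OF q] u t_ge by (auto simp: mon_def)
  moreover have "q \<noteq> 0" using q t_ge by auto
  moreover have "q * u = t" using q by (simp add: mult.commute)
  ultimately show "u \<le> t" using factor_le(2)[of q u t] t_ge by simp
qed

end

section \<open>The bounded copy in the model\<close>

context
  fixes T :: pm and k m :: nat and b :: real
  assumes t: "lev k (R T) (monom b m)" and b: "b > 0" and m: "m > 0"
begin

abbreviation "tt \<equiv> R T"

definition "big B \<longleftrightarrow> tt * tt * tt * tt * tt < R B"

lemmas T_facts = con_iff[OF t b m] con_le[OF t b m] con_exists[OF t b m] monI[OF t b m]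
  mon_affine[OF t b m] mon_inj[OF t b m] mon_pos[OF t b m] mon_surj[OF t b m] mon_t[OF t b m]
  mon_le[OF t b m] t_ge[OF t b m] ev_t_pos[OF t b m] ev_t_inj[OF t b m] ev_t_surj[OF t b m] k0[OF t b m]

text \<open>With codes at most \<open>t\<close> and constants at most \<open>t * t\<close>, the
  terms compared in \<open>zeroK\<close> stay below 2 t^3, which these bounds cover.\<close>

lemma big_bounds:
  assumes "big B"
  shows "tt \<le> R B" "tt * tt \<le> R B" "tt * (tt * tt + tt * tt) \<le> R B" "tt * (tt * tt) \<le> R B"
proof -
  have ge: "2 \<le> tt" "1 \<le> tt" using T_facts(11,13) by auto
  have step: "x \<le> x * tt" if "0 \<le> x" for x
    using mult_left_mono[OF ge(2) that] by simp
  have nn: "0 \<le> tt * tt" "0 \<le> tt * tt * tt" "0 \<le> tt * tt * tt * tt" by simp_all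
  have c: "tt \<le> tt * tt" "tt * tt \<le> tt * tt * tt" "tt * tt * tt \<le> tt * tt * tt * tt"
    "tt * tt * tt * tt \<le> tt * tt * tt * tt * tt"
    using step[of tt] step[OF nn(1)] step[OF nn(2)] step[OF nn(3)] by simp_all
  have d: "tt * tt * tt * 2 \<le> tt * tt * tt * tt" by (rule mult_left_mono[OF ge(1) nn(2)])
  have B: "tt * tt * tt * tt * tt \<le> R B" using assms by (simp add: big_def)
  show "tt \<le> R B" using c B by (meson order_trans)
  show "tt * tt \<le> R B" using c B by (meson order_trans)
  have "tt * tt * tt \<le> R B" using c B by (meson order_trans)
  then show "tt * (tt * tt) \<le> R B" by (simp only: mult.assoc)
  have "tt * tt * tt * 2 \<le> R B" using c d B by (meson order_trans)
  moreover have "tt * (tt * tt + tt * tt) = tt * tt * tt * 2" by (simp add: algebra_simps)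
  ultimately show "tt * (tt * tt + tt * tt) \<le> R B" by (simp only:)
qed

lemma monK_PM: "big B \<Longrightarrow> monK PM B T u \<longleftrightarrow> mon tt (R u)"
proof -
  assume B: "big B"
  have "R u dvd tt \<Longrightarrow> 0 < R u" using T_facts(12) R_nonneg[of u] by (cases "R u = 0") (simp_all add: less_le)
  then show ?thesis using dvdK_PM[OF big_bounds(1)[OF B]] by (auto simp: monK_def mon_def)
qed

lemma conK_PM: "big B \<Longrightarrow> conK PM B T r \<longleftrightarrow> (\<exists>c. con tt c (R r))"
proof -
  assume B: "big B"
  have "R (sMul PM T T) \<le> R B" using big_bounds(2)[OF B] by simp
  from dvdK_PM[OF this] show ?thesis
    unfolding conK_def by (simp add: T_facts(1))
qed

text \<open>At the point where \<open>w\<close> takes the value \<open>c\<close>, the modulus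
  \<open>t * w - s0\<close> vanishes, hence so do both differences. Division by the square of the
  positive value of \<open>t\<close> leaves the claimed values of \<open>v\<close> and
  \<open>x\<close>.\<close>

lemma zeroK_D:
  assumes B: "big B" and z: "zeroK PM B T x z y v r"
    and con: "con tt cz (R z)" "con tt cy (R y)" "con tt g (R r)"
  shows "\<exists>s. ev s (R v) = g \<and> ev s (R x) = cy - cz"
proof -
  obtain w s0 where w: "monK PM B T w" "conK PM B T s0"
    "congK PM B (sMul PM T w) s0 (sMul PM T (sAdd PM (sMul PM T x) z)) (sMul PM T y)"
    "congK PM B (sMul PM T w) s0 (sMul PM T (sMul PM T v)) (sMul PM T r)"
    using z unfolding zeroK_def by blast
  obtain c where c: "con tt c (R s0)" using w(2) conK_PM[OF B] by blast
  obtain q1 where q1: "(tt * R w - R s0) * q1 = tt * (tt * R x + R z) - tt * R y"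
    using congK_PM_D[OF w(3)] by auto
  obtain q2 where q2: "(tt * R w - R s0) * q2 = tt * (tt * R v) - tt * R r"
    using congK_PM_D[OF w(4)] by auto
  have "mon tt (R w)" using w(1) monK_PM[OF B] by blast
  moreover have "c > 0" using c by (simp add: con_def)
  ultimately obtain s where s: "ev s (R w) = c" using T_facts(8) by blast
  have t0: "ev s tt \<noteq> 0" using T_facts(14)[of s] by simp
  have e: "ev s (R s0) = c * ev s tt" "ev s (R z) = cz * ev s tt" "ev s (R y) = cy * ev s tt" "ev s (R r) = g * ev s tt"
    using c con by (simp_all add: con_def)
  have 0: "ev s (tt * R w - R s0) = 0" by (simp add: s e)
  have "ev s (tt * (tt * R x + R z) - tt * R y) = 0" "ev s (tt * (tt * R v) - tt * R r) = 0"
    unfolding q1[symmetric] q2[symmetric] using 0 by (simp_all only: ev_simps(4) mult_zero_left)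
  then have "ev s tt * ev s tt * (ev s (R x) + cz - cy) = 0" "ev s tt * ev s tt * (ev s (R v) - g) = 0"
    by (simp_all add: e algebra_simps)
  then show ?thesis using t0 by (intro HOL.exI[of _ s]) simp
qed

text \<open>Over the reals the linear polynomial with zero \<open>c\<close> divides p - p(c), but
  the constant term of the quotient need not be integral. The extra factor \<open>t\<close> makes it
  0; this is the reason for the outer factors \<open>t\<close> in \<open>ZeroF\<close>.\<close>

lemma root_quotient:
  assumes f: "lev K f p" and w: "lev K w (monom 1 1)" and tK: "lev K tt (monom b n)" and n: "n > 0"
  shows "\<exists>q. \<forall>u. ev u tt * (ev u w - ev s w) * ev u q = ev u tt * ev u tt * (ev u f - ev s f)"
proof -
  have K: "K > 0" using f by (simp add: lev_def)
  define c where "c = exp (s / real K)"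
  have "poly (p - [:ev s f:]) c = 0" using f by (simp add: c_def lev_iff)
  then obtain h where h: "p - [:ev s f:] = [:- c, 1:] * h" unfolding poly_eq_0_iff_dvd by (rule dvdE)
  have "coeff (monom b n * h) 0 = 0" using n by (simp add: coeff_mult_0)
  then obtain q where q: "lev K q (monom b n * h)" using ex_lev_iff[OF K, of "monom b n * h"] by auto
  have "ev u tt * (ev u w - ev s w) * ev u q = ev u tt * ev u tt * (ev u f - ev s f)" for u
  proof -
    define y where "y = exp (u / real K)"
    have e: "ev u w = y" "ev s w = c" "ev u f = poly p y" "ev u tt = b * y ^ n" "ev u q = b * y ^ n * poly h y"
      using w f tK q by (simp_all add: lev_iff poly_monom y_def c_def)
    have "poly p y - ev s f = (y - c) * poly h y" using arg_cong[OF h, of "\<lambda>p. poly p y"] by (simp add: algebra_simps)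
    then show ?thesis by (simp add: e)
  qed
  then show ?thesis by blast
qed

text \<open>The witness \<open>w\<close> is the root t^(1/K) of the indeterminate at a level where
  both \<open>x\<close> and \<open>v\<close> are polynomials in it, and \<open>root_quotient\<close>
  supplies the two quotients.\<close>

lemma zeroK_I:
  assumes B: "big B" and con: "con tt cz (R z)" "con tt cy (R y)" "con tt g (R r)"
    and s: "ev s (R v) = g" "ev s (R x) = cy - cz"
    and le: "tt * (tt * R x + R z) \<le> R B" "tt * R y \<le> R B" "tt * (tt * R v) \<le> R B" "tt * R r \<le> R B"
  shows "zeroK PM B T x z y v r"
proof -
  obtain jx where jx: "jx > 0" "\<forall>n>0. \<exists>p. lev (n * jx) (R x) p" using lev_multiple by blast
  obtain jv where jv: "jv > 0" "\<forall>n>0. \<exists>p. lev (n * jv) (R v) p" using lev_multiple by blast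
  \<comment> \<open>A common multiple of the levels of \<open>x\<close> and \<open>v\<close>; the
    factor 2 keeps the exponent of \<open>w\<close> strictly below that of \<open>t\<close>, as
    \<open>monI\<close> requires.\<close>
  define j where "j = jx * jv * 2"
  have j: "j > 0" "j \<ge> 2" using jx jv by (auto simp: j_def)
  define K where "K = k * j"
  have K: "K > 0" using j T_facts(17) by (simp add: K_def)
  obtain px where px: "lev K (R x) px"
    using jx(2)[rule_format, of "k * jv * 2"] jv(1) T_facts(17) by (auto simp: K_def j_def mult_ac)
  obtain pv where pv: "lev K (R v) pv"
    using jv(2)[rule_format, of "k * jx * 2"] jx(1) T_facts(17) by (auto simp: K_def j_def mult_ac)
  have tK: "lev K tt (monom b (m * j))" unfolding K_def by (rule lev_monom_raise[OF t j(1)])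
  have mj: "m * j > 0" using m j by simp
  obtain w where w: "lev K w (monom 1 1)" using ex_lev_iff[OF K, of "monom 1 1"] by auto
  have "1 < m * j" using m j(2) by (metis One_nat_def Suc_le_lessD mult_le_mono nat_mult_1 numeral_2_eq_2 less_le_trans lessI Suc_leI)
  then have mon: "mon tt w" using T_facts(4)[of j w 1 1] w j(1) by (simp add: K_def)
  \<comment> \<open>Puts the zero of the modulus at the given point \<open>s\<close>.\<close>
  define c where "c = ev s w"
  have c: "c > 0" unfolding c_def by (rule T_facts(7)[OF mon])
  obtain s0 where s0: "con tt c s0" "0 \<le> s0" using T_facts(3)[OF c] by blast
  have es: "ev u s0 = c * ev u tt" for u using s0(1) by (simp add: con_def)
  have ee: "ev u (R z) = cz * ev u tt" "ev u (R y) = cy * ev u tt" "ev u (R r) = g * ev u tt" for u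
    using con by (simp_all add: con_def)
  obtain q1 where q1: "\<forall>u. ev u tt * (ev u w - ev s w) * ev u q1 = ev u tt * ev u tt * (ev u (R x) - ev s (R x))"
    using root_quotient[OF px w tK mj] by blast
  obtain q2 where q2: "\<forall>u. ev u tt * (ev u w - ev s w) * ev u q2 = ev u tt * ev u tt * (ev u (R v) - ev s (R v))"
    using root_quotient[OF pv w tK mj] by blast
  have w0: "0 \<le> w" using mon by (simp add: mon_def)
  \<comment> \<open>The monomial \<open>w\<close> is injective in \<open>s\<close>, so it is not
    constantly \<open>c\<close>; a nonzero modulus is what bounds the quotients.\<close>
  have ne: "tt * w \<noteq> s0"
  proof
    assume "tt * w = s0"
    then have "ev (s + 1) (tt * w) = ev (s + 1) s0" by simp
    then have "ev (s + 1) tt * ev (s + 1) w = ev (s + 1) tt * c" by (simp add: es)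
    then have "ev (s + 1) w = ev s w" using T_facts(14)[of "s + 1"] by (simp add: c_def)
    then have "s + 1 = s" by (rule T_facts(6)[OF mon])
    then show False by simp
  qed
  let ?w = "Abs_pm w" and ?s = "Abs_pm s0"
  have "congK PM B (sMul PM T ?w) ?s (sMul PM T (sAdd PM (sMul PM T x) z)) (sMul PM T y)"
  proof (rule congK_PM_I)
    have "(tt * w - s0) * q1 = tt * (tt * R x + R z) - tt * R y"
    proof (rule pz_eqI)
      fix u
      have "ev u ((tt * w - s0) * q1) = ev u tt * (ev u w - ev s w) * ev u q1"
        by (simp add: es c_def algebra_simps)
      also have "\<dots> = ev u tt * ev u tt * (ev u (R x) - ev s (R x))" using q1 by blast
      also have "\<dots> = ev u (tt * (tt * R x + R z) - tt * R y)" by (simp add: ee s algebra_simps)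
      finally show "ev u ((tt * w - s0) * q1) = ev u (tt * (tt * R x + R z) - tt * R y)" .
    qed
    then show "(R (sMul PM T ?w) - R ?s) * q1 = R (sMul PM T (sAdd PM (sMul PM T x) z)) - R (sMul PM T y)"
      using w0 s0(2) by simp
  qed (use w0 s0(2) ne le in simp_all)
  moreover have "congK PM B (sMul PM T ?w) ?s (sMul PM T (sMul PM T v)) (sMul PM T r)"
  proof (rule congK_PM_I)
    have "(tt * w - s0) * q2 = tt * (tt * R v) - tt * R r"
    proof (rule pz_eqI)
      fix u
      have "ev u ((tt * w - s0) * q2) = ev u tt * (ev u w - ev s w) * ev u q2"
        by (simp add: es c_def algebra_simps)
      also have "\<dots> = ev u tt * ev u tt * (ev u (R v) - ev s (R v))" using q2 by blast
      also have "\<dots> = ev u (tt * (tt * R v) - tt * R r)" by (simp add: ee s algebra_simps)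
      finally show "ev u ((tt * w - s0) * q2) = ev u (tt * (tt * R v) - tt * R r)" .
    qed
    then show "(R (sMul PM T ?w) - R ?s) * q2 = R (sMul PM T (sMul PM T v)) - R (sMul PM T r)"
      using w0 s0(2) by simp
  qed (use w0 s0(2) ne le in simp_all)
  moreover have "monK PM B T ?w" using mon w0 monK_PM[OF B] by simp
  moreover have "conK PM B T ?s" using s0 conK_PM[OF B] by auto
  moreover have "R ?w \<le> R B" using T_facts(10)[OF mon] big_bounds(1)[OF B] w0 by simp
  moreover have "R ?s \<le> R B" using T_facts(2)[OF s0] big_bounds(2)[OF B] s0(2) by simp
  ultimately show ?thesis unfolding zeroK_def leK_PM by blast
qed

text \<open>Here \<open>g\<close> is the common value of the two monomials. They are injective, so
  the points given by \<open>zeroK_D\<close> are \<open>s\<close> and \<open>s'\<close> themselves,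
  and both second components take the same value \<open>cy - cz\<close> there.\<close>

lemma eqK_D:
  assumes eq: "eqK PM B T v x v' x'" and mon: "mon tt (R v)" "mon tt (R v')"
  shows "eqR (R v) (R x) (R v') (R x')"
  unfolding eqR_def
proof (intro HOL.allI HOL.impI)
  fix s s' assume ss: "ev s (R v) = ev s' (R v')"
  have B: "big B" using eq by (simp add: eqK_def big_def)
  define g where "g = ev s (R v)"
  have "g > 0" unfolding g_def by (rule T_facts(7)[OF mon(1)])
  then obtain r0 where r0: "con tt g r0" "0 \<le> r0" using T_facts(3) by blast
  let ?r = "Abs_pm r0"
  have r: "con tt g (R ?r)" "R ?r \<le> R B"
    using r0 T_facts(2)[OF r0] big_bounds(2)[OF B] by simp_all
  then have "conK PM B T ?r" using conK_PM[OF B] by blast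
  then obtain z y where zy: "conK PM B T z" "conK PM B T y" "zeroK PM B T x z y v ?r" "zeroK PM B T x' z y v' ?r"
    using eq r(2) unfolding eqK_def leK_PM by blast
  obtain cz cy where c: "con tt cz (R z)" "con tt cy (R y)" using zy(1,2) conK_PM[OF B] by blast
  obtain s1 where s1: "ev s1 (R v) = g" "ev s1 (R x) = cy - cz" using zeroK_D[OF B zy(3) c r(1)] by blast
  obtain s2 where s2: "ev s2 (R v') = g" "ev s2 (R x') = cy - cz" using zeroK_D[OF B zy(4) c r(1)] by blast
  have "s1 = s" using s1(1) T_facts(6)[OF mon(1)] by (simp add: g_def)
  moreover have "s2 = s'" using s2(1) ss T_facts(6)[OF mon(2)] by (simp add: g_def)
  ultimately show "ev s (R x) = ev s' (R x')" using s1 s2 by simp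
qed

lemma eqK_I:
  assumes B: "big B" and mon: "mon tt (R v)" "mon tt (R v')" and eq: "eqR (R v) (R x) (R v') (R x')"
    and le: "tt * (tt * R x + tt * tt) \<le> R B" "tt * (tt * R x' + tt * tt) \<le> R B"
  shows "eqK PM B T v x v' x'"
  unfolding eqK_def leK_PM
proof (intro HOL.conjI HOL.allI HOL.impI)
  show "sLess PM (sMul PM (sMul PM (sMul PM (sMul PM T T) T) T) T) B" using B by (simp add: big_def)
  fix r assume "R r \<le> R B" "conK PM B T r"
  then obtain g where g: "con tt g (R r)" using conK_PM[OF B] by blast
  then have g0: "g > 0" by (simp add: con_def)
  obtain s where s: "ev s (R v) = g" using T_facts(8)[OF mon(1) g0] by blast
  obtain s' where s': "ev s' (R v') = g" using T_facts(8)[OF mon(2) g0] by blast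
  define e where "e = ev s (R x)"
  have e': "ev s' (R x') = e" using eq[unfolded eqR_def, rule_format, of s s'] s s' by (simp add: e_def)
  \<comment> \<open>Only positive reals have representatives, so the value \<open>e\<close>, which
    may be negative or 0, is written as the difference of two positive ones.\<close>
  define cz where "cz = \<bar>e\<bar> + 1"
  define cy where "cy = e + \<bar>e\<bar> + 1"
  have c0: "cz > 0" "cy > 0" by (auto simp: cz_def cy_def abs_if)
  obtain z where z: "con tt cz z" "0 \<le> z" using T_facts(3)[OF c0(1)] by blast
  obtain y where y: "con tt cy y" "0 \<le> y" using T_facts(3)[OF c0(2)] by blast
  let ?z = "Abs_pm z" and ?y = "Abs_pm y"
  have zy: "con tt cz (R ?z)" "con tt cy (R ?y)" using z y by simp_all
  have le': "R ?z \<le> tt * tt" "R ?y \<le> tt * tt" "R r \<le> tt * tt"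
    using T_facts(2)[OF z] T_facts(2)[OF y] T_facts(2)[OF g] z y by simp_all
  have t0: "0 \<le> tt" by simp
  have bnd: "tt * (tt * R u + R ?z) \<le> R B" if "tt * (tt * R u + tt * tt) \<le> R B" for u
    using mult_left_mono[OF add_left_mono[OF le'(1), of "tt * R u"] t0] that by (rule order_trans)
  have bnd2: "tt * a \<le> R B" if "a \<le> tt * tt" for a
    using mult_left_mono[OF that t0] big_bounds(4)[OF B] by (rule order_trans)
  have bnd3: "tt * (tt * R u) \<le> R B" if "mon tt (R u)" for u
    using mult_left_mono[OF T_facts(10)[OF that] t0] by (rule bnd2)
  have "zeroK PM B T x ?z ?y v r"
    by (rule zeroK_I[OF B zy g s]) (use bnd[OF le(1)] bnd2[OF le'(2)] bnd2[OF le'(3)] bnd3[OF mon(1)] in \<open>simp_all add: e_def[symmetric] cz_def cy_def\<close>)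
  moreover have "zeroK PM B T x' ?z ?y v' r"
    by (rule zeroK_I[OF B zy g s']) (use bnd[OF le(2)] bnd2[OF le'(2)] bnd2[OF le'(3)] bnd3[OF mon(2)] in \<open>simp_all add: e' cz_def cy_def\<close>)
  moreover have "conK PM B T ?z" "conK PM B T ?y" using zy conK_PM[OF B] by blast+
  moreover have "R ?z \<le> R B" "R ?y \<le> R B" using le' big_bounds(2)[OF B] by (meson order_trans)+
  ultimately show "\<exists>z. R z \<le> R B \<and> (\<exists>y. R y \<le> R B \<and> conK PM B T z \<and> conK PM B T y \<and>
      zeroK PM B T x z y v r \<and> zeroK PM B T x' z y v' r)" by blast
qed

definition cod :: "pm \<Rightarrow> pm \<Rightarrow> pm \<Rightarrow> bool" where
  "cod v x y \<longleftrightarrow> mon tt (R v) \<and> R x \<le> tt \<and> eqR (R v) (R x) tt (R y)"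

lemma small_bound: "big B \<Longrightarrow> x \<le> tt \<Longrightarrow> tt * (tt * x + tt * tt) \<le> R B"
proof -
  assume B: "big B" and x: "x \<le> tt"
  have t0: "0 \<le> tt" by simp
  show ?thesis
    using mult_left_mono[OF add_right_mono[OF mult_left_mono[OF x t0], of "tt * tt"] t0] big_bounds(3)[OF B]
    by (rule order_trans)
qed

lemma codes_PM:
  assumes B: "big B"
  shows "codes PM B T v x y \<longleftrightarrow> cod v x y"
proof
  assume *: "codes PM B T v x y"
  then have mon: "mon tt (R v)" and le: "R x \<le> tt" using monK_PM[OF B] by (auto simp: codes_def domK_def)
  obtain B' where "eqK PM B' T v x T y" using * unfolding codes_def by blast
  from eqK_D[OF this mon T_facts(9)] show "cod v x y" using mon le by (simp add: cod_def)
next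
  assume *: "cod v x y"
  then have mon: "mon tt (R v)" and le: "R x \<le> tt" and eq: "eqR (R v) (R x) tt (R y)" by (auto simp: cod_def)
  \<comment> \<open>\<open>y\<close> may be larger than \<open>B\<close>, so \<open>eqK_I\<close>
    needs a bound that grows with \<open>y\<close>.\<close>
  define B0 where "B0 = R B + tt * (tt * R y + tt * tt)"
  have B0: "0 \<le> B0" "R B \<le> B0" "tt * (tt * R y + tt * tt) \<le> B0" by (simp_all add: B0_def)
  let ?B = "Abs_pm B0"
  have "big ?B" using B B0 unfolding big_def by simp
  then have "eqK PM ?B T v x T y"
    using eqK_I[OF _ mon T_facts(9) eq] small_bound[OF _ le] B0 by simp
  moreover have "R v \<le> R B" using T_facts(10)[OF mon] big_bounds(1)[OF B] by (rule order_trans)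
  moreover have "R x \<le> R B" using le big_bounds(1)[OF B] by (rule order_trans)
  moreover have "domK PM B T v x" using mon le monK_PM[OF B] by (simp add: domK_def)
  ultimately show "codes PM B T v x y" unfolding codes_def leK_PM by blast
qed

text \<open>For a fixed \<open>v\<close>, decoding is the inverse of one affine change that is the
  same for all codes; operations and order can therefore be compared pointwise.\<close>

lemma cod_affine:
  assumes "mon tt (R v)"
  shows "\<exists>i n d. i > 0 \<and> n > 0 \<and> (\<forall>s. ev s (R v) = ev (real i / real n * s + d) tt) \<and>
    (\<forall>x y. eqR (R v) (R x) tt (R y) \<longleftrightarrow> (\<forall>s. ev s (R x) = ev (real i / real n * s + d) (R y)))"
proof -
  obtain i n d where a: "i > 0" "n > 0" "\<forall>s. ev s (R v) = ev (real i / real n * s + d) tt"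
    using T_facts(5)[OF assms] by blast
  have "eqR (R v) (R x) tt (R y) \<longleftrightarrow> (\<forall>s. ev s (R x) = ev (real i / real n * s + d) (R y))" for x y
  proof
    assume "eqR (R v) (R x) tt (R y)"
    then show "\<forall>s. ev s (R x) = ev (real i / real n * s + d) (R y)" using a(3) by (simp add: eqR_def)
  next
    assume *: "\<forall>s. ev s (R x) = ev (real i / real n * s + d) (R y)"
    show "eqR (R v) (R x) tt (R y)"
      unfolding eqR_def
    proof (intro HOL.allI HOL.impI)
      fix s s' assume "ev s (R v) = ev s' tt"
      then have "ev (real i / real n * s + d) tt = ev s' tt" using a(3) by simp
      then have "real i / real n * s + d = s'" by (rule T_facts(15))
      then show "ev s (R x) = ev s' (R y)" using * by simp
    qed
  qed
  then show ?thesis using a by blast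
qed

text \<open>The inverse of the affine change given by \<open>v\<close> again comes from a monomial
  with positive rational exponent, so \<open>sub_exists\<close> applies.\<close>

lemma cod_total:
  assumes "mon tt (R v)"
  shows "\<exists>y. eqR (R v) (R x) tt (R y)"
proof -
  obtain i n d where a: "i > 0" "n > 0" and
    eq: "\<forall>x y. eqR (R v) (R x) tt (R y) \<longleftrightarrow> (\<forall>s. ev s (R x) = ev (real i / real n * s + d) (R y))"
    using cod_affine[OF assms] by blast
  obtain y where y: "\<forall>s. ev s y = ev (real n / real i * s + - (real n / real i * d)) (R x)"
    using sub_exists[OF a(2,1)] by blast
  have *: "ev s (R x) = ev (real i / real n * s + d) y" for s
  proof -
    have "real n / real i * (real i / real n * s + d) + - (real n / real i * d) = s"
      using a by (simp add: distrib_left)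
    then show ?thesis using y by simp
  qed
  have "real i / real n > 0" using a by simp
  from sub_pos_iff[OF * this] have "0 < R x \<longleftrightarrow> 0 < y" .
  moreover have "y = 0" if "R x = 0" using that y by (intro pz_eqI) simp
  ultimately have "0 \<le> y" using R_nonneg[of x] by (cases "R x = 0") (simp_all add: less_le)
  then have "R (Abs_pm y) = y" by simp
  then show ?thesis using eq * by metis
qed

text \<open>Replacing t by t^(1/N) divides all exponents by N and so brings any element below
  \<open>t\<close> once N is large. Validity for all large N allows a common choice for several
  elements.\<close>

lemma cod_onto:
  "\<exists>N0. \<forall>N\<ge>N0. \<exists>x. R x \<le> tt \<and> (\<forall>s. ev s (R x) = ev (s / real N) (R y))"
proof -
  obtain j where j: "j > 0" "\<forall>n>0. \<exists>p. lev (n * j) (R y) p" using lev_multiple by blast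
  obtain p where p: "lev (k * j) (R y) p" using j(2) T_facts(17) by blast
  have tj: "lev (k * j) tt (monom b (m * j))" by (rule lev_monom_raise[OF t j(1)])
  have kj: "k * j > 0" using T_facts(17) j(1) by simp
  have "\<exists>x. R x \<le> tt \<and> (\<forall>s. ev s (R x) = ev (s / real N) (R y))" if N: "N \<ge> degree p + 1" for N
  proof -
    have N0: "N > 0" using N by simp
    obtain x where x: "lev (k * j * N) x p" using ex_lev_iff[of "k * j * N" p] kj N0 lev_coeff_0[OF p] by auto
    have sub: "ev s x = ev (s / real N) (R y)" for s
      using x p N0 by (simp add: lev_iff mult.commute)
    have tN: "lev (k * j * N) tt (monom b (m * j * N))" by (rule lev_monom_raise[OF tj N0])
    have deg: "degree p < m * j * N"
    proof -
      have "N \<le> m * j * N" using m j(1) by simp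
      then show ?thesis using N by linarith
    qed
    have "degree (monom b (m * j * N) - p) = m * j * N"
      using degree_add_eq_left[of "- p" "monom b (m * j * N)"] deg b by (simp add: degree_monom_eq)
    then have "lead_coeff (monom b (m * j * N) - p) = b" using deg by (simp add: coeff_eq_0)
    then have "x < tt" using lev_less_iff[OF x tN] b by simp
    moreover have "0 \<le> x"
    proof -
      have 1: "0 < x \<longleftrightarrow> 0 < R y" by (rule sub_pos_iff[where a = "1 / real N" and d = 0]) (use sub N0 in simp_all)
      have "x = 0" if "R y = 0" using that sub by (intro pz_eqI) simp
      then show ?thesis using 1 R_nonneg[of y] by (cases "R y = 0") (simp_all add: less_le)
    qed
    ultimately show ?thesis using sub by (intro HOL.exI[of _ "Abs_pm x"]) simp
  qed
  then show ?thesis by blast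
qed

lemma mon_scaled:
  assumes "N \<ge> 2"
  shows "\<exists>v. mon tt (R v) \<and> (\<forall>s. ev s (R v) = ev (s / real N) tt)"
proof -
  have kN: "k * N > 0" using assms T_facts(17) by simp
  obtain v where v: "lev (k * N) v (monom b m)" using ex_lev_iff[OF kN, of "monom b m"] m by auto
  have "m < m * N" using m assms by simp
  then have mon: "mon tt v" using T_facts(4)[OF v] assms b m by simp
  moreover have "ev s v = ev (s / real N) tt" for s
    using v t assms by (simp add: lev_iff mult.commute)
  moreover have "0 \<le> v" using mon by (simp add: mon_def)
  ultimately show ?thesis by (intro HOL.exI[of _ "Abs_pm v"]) simp
qed

text \<open>One N above the three thresholds serves all elements; it is at least 2 to make the
  exponent of \<open>v\<close> smaller than that of \<open>t\<close>.\<close>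

lemma cod_common:
  "\<exists>v x1 x2 x3. cod v x1 y1 \<and> cod v x2 y2 \<and> cod v x3 y3"
proof -
  obtain N1 where N1: "\<forall>N\<ge>N1. \<exists>x. R x \<le> tt \<and> (\<forall>s. ev s (R x) = ev (s / real N) (R y1))" using cod_onto by blast
  obtain N2 where N2: "\<forall>N\<ge>N2. \<exists>x. R x \<le> tt \<and> (\<forall>s. ev s (R x) = ev (s / real N) (R y2))" using cod_onto by blast
  obtain N3 where N3: "\<forall>N\<ge>N3. \<exists>x. R x \<le> tt \<and> (\<forall>s. ev s (R x) = ev (s / real N) (R y3))" using cod_onto by blast
  define N where "N = N1 + N2 + N3 + 2"
  have N: "N \<ge> N1" "N \<ge> N2" "N \<ge> N3" "N \<ge> 2" by (auto simp: N_def)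
  obtain v where v: "mon tt (R v)" "\<forall>s. ev s (R v) = ev (s / real N) tt" using mon_scaled[OF N(4)] by blast
  have c: "cod v x y" if x: "R x \<le> tt" "\<forall>s. ev s (R x) = ev (s / real N) (R y)" for x y
    unfolding cod_def eqR_def
  proof (intro HOL.conjI HOL.allI HOL.impI)
    fix s s' assume "ev s (R v) = ev s' tt"
    then have "ev (s / real N) tt = ev s' tt" using v(2) by simp
    then have "s / real N = s'" by (rule T_facts(15))
    then show "ev s (R x) = ev s' (R y)" using x(2) by simp
  qed (use v x in simp_all)
  obtain x1 where x1: "R x1 \<le> tt" "\<forall>s. ev s (R x1) = ev (s / real N) (R y1)" using N1 N(1) by blast
  obtain x2 where x2: "R x2 \<le> tt" "\<forall>s. ev s (R x2) = ev (s / real N) (R y2)" using N2 N(2) by blast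
  obtain x3 where x3: "R x3 \<le> tt" "\<forall>s. ev s (R x3) = ev (s / real N) (R y3)" using N3 N(3) by blast
  show ?thesis using c[OF x1] c[OF x2] c[OF x3] by blast
qed

text \<open>Monomials attain every positive value, so points with a common value of
  \<open>v\<close>, \<open>v'\<close> and \<open>t\<close> exist for each argument of
  \<open>y\<close> and \<open>y'\<close>; there the codes can be compared with what they
  code.\<close>

lemma cod_eq:
  assumes B: "big B" and c: "cod v x y" "cod v' x' y'"
  shows "eqK PM B T v x v' x' \<longleftrightarrow> R y = R y'"
proof -
  have mon: "mon tt (R v)" "mon tt (R v')" and le: "R x \<le> tt" "R x' \<le> tt"
    and eq: "eqR (R v) (R x) tt (R y)" "eqR (R v') (R x') tt (R y')" using c by (auto simp: cod_def)
  have "eqK PM B T v x v' x' \<longleftrightarrow> eqR (R v) (R x) (R v') (R x')"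
    using eqK_D[OF _ mon] eqK_I[OF B mon _ small_bound[OF B le(1)] small_bound[OF B le(2)]] by blast
  also have "\<dots> \<longleftrightarrow> R y = R y'"
  proof
    assume e: "eqR (R v) (R x) (R v') (R x')"
    show "R y = R y'"
    proof (rule pz_eqI)
      fix u
      obtain s where s: "ev s (R v) = ev u tt" using T_facts(8)[OF mon(1) T_facts(14)[of u]] by blast
      obtain s' where s': "ev s' (R v') = ev u tt" using T_facts(8)[OF mon(2) T_facts(14)[of u]] by blast
      have "ev s (R x) = ev u (R y)" using eq(1)[unfolded eqR_def, rule_format, OF s] .
      moreover have "ev s' (R x') = ev u (R y')" using eq(2)[unfolded eqR_def, rule_format, OF s'] .
      moreover have "ev s (R x) = ev s' (R x')" using e[unfolded eqR_def, rule_format, of s s'] s s' by simp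
      ultimately show "ev u (R y) = ev u (R y')" by simp
    qed
  next
    assume y: "R y = R y'"
    show "eqR (R v) (R x) (R v') (R x')"
      unfolding eqR_def
    proof (intro HOL.allI HOL.impI)
      fix s s' assume ss: "ev s (R v) = ev s' (R v')"
      obtain u where u: "ev u tt = ev s (R v)" using T_facts(16)[OF T_facts(7)[OF mon(1), of s]] by blast
      have "ev s (R x) = ev u (R y)" using eq(1)[unfolded eqR_def, rule_format, OF u[symmetric]] .
      moreover have "ev s' (R x') = ev u (R y')" by (rule eq(2)[unfolded eqR_def, rule_format]) (simp add: u ss)
      ultimately show "ev s (R x) = ev s' (R x')" by (simp add: y)
    qed
  qed
  finally show ?thesis .
qed

text \<open>A constant function is unchanged by substitution, whatever the monomial
  \<open>v\<close>; so 0 and 1 can be recognised from the second component alone.\<close>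

lemma cod_const:
  assumes c: "cod v x y" and a: "\<And>s. ev s a = a0"
  shows "R x = a \<longleftrightarrow> R y = a"
proof -
  have mon: "mon tt (R v)" and eq: "eqR (R v) (R x) tt (R y)" using c by (auto simp: cod_def)
  show ?thesis
  proof
    assume x: "R x = a"
    show "R y = a"
    proof (rule pz_eqI)
      fix u
      obtain s where s: "ev s (R v) = ev u tt" using T_facts(8)[OF mon T_facts(14)[of u]] by blast
      show "ev u (R y) = ev u a" using eq[unfolded eqR_def, rule_format, OF s] by (simp add: x a)
    qed
  next
    assume y: "R y = a"
    show "R x = a"
    proof (rule pz_eqI)
      fix s
      obtain u where u: "ev u tt = ev s (R v)" using T_facts(16)[OF T_facts(7)[OF mon, of s]] by blast
      show "ev s (R x) = ev s a" using eq[unfolded eqR_def, rule_format, OF u[symmetric]] by (simp add: y a)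
    qed
  qed
qed

text \<open>The hypothesis \<open>inv\<close> is invariance of the relation under an increasing
  affine change. Codes with a common monomial exist by \<open>cod_common\<close>, and
  \<open>cod_eq\<close> shows that any triple found by \<open>triK\<close> still codes the same
  three elements.\<close>

lemma cod_tri:
  assumes B: "big B" and c: "cod v1 x1 y1" "cod v2 x2 y2" "cod v3 x3 y3"
    and inv: "\<And>a d z1 z2 z3. a > 0 \<Longrightarrow> (\<And>s. ev s (R z1) = ev (a * s + d) (R y1)) \<Longrightarrow>
      (\<And>s. ev s (R z2) = ev (a * s + d) (R y2)) \<Longrightarrow> (\<And>s. ev s (R z3) = ev (a * s + d) (R y3)) \<Longrightarrow>
      P z1 z2 z3 \<longleftrightarrow> P y1 y2 y3"
  shows "triK P PM B T v1 x1 v2 x2 v3 x3 \<longleftrightarrow> P y1 y2 y3"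
proof -
  have P: "P z1 z2 z3 \<longleftrightarrow> P y1 y2 y3" if z: "cod v z1 y1" "cod v z2 y2" "cod v z3 y3" for v z1 z2 z3
  proof -
    have mon: "mon tt (R v)" using z by (simp add: cod_def)
    obtain i n d where a: "i > 0" "n > 0" and
      eq: "\<forall>x y. eqR (R v) (R x) tt (R y) \<longleftrightarrow> (\<forall>s. ev s (R x) = ev (real i / real n * s + d) (R y))"
      using cod_affine[OF mon] by blast
    show ?thesis
      by (rule inv[of "real i / real n" z1 d z2 z3]) (use a eq z in \<open>simp_all add: cod_def\<close>)
  qed
  show ?thesis
  proof
    assume "triK P PM B T v1 x1 v2 x2 v3 x3"
    then obtain v z1 z2 z3 where z: "domK PM B T v z1" "domK PM B T v z2" "domK PM B T v z3"
      "eqK PM B T v1 x1 v z1" "eqK PM B T v2 x2 v z2" "eqK PM B T v3 x3 v z3" "P z1 z2 z3"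
      unfolding triK_def by blast
    have mon: "mon tt (R v)" and le: "R z1 \<le> tt" "R z2 \<le> tt" "R z3 \<le> tt"
      using z(1-3) monK_PM[OF B] by (simp_all add: domK_def)
    obtain u1 where "eqR (R v) (R z1) tt (R u1)" using cod_total[OF mon] by blast
    then have u1: "cod v z1 u1" using mon le by (simp add: cod_def)
    obtain u2 where "eqR (R v) (R z2) tt (R u2)" using cod_total[OF mon] by blast
    then have u2: "cod v z2 u2" using mon le by (simp add: cod_def)
    obtain u3 where "eqR (R v) (R z3) tt (R u3)" using cod_total[OF mon] by blast
    then have u3: "cod v z3 u3" using mon le by (simp add: cod_def)
    have "u1 = y1" "u2 = y2" "u3 = y3"
      using cod_eq[OF B c(1) u1] cod_eq[OF B c(2) u2] cod_eq[OF B c(3) u3] z(4-6) by (simp_all add: Rep_pm_inject)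
    then show "P y1 y2 y3" using P[of v z1 z2 z3] u1 u2 u3 z(7) by simp
  next
    assume "P y1 y2 y3"
    obtain v z1 z2 z3 where z: "cod v z1 y1" "cod v z2 y2" "cod v z3 y3" using cod_common by blast
    have "R v \<le> R B" "R z1 \<le> R B" "R z2 \<le> R B" "R z3 \<le> R B" "domK PM B T v z1" "domK PM B T v z2" "domK PM B T v z3"
      using z[THEN codes_PM[OF B, THEN iffD2]] by (simp_all add: codes_def)
    moreover have "eqK PM B T v1 x1 v z1" "eqK PM B T v2 x2 v z2" "eqK PM B T v3 x3 v z3"
      using cod_eq[OF B c(1) z(1)] cod_eq[OF B c(2) z(2)] cod_eq[OF B c(3) z(3)] by simp_all
    moreover have "P z1 z2 z3" using P[OF z] \<open>P y1 y2 y3\<close> by simp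
    ultimately show "triK P PM B T v1 x1 v2 x2 v3 x3" unfolding triK_def leK_PM by blast
  qed
qed

lemma affine_eqI:
  assumes "a > 0" "\<And>s. ev (a * s + d) x = ev (a * s + d) y"
  shows "x = y"
proof (rule pz_eqI)
  fix s
  have "a * ((s - d) / a) + d = s" using assms(1) by simp
  then show "ev s x = ev s y" using assms(2)[of "(s - d) / a"] by simp
qed

lemma cod_add: "big B \<Longrightarrow> cod v1 x1 y1 \<Longrightarrow> cod v2 x2 y2 \<Longrightarrow> cod v3 x3 y3 \<Longrightarrow>
    addK PM B T v1 x1 v2 x2 v3 x3 \<longleftrightarrow> R y1 + R y2 = R y3"
proof (subst cod_tri[of B v1 x1 y1 v2 x2 y2 v3 x3 y3])
  fix a d :: real and z1 z2 z3 :: pm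
  assume a: "a > 0" and z: "\<And>s. ev s (R z1) = ev (a * s + d) (R y1)" "\<And>s. ev s (R z2) = ev (a * s + d) (R y2)"
    "\<And>s. ev s (R z3) = ev (a * s + d) (R y3)"
  have "R z1 + R z2 = R z3 \<longleftrightarrow> R y1 + R y2 = R y3"
  proof
    assume "R z1 + R z2 = R z3"
    then have "ev s (R z1 + R z2) = ev s (R z3)" for s by simp
    then show "R y1 + R y2 = R y3" using z by (intro affine_eqI[OF a]) simp
  next
    assume "R y1 + R y2 = R y3"
    then have "ev s (R y1 + R y2) = ev s (R y3)" for s by simp
    then show "R z1 + R z2 = R z3" using z by (intro pz_eqI) simp
  qed
  then show "sEq PM (sAdd PM z1 z2) z3 = sEq PM (sAdd PM y1 y2) y3" by simp
qed simp_all

lemma cod_mul: "big B \<Longrightarrow> cod v1 x1 y1 \<Longrightarrow> cod v2 x2 y2 \<Longrightarrow> cod v3 x3 y3 \<Longrightarrow>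
    mulK PM B T v1 x1 v2 x2 v3 x3 \<longleftrightarrow> R y1 * R y2 = R y3"
proof (subst cod_tri[of B v1 x1 y1 v2 x2 y2 v3 x3 y3])
  fix a d :: real and z1 z2 z3 :: pm
  assume a: "a > 0" and z: "\<And>s. ev s (R z1) = ev (a * s + d) (R y1)" "\<And>s. ev s (R z2) = ev (a * s + d) (R y2)"
    "\<And>s. ev s (R z3) = ev (a * s + d) (R y3)"
  have "R z1 * R z2 = R z3 \<longleftrightarrow> R y1 * R y2 = R y3"
  proof
    assume "R z1 * R z2 = R z3"
    then have "ev s (R z1 * R z2) = ev s (R z3)" for s by simp
    then show "R y1 * R y2 = R y3" using z by (intro affine_eqI[OF a]) simp
  next
    assume "R y1 * R y2 = R y3"
    then have "ev s (R y1 * R y2) = ev s (R y3)" for s by simp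
    then show "R z1 * R z2 = R z3" using z by (intro pz_eqI) simp
  qed
  then show "sEq PM (sMul PM z1 z2) z3 = sEq PM (sMul PM y1 y2) y3" by simp
qed simp_all

lemma cod_less: "big B \<Longrightarrow> cod v1 x1 y1 \<Longrightarrow> cod v2 x2 y2 \<Longrightarrow> cod v3 x3 y3 \<Longrightarrow>
    lessK PM B T v1 x1 v2 x2 v3 x3 \<longleftrightarrow> R y1 < R y2"
proof (subst cod_tri[of B v1 x1 y1 v2 x2 y2 v3 x3 y3])
  fix a d :: real and z1 z2 z3 :: pm
  assume a: "a > 0" and z: "\<And>s. ev s (R z1) = ev (a * s + d) (R y1)" "\<And>s. ev s (R z2) = ev (a * s + d) (R y2)"
  have "0 < R z2 - R z1 \<longleftrightarrow> 0 < R y2 - R y1"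
    by (rule sub_pos_iff[where a = a and d = d]) (use a z in simp_all)
  then show "sLess PM z1 z2 = sLess PM y1 y2" by simp
qed simp_all

lemma faithful_PM: "big B \<Longrightarrow> faithful PM B T"
proof -
  assume B: "big B"
  note cp = codes_PM[OF B]
  show ?thesis
    unfolding faithful_def
  proof (intro HOL.conjI HOL.allI HOL.impI)
    show "\<exists>v x. codes PM B T v x y" for y unfolding cp using cod_common[of y y y] by blast
    show "\<exists>y. codes PM B T v x y" if "leK PM v B \<and> leK PM x B \<and> domK PM B T v x" for v x
    proof -
      have mon: "mon tt (R v)" "R x \<le> tt" using that monK_PM[OF B] by (simp_all add: domK_def)
      then show ?thesis unfolding cp cod_def using cod_total[OF mon(1)] by blast
    qed
    show "sEq PM x (sZero PM) = sEq PM y (sZero PM)" if "codes PM B T v x y" for v x y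
      using cod_const[of v x y 0 0] that by (simp add: cp)
    show "sEq PM x (sOne PM) = sEq PM y (sOne PM)" if "codes PM B T v x y" for v x y
      using cod_const[of v x y 1 1] that by (simp add: cp)
    show "eqK PM B T v x v' x' = sEq PM y y'" if "codes PM B T v x y" "codes PM B T v' x' y'" for v x y v' x' y'
      using cod_eq[OF B] that by (simp add: cp)
    show "lessK PM B T v x v' x' v' x' = sLess PM y y'" if "codes PM B T v x y" "codes PM B T v' x' y'" for v x y v' x' y'
      using cod_less[OF B, of v x y v' x' y' v' x' y'] that by (simp add: cp)
    show "addK PM B T v x v' x' v'' x'' = sEq PM (sAdd PM y y') y''"
      if "codes PM B T v x y" "codes PM B T v' x' y'" "codes PM B T v'' x'' y''" for v x y v' x' y' v'' x'' y''
      using cod_add[OF B, of v x y v' x' y' v'' x'' y''] that by (simp add: cp)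
    show "mulK PM B T v x v' x' v'' x'' = sEq PM (sMul PM y y') y''"
      if "codes PM B T v x y" "codes PM B T v' x' y'" "codes PM B T v'' x'' y''" for v x y v' x' y' v'' x'' y''
      using cod_mul[OF B, of v x y v' x' y' v'' x'' y''] that by (simp add: cp)
  qed
qed

end

section \<open>The completion\<close>

text \<open>A divisor 2 d + 1 of \<open>t\<close> satisfies d <= 2 d + 1 <= t <= B, so the bound on
  \<open>d\<close> in \<open>goodK\<close> excludes no divisor and the unbounded chain condition
  follows.\<close>

lemma goodK_monomial:
  assumes "goodK PM B T"
  shows "\<exists>k b m. lev k (R T) (monom b m) \<and> b > 0 \<and> m > 0"
proof (rule odd_divisor_chain_monomial)
  have g: "R T * R T * R T * R T * R T < R B" "0 < R T"
    and step: "\<And>d. leK PM d B \<Longrightarrow> dvdK PM B (sAdd PM (sAdd PM d d) (sOne PM)) T \<Longrightarrow>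
       dvdK PM B (sAdd PM (sAdd PM (sAdd PM (sAdd PM d d) (sOne PM)) (sOne PM)) (sOne PM)) T"
    using assms unfolding goodK_def by simp_all
  show "0 < R T" by (rule g)
  have mono: "x \<le> x * R T" if "0 \<le> x" for x
    using mult_left_mono[OF pz_discrete[OF g(2)] that] by simp
  have "R T \<le> R T * R T" "R T * R T \<le> R T * R T * R T" "R T * R T * R T \<le> R T * R T * R T * R T"
    "R T * R T * R T * R T \<le> R T * R T * R T * R T * R T"
    by (rule mono; simp)+
  then have TB: "R T \<le> R B" using g(1) by (meson order_trans less_imp_le)
  fix d assume d: "0 \<le> d" "(2 * d + 1) dvd R T"
  let ?d = "Abs_pm d"
  obtain q where "(2 * d + 1) * q = R T" using dvd_ex[OF d(2)] by blast
  then have q: "q * (2 * d + 1) = R T" by (simp only: mult.commute)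
  have d1: "0 \<le> 2 * d + 1" using d(1) by simp
  have q0: "q \<noteq> 0" using q g(2) by auto
  have "2 * d + 1 \<noteq> 0" using q g(2) by auto
  then have "0 \<le> q" using factor_le(1)[of "2 * d + 1" q "R T"] d1 q by (simp add: mult.commute)
  then have "2 * d + 1 \<le> R T" using factor_le(2)[OF q] q0 by simp
  moreover have "d \<le> 2 * d + 1" using d(1) by simp
  ultimately have "d \<le> R B" using TB by (meson order_trans)
  then have "leK PM ?d B" using d(1) by simp
  moreover have "R (sAdd PM (sAdd PM ?d ?d) (sOne PM)) = 2 * d + 1" using d(1) by simp
  then have "dvdK PM B (sAdd PM (sAdd PM ?d ?d) (sOne PM)) T" using dvdK_PM[OF TB] d(2) by simp
  ultimately have "dvdK PM B (sAdd PM (sAdd PM (sAdd PM (sAdd PM ?d ?d) (sOne PM)) (sOne PM)) (sOne PM)) T"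
    by (rule step)
  moreover have "R (sAdd PM (sAdd PM (sAdd PM (sAdd PM ?d ?d) (sOne PM)) (sOne PM)) (sOne PM)) = 2 * d + 3"
    using d(1) by simp
  ultimately show "(2 * d + 3) dvd R T" using dvdK_PM[OF TB] by metis
qed

text \<open>For the indeterminate t, an odd divisor 2 d + 1 must be a positive constant, and then 2
  d + 3 is a constant as well and divides t.\<close>

lemma goodK_exists: "\<exists>B T. goodK PM B T"
proof -
  obtain t where t: "lev 1 t (monom 1 1)" using ex_lev_iff[of 1 "monom 1 1"] by auto
  have tp: "(1 :: real) > 0" "(1 :: nat) > 0" by simp_all
  have t0: "0 < t" using lev_pos_monom[OF t] by simp
  let ?T = "Abs_pm t" and ?B = "Abs_pm (t * t * t * t * t + 1)"
  have RT: "R ?T = t" "R ?B = t * t * t * t * t + 1" using t0 by simp_all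
  have mono: "x \<le> x * t" if "0 \<le> x" for x
    using mult_left_mono[OF pz_discrete[OF t0] that] by simp
  have "t \<le> t * t" "t * t \<le> t * t * t" "t * t * t \<le> t * t * t * t" "t * t * t * t \<le> t * t * t * t * t"
    using t0 by (intro mono; simp)+
  moreover have "t * t * t * t * t \<le> R ?B" unfolding RT by simp
  ultimately have TB: "R ?T \<le> R ?B" unfolding RT(1) by (meson order_trans)
  have step: "(2 * d + 3) dvd t" if d: "0 \<le> d" "(2 * d + 1) dvd t" for d
  proof -
    obtain j a i where u: "j > 0" "lev (1 * j) (2 * d + 1) (monom a i)" "a \<noteq> 0"
      using dvd_t[OF t tp d(2)] by blast
    obtain l where l: "l > 0" "\<forall>n>0. \<exists>p. lev (n * l) d p" using lev_multiple by blast
    obtain p where p: "lev (j * l) d p" using l u(1) by blast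
    have one: "lev (j * l) 1 1" using l u(1) by (intro lev_one) simp
    have "lev (j * l) (2 * d + 1) (monom a (i * l))" using lev_monom_raise[OF u(2) l(1)] by simp
    moreover have "lev (j * l) (2 * d + 1) (p + p + 1)"
      using lev_plus[OF lev_plus[OF p p] one] by (simp only: mult_2)
    ultimately have eq: "monom a (i * l) = p + p + 1" by (rule lev_unique)
    \<comment> \<open>A monomial of positive exponent has constant term 0, whereas the constant term
      of 2 d + 1 is odd.\<close>
    have "i * l = 0"
    proof (rule HOL.ccontr)
      assume "i * l \<noteq> 0"
      then have "coeff (p + p + 1) 0 = 0" unfolding eq[symmetric] by simp
      then have "coeff p 0 + coeff p 0 + 1 = 0" unfolding coeff_add by simp
      moreover obtain z where "coeff p 0 = of_int z" using lev_coeff_0[OF p] by (auto elim: Ints_cases)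
      ultimately have "real_of_int (2 * z + 1) = of_int 0" by simp
      then have "2 * z + 1 = 0" by (simp only: of_int_eq_iff)
      then show False by presburger
    qed
    then have i: "i = 0" using l(1) by simp
    have ev: "ev s (2 * d + 1) = a" for s using u(2) by (simp add: lev_iff poly_monom i)
    have "0 < 2 * d + 1" using d(1) by simp
    then have "a > 0" using lev_pos_monom[OF u(2)] by simp
    moreover have "ev s (2 * d + 3) = a + 2" for s
    proof -
      have "2 * d + 3 = (2 * d + 1) + (1 + 1)" by simp
      then show ?thesis using ev[of s] by (simp only: ev_simps(2,3))
    qed
    ultimately show ?thesis by (intro odd_constant_dvd[OF t tp, of "a + 2"]) simp_all
  qed
  have "goodK PM ?B ?T"
    unfolding goodK_def
  proof (intro HOL.conjI HOL.allI HOL.impI)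
    fix d assume "dvdK PM ?B (sAdd PM (sAdd PM d d) (sOne PM)) ?T"
    then have "(2 * R d + 1) dvd t" using dvdK_PM[OF TB] t0 by (simp only: PM_simps RT mult_2)
    from step[OF R_nonneg this]
    have "R (sAdd PM (sAdd PM (sAdd PM (sAdd PM d d) (sOne PM)) (sOne PM)) (sOne PM)) dvd R ?T"
      using t0 by (simp add: algebra_simps)
    then show "dvdK PM ?B (sAdd PM (sAdd PM (sAdd PM (sAdd PM d d) (sOne PM)) (sOne PM)) (sOne PM)) ?T"
      using dvdK_PM[OF TB] by blast
  qed (use t0 RT in simp_all)
  then show ?thesis by blast
qed

theorem sat_copy_axiom_PM: "sat PM e copy_axiom"
  unfolding sat_copy_axiom
proof (intro HOL.conjI HOL.allI HOL.impI goodK_exists)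
  fix B T assume g: "goodK PM B T"
  obtain k b m where t: "lev k (R T) (monom b m)" "b > 0" "m > 0" using goodK_monomial[OF g] by blast
  have "big T B" unfolding big_def[OF t] using g by (simp add: goodK_def)
  then show "faithful PM B T" by (rule faithful_PM[OF t])
qed

section \<open>Open induction and the remaining axioms in the model\<close>

lemma term_poly: "\<exists>P. \<forall>x. R (tval PM (case_nat x e) s) = poly P (R x)"
proof (induction s)
  case (Var n)
  show ?case
  proof (cases n)
    case 0
    then show ?thesis by (intro HOL.exI[of _ "[:0, 1:]"]) simp
  next
    case (Suc i)
    then show ?thesis by (intro HOL.exI[of _ "[:R (e i):]"]) simp
  qed
next
  case Zero
  show ?case by (intro HOL.exI[of _ 0]) simp
next
  case One
  show ?case by (intro HOL.exI[of _ 1]) simp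
next
  case (Add s1 s2)
  then obtain P Q where "\<forall>x. R (tval PM (case_nat x e) s1) = poly P (R x)"
    "\<forall>x. R (tval PM (case_nat x e) s2) = poly Q (R x)" by blast
  then show ?case by (intro HOL.exI[of _ "P + Q"]) simp
next
  case (Mul s1 s2)
  then obtain P Q where "\<forall>x. R (tval PM (case_nat x e) s1) = poly P (R x)"
    "\<forall>x. R (tval PM (case_nat x e) s2) = poly Q (R x)" by blast
  then show ?case by (intro HOL.exI[of _ "P * Q"]) simp
qed

definition sign_det :: "(nat \<Rightarrow> pm) \<Rightarrow> fm \<Rightarrow> pz poly set \<Rightarrow> bool" where
  "sign_det e p \<P> \<longleftrightarrow> finite \<P> \<and> (\<forall>x y. (\<forall>P\<in>\<P>. sgn (poly P (R x)) = sgn (poly P (R y))) \<longrightarrow>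
     sat PM (case_nat x e) p = sat PM (case_nat y e) p)"

lemma sign_det_union:
  assumes "sign_det e p \<P>" "sign_det e q \<Q>"
  shows "sign_det e (p \<^bold>\<longrightarrow> q) (\<P> \<union> \<Q>)" "sign_det e (p \<^bold>\<and> q) (\<P> \<union> \<Q>)" "sign_det e (p \<^bold>\<or> q) (\<P> \<union> \<Q>)"
  proof -
  have "finite (\<P> \<union> \<Q>)" using assms by (simp add: sign_det_def)
  moreover have "sat PM (case_nat x e) p = sat PM (case_nat y e) p" "sat PM (case_nat x e) q = sat PM (case_nat y e) q"
    if "\<forall>P\<in>\<P> \<union> \<Q>. sgn (poly P (R x)) = sgn (poly P (R y))" for x y
    using assms that unfolding sign_det_def by blast+
  ultimately show "sign_det e (p \<^bold>\<longrightarrow> q) (\<P> \<union> \<Q>)" "sign_det e (p \<^bold>\<and> q) (\<P> \<union> \<Q>)" "sign_det e (p \<^bold>\<or> q) (\<P> \<union> \<Q>)"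
    unfolding sign_det_def sat.simps by blast+
qed

text \<open>With the parameters fixed, an atomic formula is a condition on the sign of the
  difference of two polynomials over the ring, and connectives only unite the finite sets of
  polynomials.\<close>

lemma quantifier_free_sign_det: "quantifier_free p \<Longrightarrow> \<exists>\<P>. sign_det e p \<P>"
proof (induction p)
  case (Eq s s')
  obtain P where P: "\<forall>x. R (tval PM (case_nat x e) s) = poly P (R x)" using term_poly by blast
  obtain Q where Q: "\<forall>x. R (tval PM (case_nat x e) s') = poly Q (R x)" using term_poly by blast
  have "sat PM (case_nat x e) (s \<^bold>= s') \<longleftrightarrow> sgn (poly (P - Q) (R x)) = 0" for x
    using P Q by (simp add: sgn_0_0)
  then have "sign_det e (s \<^bold>= s') {P - Q}" unfolding sign_det_def by simp
  then show ?case ..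
next
  case (Less s s')
  obtain P where P: "\<forall>x. R (tval PM (case_nat x e) s) = poly P (R x)" using term_poly by blast
  obtain Q where Q: "\<forall>x. R (tval PM (case_nat x e) s') = poly Q (R x)" using term_poly by blast
  have "sat PM (case_nat x e) (s \<^bold>< s') \<longleftrightarrow> sgn (poly (Q - P) (R x)) = 1" for x
    using P Q by (simp add: sgn_1_pos)
  then have "sign_det e (s \<^bold>< s') {Q - P}" unfolding sign_det_def by simp
  then show ?case ..
next
  case Fls
  have "sign_det e \<^bold>\<bottom> {}" by (simp add: sign_det_def)
  then show ?case ..
next
  case (Imp p q)
  then obtain \<P> \<Q> where "sign_det e p \<P>" "sign_det e q \<Q>" by auto
  then show ?case using sign_det_union(1) by blast
next
  case (Conj p q)
  then obtain \<P> \<Q> where "sign_det e p \<P>" "sign_det e q \<Q>" by auto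
  then show ?case using sign_det_union(2) by blast
next
  case (Disj p q)
  then obtain \<P> \<Q> where "sign_det e p \<P>" "sign_det e q \<Q>" by auto
  then show ?case using sign_det_union(3) by blast
qed simp_all

lemma sat_induction_axiom:
  assumes "quantifier_free p"
  shows "sat PM e (induction_axiom p)"
  unfolding induction_axiom_def sat_univ_closure
proof (rule HOL.allI)
  fix e
  obtain \<P> where \<P>: "sign_det e p \<P>" using quantifier_free_sign_det[OF assms] by blast
  define \<theta> where "\<theta> u \<longleftrightarrow> sat PM (case_nat (Abs_pm u) e) p" for u
  have succ: "sat PM (case_nat x e) (subst (Var(0 := Var 0 \<^bold>+ \<^bold>1)) p) \<longleftrightarrow> sat PM (case_nat (sAdd PM x (sOne PM)) e) p" for x
  proof -
    have "(\<lambda>n. tval PM (case_nat x e) ((Var(0 := Var 0 \<^bold>+ \<^bold>1)) n)) = case_nat (sAdd PM x (sOne PM)) e"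
      by (rule ext) (simp split: nat.split)
    then show ?thesis by (simp add: sat_subst)
  qed
  have Abs_R: "Abs_pm (R x) = x" for x by (rule Rep_pm_inverse)
  have main: "sat PM (case_nat x e) p"
    if base: "sat PM e (inst p \<^bold>0)" and
      step: "\<And>x. sat PM (case_nat x e) p \<Longrightarrow> sat PM (case_nat (sAdd PM x (sOne PM)) e) p" for x
  proof -
    have "\<theta> (R x)"
    proof (rule sign_determined_induction[of \<P>])
      show "finite \<P>" using \<P> by (simp add: sign_det_def)
      show "\<theta> u = \<theta> v" if "0 \<le> u" "0 \<le> v" "\<And>P. P \<in> \<P> \<Longrightarrow> sgn (poly P u) = sgn (poly P v)" for u v
        using \<P> that unfolding sign_det_def \<theta>_def by (metis R_Abs)
      have "Abs_pm 0 = sZero PM" by (simp add: PM_def)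
      then show "\<theta> 0" using base by (simp add: \<theta>_def sat_inst)
      show "\<theta> (u + 1)" if "0 \<le> u" "\<theta> u" for u
      proof -
        have "sAdd PM (Abs_pm u) (sOne PM) = Abs_pm (u + 1)"
          using that(1) by (simp add: PM_def)
        then show ?thesis using step[of "Abs_pm u"] that(2) by (simp add: \<theta>_def)
      qed
    qed simp
    then show ?thesis by (simp add: \<theta>_def Abs_R)
  qed
  show "sat PM e (inst p \<^bold>0 \<^bold>\<and> All (p \<^bold>\<longrightarrow> subst (Var(0 := Var 0 \<^bold>+ \<^bold>1)) p) \<^bold>\<longrightarrow> All p)"
    using main succ by simp
qed

lemma sat_PA_minus_axioms:
  assumes "p \<in> PA_minus_axioms"
  shows "sat PM e p"
proof -
  have sub: "\<exists>z. R x + R z = R y" if "R x < R y" for x y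
    using that by (intro HOL.exI[of _ "Abs_pm (R y - R x)"]) simp
  have sub': "\<exists>z. R z + R x = R y" if "R x < R y" for x y
    using sub[OF that] by (simp only: add.commute)
  have lin: "R x < R y \<or> R x = R y \<or> R y < R x" for x y
    by (rule less_linear)
  have disc: "R x = 1 \<or> 1 < R x" if "0 < R x" for x
    using pz_discrete[OF that] by (auto simp: le_less)
  have zero: "R x = 0 \<or> 0 < R x" for x
    using R_nonneg[of x] by (auto simp: le_less)  obtain q where q: "p = univ_closure q" and "\<forall>e. sat PM e q"
    using assms disc zero unfolding PA_minus_axioms_def Let_def
    by (elim imageE insertE) (auto simp: eval_nat_numeral algebra_simps lin sub sub' intro: mult_strict_right_mono)
  then show ?thesis by (simp add: sat_univ_closure)
qed

lemma sat_IOpen: "p \<in> IOpen \<Longrightarrow> sentence p \<and> sat PM e p"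
proof -
  assume "p \<in> IOpen"
  then have p: "sentence p" and d: "PA_minus_axioms \<union> {induction_axiom p | p. quantifier_free p} \<turnstile> p"
    by (auto simp: IOpen_def deductive_closure_def)
  have "sat PM e p"
    by (rule soundness[OF d]) (auto simp: PM_def sat_PA_minus_axioms[unfolded PM_def] sat_induction_axiom[unfolded PM_def])
  with p show ?thesis by blast
qed

theorem theorem5p2:
  shows "\<exists>T. completion_of IOpen T \<and>
    (\<exists>\<phi> S. sentence \<phi> \<and> infinite S \<and> (\<forall>\<sigma>\<in>S. sentence \<sigma> \<and> sigma1 \<sigma>) \<and>
           axiomatised_by T (insert \<phi> S))"
proof -
  define e :: "nat \<Rightarrow> pm" where "e = (\<lambda>_. sZero PM)"
  define T where "T = {p. sentence p \<and> sat PM e p}"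
  define S where "S = {p. sentence p \<and> sigma1 p \<and> sat PM e p}"
  have eqPM: "sEq PM = (=)" by (simp add: PM_def)
  have sound: "sat PM e p" if "A \<turnstile> p" "A \<subseteq> T" for A p
    by (rule soundness[OF that(1) eqPM]) (use that(2) in \<open>auto simp: T_def\<close>)
  have copy_axiom: "sentence copy_axiom" "sat PM e copy_axiom"
    using sentence_univ_closure sat_copy_axiom_PM by (simp_all add: copy_axiom_def)
  have sub: "insert copy_axiom S \<subseteq> T" using copy_axiom by (auto simp: T_def S_def)
  have thy: "deductive_closure T = T"
    using sound[of T] by (auto simp: deductive_closure_def T_def intro: derives.assm)
  have "IOpen \<subseteq> T" using sat_IOpen by (auto simp: T_def)
  moreover have "consistent T" using sound[of T "\<^bold>\<bottom>"] by (auto simp: consistent_def)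
  moreover have "Defs.complete T"
    unfolding Defs.complete_def
  proof (intro HOL.allI HOL.impI)
    fix p assume "sentence p"
    then have "p \<in> T \<or> \<^bold>\<not> p \<in> T" by (auto simp: T_def sentence_def)
    then show "T \<turnstile> p \<or> T \<turnstile> \<^bold>\<not> p" using derives.assm by blast
  qed
  ultimately have compl: "completion_of IOpen T" using thy by (simp add: completion_of_def is_theory_def)
  have "deductive_closure (insert copy_axiom S) = T"
  proof
    show "deductive_closure (insert copy_axiom S) \<subseteq> T"
      using sound[OF _ sub] by (auto simp: deductive_closure_def T_def)
    show "T \<subseteq> deductive_closure (insert copy_axiom S)"
    proof
      fix p assume "p \<in> T"
      then have p: "sentence p" "sat PM e p" by (auto simp: T_def)
      \<comment> \<open>The model satisfies the single axiom, so it satisfies the bounded version of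
        each sentence true in it.\<close>
      have bounded_version: "bounded_version p \<in> S"
        using p sat_bounded_version[OF eq_congruence_PM copy_axiom(2) p(1)] sigma1_bounded_version[of p] sentence_ex_closure
        by (auto simp: S_def bounded_version_def)
      \<comment> \<open>In every structure satisfying these axioms, \<open>p\<close> is equivalent
        to its bounded version, which is itself one of the axioms.\<close>
      have "insert copy_axiom S \<turnstile> p"
      proof (rule completeness)
        show "sentence q" if "q \<in> insert copy_axiom S" for q using that copy_axiom by (auto simp: S_def)
        show "sat K e' p" if K: "eq_congruence K" and ax: "\<And>q. q \<in> insert copy_axiom S \<Longrightarrow> sat K e' q"
          for K :: "tm str" and e'
          using sat_bounded_version[OF K ax[of copy_axiom] p(1)] ax[of "bounded_version p"] bounded_version by simp
      qed (rule p)
      then show "p \<in> deductive_closure (insert copy_axiom S)" using p by (simp add: deductive_closure_def)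
    qed
  qed
  moreover have "infinite S"
  proof -
    \<comment> \<open>Conjunctions of growing length of one trivial truth provide infinitely many
      members of \<open>S\<close>.\<close>
    define f where "f n = ((\<^bold>\<and>) (\<^bold>\<not> \<^bold>\<bottom>) ^^ n) (\<^bold>\<not> \<^bold>\<bottom>)" for n :: nat
    have "f m = f n \<Longrightarrow> m = n" for m n
      unfolding f_def
    proof (induction m arbitrary: n)
      case 0
      then show ?case by (cases n) simp_all
    next
      case (Suc m)
      then show ?case by (cases n) simp_all
    qed
    then have "inj f" by (rule injI)
    have "sentence (f n) \<and> delta0 (f n) \<and> sat PM e (f n)" for n
      by (induction n) (auto simp: f_def sentence_def intro!: delta0_intros)
    then have "range f \<subseteq> S" by (auto simp: S_def intro: sigma1.intros)
    then show ?thesis using range_inj_infinite[OF \<open>inj f\<close>] infinite_super by blast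
  qed
  moreover have "\<forall>\<sigma>\<in>S. sentence \<sigma> \<and> sigma1 \<sigma>" by (auto simp: S_def)
  ultimately have "sentence copy_axiom \<and> infinite S \<and> (\<forall>\<sigma>\<in>S. sentence \<sigma> \<and> sigma1 \<sigma>) \<and> axiomatised_by T (insert copy_axiom S)"
    using copy_axiom(1) by (simp add: axiomatised_by_def)
  with compl show ?thesis by blast
qed

end
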